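(* Let $\epsilon>0$ be a fixed constant, let $\delta>0$, and let $p=p(n)$ satisfy $n^{-1/3+\delta}\le p\le 1/2$. Let $b=1/(1-p)$. Then asymptotically almost surely the random graph $G_{n,p}$ has the following property: for every collection $E$ of $2^{-12}\epsilon^2\frac{n^2}{\log_b^2(np)}$ pairs of vertices (edges), the chromatic number of the graph $G_{n,p}\cup E$ is at most $(1+\epsilon)\frac{n}{2\log_b(np)}$.
   Context: $G_{n,p}$ is the random graph on the vertex set $\{1,\dots,n\}$ in which each pair of vertices is an edge independently with probability $p$. $G_{n,p}\cup E$ denotes the graph on the same vertex set whose edge set is the union of the edges of $G_{n,p}$ and $E$. "Asymptotically almost surely" means with probability tending to $1$ as $n\to\infty$. $\log_b x=\log x/\log b$, where $\log$ is the natural logarithm. *)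

theory Defs
  imports "HOL-Probability.Probability" "HOL-Library.Ramsey"
begin

text \<open>A graph on a vertex set \<open>V\<close> is represented by its edge set, a subset of
  \<open>nsets V 2\<close>, the set of all two-element subsets of \<open>V\<close>.\<close>

definition proper_colouring :: "'a set \<Rightarrow> 'a set set \<Rightarrow> nat \<Rightarrow> ('a \<Rightarrow> nat) \<Rightarrow> bool" where
  "proper_colouring V G k c \<longleftrightarrow>
     c \<in> V \<rightarrow> {..<k} \<and> (\<forall>u\<in>V. \<forall>v\<in>V. {u, v} \<in> G \<longrightarrow> c u \<noteq> c v)"

text \<open>Meaningful for finite \<open>V\<close>, where \<open>card V\<close> colours always suffice.\<close>

definition chromatic_number :: "'a set \<Rightarrow> 'a set set \<Rightarrow> nat" where
  "chromatic_number V G = (LEAST k. \<exists>c. proper_colouring V G k c)"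

definition random_graph :: "nat \<Rightarrow> real \<Rightarrow> nat set set pmf" where
  "random_graph n p =
     map_pmf (\<lambda>f. {e \<in> nsets {1..n} 2. f e})
       (Pi_pmf (nsets {1..n} 2) False (\<lambda>_. bernoulli_pmf p))"

end

theory Submission
  imports Defs "HOL-Real_Asymp.Real_Asymp"
begin

text \<open>
  Write \<open>\<Lambda> = log\<^sub>b(np)\<close> and let \<open>k\<close> be slightly below \<open>2\<Lambda>\<close>. For a family \<open>K\<close> of \<open>k\<close>-subsets of a
  vertex set \<open>S\<close> consider the fractional number of pairs needed to hit every member of \<open>K\<close> that is
  independent in the random graph. It changes by at most one when a single edge is flipped, and if
  \<open>K\<close> contains half of all \<open>k\<close>-subsets, then a second moment computation for the number of
  independent sets through a given pair shows that its mean is of order \<open>|S|\<^sup>2/k\<^sup>2\<close>. As edges have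
  probability \<open>p\<close>, it falls below a smaller constant multiple of that with probability at most \<open>exp(-c|S|\<^sup>2/(k\<^sup>4 p))\<close>, which
  for \<open>p \<ge> n\<^bsup>-1/3+\<delta>\<^esup>\<close> beats a union bound over all large \<open>S\<close> and all families \<open>K\<close> given by a
  lower bound on a sum of vertex weights in \<open>{0..n}\<close>. Hence almost surely every large \<open>S\<close> contains,
  for every \<open>E\<close>, an independent \<open>k\<close>-set spanning \<open>O(k\<^sup>2/|S|\<^sup>2)\<close> of the \<open>E\<close>-edges in \<open>S\<close> and having
  at least its fair share (up to a constant) of a prescribed vertex weight.

  Given \<open>E\<close>, first give the vertices of large \<open>E\<close>-degree private colours. Then remove such
  \<open>k\<close>-sets greedily, taking the \<open>E\<close>-degree as weight, and colour each of them according to the few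
  \<open>E\<close>-edges inside. The choice of weight forces the number of remaining \<open>E\<close>-edges to decrease
  linearly with the number of remaining vertices, so that the extra cost is a convergent sum of
  order \<open>\<surd>|E|\<close> without a logarithmic loss. When only \<open>n/ln\<^sup>2 n\<close> vertices are left, the union of
  both graphs is degenerate enough to be coloured greedily.
\<close>

section \<open>A lower tail inequality for Lipschitz functions of independent bits\<close>

abbreviation bernoulli_product :: "'a set \<Rightarrow> real \<Rightarrow> ('a \<Rightarrow> bool) pmf" where
  "bernoulli_product A p \<equiv> Pi_pmf A False (\<lambda>_. bernoulli_pmf p)"

lemma finite_set_bernoulli_product:
  assumes "finite A"
  shows "finite (set_pmf (bernoulli_product A p))"
proof (rule finite_subset)
  show "set_pmf (bernoulli_product A p) \<subseteq> PiE_dflt A False (\<lambda>_. UNIV)"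
    using set_Pi_pmf_subset[OF assms, of False "\<lambda>_. bernoulli_pmf p"] by (auto simp: PiE_dflt_def)
  show "finite (PiE_dflt A False (\<lambda>_. UNIV :: bool set))"
    using assms by (rule finite_PiE_dflt) simp
qed

lemma integrable_bernoulli_product [simp]:
  fixes f :: "('a \<Rightarrow> bool) \<Rightarrow> real"
  assumes "finite A"
  shows "integrable (measure_pmf (bernoulli_product A p)) f"
  by (rule integrable_measure_pmf_finite[OF finite_set_bernoulli_product[OF assms]])

lemma expectation_bernoulli_product_insert:
  fixes f :: "('a \<Rightarrow> bool) \<Rightarrow> real"
  assumes "finite A" "x \<notin> A" "0 \<le> p" "p \<le> 1"
  shows "measure_pmf.expectation (bernoulli_product (insert x A) p) f =
    measure_pmf.expectation (bernoulli_product A p)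
      (\<lambda>g. p * f (g(x := True)) + (1 - p) * f (g(x := False)))"
proof -
  have "measure_pmf.expectation (bernoulli_product (insert x A) p) f =
    measure_pmf.expectation (bernoulli_pmf p \<bind>
      (\<lambda>y. map_pmf (\<lambda>g. g(x := y)) (bernoulli_product A p))) f"
    using assms by (simp add: Pi_pmf_insert' map_pmf_def)
  also have "\<dots> = (\<Sum>y\<in>UNIV. pmf (bernoulli_pmf p) y *\<^sub>R
      measure_pmf.expectation (map_pmf (\<lambda>g. g(x := y)) (bernoulli_product A p)) f)"
    by (rule pmf_expectation_bind) (use assms finite_set_bernoulli_product in auto)
  also have "\<dots> = measure_pmf.expectation (bernoulli_product A p)
      (\<lambda>g. p * f (g(x := True)) + (1 - p) * f (g(x := False)))"
    using assms by (simp add: UNIV_bool)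
  finally show ?thesis .
qed

text \<open>The exponent carries the factor p, the order of the variance of a sparse bit; a bound of
  Hoeffding type, using only the range of the variable, would lose it. With t = l * (v - u) the
  estimate comes from exp t <= 1 + t + t^2 for |t| <= 1 and from 1 + x <= exp x.\<close>

lemma two_point_mgf:
  fixes p u v l c :: real
  assumes p: "0 \<le> p" "p \<le> 1" and l: "0 \<le> l" "l \<le> 1" and d: "\<bar>u - v\<bar> \<le> c" "c \<le> 1"
  defines "m \<equiv> p * u + (1 - p) * v"
  shows "p * exp (l * (m - u)) + (1 - p) * exp (l * (m - v)) \<le> exp (p * l\<^sup>2 * c\<^sup>2)"
proof -
  define t where "t = l * (v - u)"
  have c0: "0 \<le> c" using d by linarith
  have "\<bar>t\<bar> \<le> 1 * 1" unfolding t_def abs_mult by (rule mult_mono) (use l d in auto)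
  hence t1: "\<bar>t\<bar> \<le> 1" by simp
  have t2: "t\<^sup>2 \<le> l\<^sup>2 * c\<^sup>2"
  proof -
    have "\<bar>t\<bar> \<le> l * c" unfolding t_def abs_mult using l d by (intro mult_mono) auto
    from power_mono[OF this, of 2] show ?thesis by (simp add: power_mult_distrib)
  qed
  have e1: "exp t \<le> 1 + t + t\<^sup>2"
  proof (cases "t \<ge> 0")
    case True thus ?thesis using exp_bound[of t] t1 by simp
  next
    case False
    \<comment> \<open>For t < 0 the quadratic Taylor bound is available only for exp (-t). Inverting
      it suffices, as (1 + t + t^2) * (1 - t + t^2 / 2) >= 1.\<close>
    have "exp (-t) \<ge> 1 + (-t) + (-t)\<^sup>2 / 2" using exp_lower_Taylor_quadratic[of "-t"] False by simp
    moreover have pos: "1 + (-t) + (-t)\<^sup>2 / 2 > 0" using False by (simp add: add_pos_nonneg)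
    ultimately have "exp t \<le> 1 / (1 - t + t\<^sup>2/2)"
      by (simp add: exp_minus field_simps)
    also have "\<dots> \<le> 1 + t + t\<^sup>2"
    proof -
      have "(1 + t + t\<^sup>2) * (1 - t + t\<^sup>2/2) = 1 + t\<^sup>2 / 2 * (1 - t + t\<^sup>2)"
        by (simp add: power2_eq_square field_simps)
      moreover have "t\<^sup>2 / 2 * (1 - t + t\<^sup>2) \<ge> 0" using False by (intro mult_nonneg_nonneg) auto
      ultimately have "1 \<le> (1 + t + t\<^sup>2) * (1 - t + t\<^sup>2/2)" by linarith
      thus ?thesis using pos by (simp add: divide_le_eq)
    qed
    finally show ?thesis .
  qed
  \<comment> \<open>Since m is the mean, the two exponents are t - p * t and - p * t. The common
    factor exp (- p * t) will cancel the linear term of p * exp t.\<close>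
  have "p * exp (l * (m - u)) + (1 - p) * exp (l * (m - v)) =
     exp (- p * t) * (p * exp t + (1 - p))"
  proof -
    have "l * (m - u) = - p * t + t" "l * (m - v) = - p * t"
      by (simp_all add: m_def t_def algebra_simps)
    thus ?thesis by (simp only: exp_add) (simp add: algebra_simps)
  qed
  also have "\<dots> \<le> exp (- p * t) * exp (p * (exp t - 1))"
    using exp_ge_add_one_self[of "p * (exp t - 1)"] by (intro mult_left_mono) (auto simp: algebra_simps)
  also have "\<dots> = exp (p * (exp t - 1 - t))" by (simp add: exp_add[symmetric] algebra_simps)
  also have "\<dots> \<le> exp (p * (l\<^sup>2 * c\<^sup>2))"
    using e1 t2 p by (intro exp_le_cancel_iff[THEN iffD2] mult_left_mono) auto
  finally show ?thesis by (simp add: mult.assoc)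
qed

text \<open>Bits are averaged out one at a time: averaging over the bit x turns f into a function h
  of the other bits with the same mean and the same Lipschitz constants, at the cost of the factor
  in \<open>two_point_mgf\<close>. This is the bounded-differences martingale argument, run as an
  induction on A.\<close>

lemma lipschitz_mgf:
  fixes f :: "('a \<Rightarrow> bool) \<Rightarrow> real" and c :: "'a \<Rightarrow> real"
  assumes "finite A" and p: "0 \<le> p" "p \<le> 1" and l: "0 \<le> l" "l \<le> 1"
    and "\<And>g e. e \<in> A \<Longrightarrow> \<bar>f (g(e := True)) - f (g(e := False))\<bar> \<le> c e"
    and "\<And>e. e \<in> A \<Longrightarrow> c e \<le> 1"
  shows "measure_pmf.expectation (bernoulli_product A p)
      (\<lambda>g. exp (l * (measure_pmf.expectation (bernoulli_product A p) f - f g)))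
    \<le> exp (p * l\<^sup>2 * (\<Sum>e\<in>A. (c e)\<^sup>2))"
  using assms(1,6,7)
proof (induction A arbitrary: f rule: finite_induct)
  case empty
  thus ?case by simp
next
  case (insert x A)
  define h where "h = (\<lambda>g. p * f (g(x := True)) + (1 - p) * f (g(x := False)))"
  let ?M = "measure_pmf.expectation (bernoulli_product A p)"
  have Ef: "measure_pmf.expectation (bernoulli_product (insert x A) p) f = ?M h"
    unfolding h_def by (rule expectation_bernoulli_product_insert) (use insert.hyps p in auto)
  have lip: "\<bar>h (g(e := True)) - h (g(e := False))\<bar> \<le> c e" if e: "e \<in> A" for g e
  proof -
    have ne: "e \<noteq> x" using e insert.hyps by auto
    have a: "\<bar>f (g(e := True, x := y)) - f (g(e := False, x := y))\<bar> \<le> c e" for y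
      using insert.prems(1)[of e "g(x := y)"] e by (simp only: fun_upd_twist[OF ne] insertI2)
    have "\<bar>h (g(e := True)) - h (g(e := False))\<bar> =
        \<bar>p * (f (g(e := True, x := True)) - f (g(e := False, x := True))) +
         (1 - p) * (f (g(e := True, x := False)) - f (g(e := False, x := False)))\<bar>"
      by (simp add: h_def algebra_simps)
    also have "\<dots> \<le> p * c e + (1 - p) * c e"
      using p a[of True] a[of False]
      by (intro order_trans[OF abs_triangle_ineq] add_mono) (auto simp: abs_mult intro!: mult_left_mono)
    finally show ?thesis by (simp add: algebra_simps)
  qed
  have "measure_pmf.expectation (bernoulli_product (insert x A) p) (\<lambda>g. exp (l * (?M h - f g)))
     = ?M (\<lambda>g. p * exp (l * (?M h - f (g(x := True)))) + (1 - p) * exp (l * (?M h - f (g(x := False)))))"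
    by (rule expectation_bernoulli_product_insert) (use insert.hyps p in auto)
  also have "\<dots> \<le> ?M (\<lambda>g. exp (l * (?M h - h g)) * exp (p * l\<^sup>2 * (c x)\<^sup>2))"
  proof (rule integral_mono)
    fix g
    have "p * exp (l * (?M h - f (g(x := True)))) + (1 - p) * exp (l * (?M h - f (g(x := False)))) =
      exp (l * (?M h - h g)) * (p * exp (l * (h g - f (g(x := True)))) + (1 - p) * exp (l * (h g - f (g(x := False)))))"
      by (simp add: algebra_simps exp_add[symmetric])
    also have "\<dots> \<le> exp (l * (?M h - h g)) * exp (p * l\<^sup>2 * (c x)\<^sup>2)"
      unfolding h_def
      using two_point_mgf[OF p l, of "f (g(x := True))" "f (g(x := False))" "c x"] insert.prems
      by (intro mult_left_mono) auto
    finally show "p * exp (l * (?M h - f (g(x := True)))) + (1 - p) * exp (l * (?M h - f (g(x := False))))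
       \<le> exp (l * (?M h - h g)) * exp (p * l\<^sup>2 * (c x)\<^sup>2)" .
  qed (use insert.hyps in auto)
  also have "\<dots> = ?M (\<lambda>g. exp (l * (?M h - h g))) * exp (p * l\<^sup>2 * (c x)\<^sup>2)"
    by simp
  also have "\<dots> \<le> exp (p * l\<^sup>2 * (\<Sum>e\<in>A. (c e)\<^sup>2)) * exp (p * l\<^sup>2 * (c x)\<^sup>2)"
    by (intro mult_right_mono insert.IH lip insert.prems) auto
  also have "\<dots> = exp (p * l\<^sup>2 * (\<Sum>e\<in>insert x A. (c e)\<^sup>2))"
    using insert.hyps by (simp add: exp_add[symmetric] algebra_simps)
  finally show ?case unfolding Ef .
qed

text \<open>Markov's inequality for the exponential moment. The parameter l stays free: it is
  optimised for cover numbers and set to 1 for edge counts.\<close>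

lemma lipschitz_lower_tail:
  fixes f :: "('a \<Rightarrow> bool) \<Rightarrow> real" and c :: "'a \<Rightarrow> real"
  assumes "finite A" and "0 \<le> p" "p \<le> 1" and "0 \<le> l" "l \<le> 1"
    and "\<And>g e. e \<in> A \<Longrightarrow> \<bar>f (g(e := True)) - f (g(e := False))\<bar> \<le> c e"
    and "\<And>e. e \<in> A \<Longrightarrow> c e \<le> 1"
  shows "measure_pmf.prob (bernoulli_product A p)
      {g. f g \<le> measure_pmf.expectation (bernoulli_product A p) f - t}
    \<le> exp (p * l\<^sup>2 * (\<Sum>e\<in>A. (c e)\<^sup>2) - l * t)"
proof -
  let ?E = "measure_pmf.expectation (bernoulli_product A p) f"
  have "measure_pmf.prob (bernoulli_product A p) {g. f g \<le> ?E - t} \<le>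
    measure_pmf.prob (bernoulli_product A p) {g. exp (l * t) \<le> exp (l * (?E - f g))}"
    using assms by (intro measure_pmf.finite_measure_mono) (auto intro!: mult_left_mono)
  also have "\<dots> \<le> measure_pmf.expectation (bernoulli_product A p) (\<lambda>g. exp (l * (?E - f g))) / exp (l * t)"
    using integral_Markov_inequality_measure[of "measure_pmf (bernoulli_product A p)" "\<lambda>g. exp (l * (?E - f g))" "{}" "exp (l * t)"]
      assms(1) by simp
  also have "\<dots> \<le> exp (p * l\<^sup>2 * (\<Sum>e\<in>A. (c e)\<^sup>2)) / exp (l * t)"
    by (intro divide_right_mono lipschitz_mgf assms) auto
  finally show ?thesis by (simp add: exp_diff)
qed

lemma expectation_all_False:
  fixes A :: "'a set" and p :: real
  assumes "finite A" "F \<subseteq> A" "0 \<le> p" "p \<le> 1"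
  shows "measure_pmf.expectation (bernoulli_product A p) (\<lambda>g. of_bool (\<forall>e\<in>F. \<not> g e)) = (1 - p) ^ card F"
proof -
  have "finite F" using assms finite_subset by blast
  have "(of_bool (\<forall>e\<in>F. \<not> g e) :: real) = (\<Prod>e\<in>A. if e \<in> F then of_bool (\<not> g e) else 1)"
    for g :: "'a \<Rightarrow> bool"
  proof -
    have "(\<Prod>e\<in>A. if e \<in> F then of_bool (\<not> g e) else 1) = (\<Prod>e\<in>F. of_bool (\<not> g e) :: real)"
      using assms by (simp add: prod.If_cases Int_absorb1)
    also have "\<dots> = of_bool (\<forall>e\<in>F. \<not> g e)" using \<open>finite F\<close> by (induction F) auto
    finally show ?thesis by simp
  qed
  hence "measure_pmf.expectation (bernoulli_product A p) (\<lambda>g. of_bool (\<forall>e\<in>F. \<not> g e)) =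
    measure_pmf.expectation (bernoulli_product A p) (\<lambda>g. \<Prod>e\<in>A. if e \<in> F then of_bool (\<not> g e) else 1 :: real)"
    by (simp only:)
  also have "\<dots> = (\<Prod>e\<in>A. measure_pmf.expectation (bernoulli_pmf p) (\<lambda>b. if e \<in> F then of_bool (\<not> b) else 1))"
    by (rule expectation_prod_Pi_pmf) (use assms in \<open>auto intro: integrable_measure_pmf_finite\<close>)
  also have "\<dots> = (\<Prod>e\<in>A. if e \<in> F then 1 - p else 1)"
    using assms by (intro prod.cong) auto
  also have "\<dots> = (1 - p) ^ card F"
    using assms by (simp add: prod.If_cases Int_absorb1)
  finally show ?thesis .
qed

section \<open>Fractional covers of independent sets\<close>

lemma card_nsets: "finite A \<Longrightarrow> card (nsets A k) = card A choose k"
proof -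
  assume f: "finite A"
  hence "nsets A k = {B. B \<subseteq> A \<and> card B = k}" by (auto simp: nsets_def finite_subset)
  thus ?thesis using n_subsets[OF f] by simp
qed

lemma choose_two_real: "real (n choose 2) = real n * (real n - 1) / 2"
  by (induction n) (auto simp: numeral_2_eq_2 algebra_simps)

lemma card_nsets_superset:
  assumes "finite S" "T \<subseteq> S" "card T \<le> k"
  shows "card {J \<in> nsets S k. T \<subseteq> J} = (card S - card T) choose (k - card T)"
proof -
  have fT: "finite T" using assms finite_subset by blast
  have "bij_betw (\<lambda>B. B \<union> T) (nsets (S - T) (k - card T)) {J \<in> nsets S k. T \<subseteq> J}"
  proof (rule bij_betw_byWitness[where f' = "\<lambda>J. J - T"])
    show "(\<lambda>B. B \<union> T) ` nsets (S - T) (k - card T) \<subseteq> {J \<in> nsets S k. T \<subseteq> J}"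
    proof clarify
      fix B assume B: "B \<in> nsets (S - T) (k - card T)"
      hence "card (B \<union> T) = k" using assms fT by (subst card_Un_disjoint) (auto simp: nsets_def)
      thus "B \<union> T \<in> nsets S k \<and> T \<subseteq> B \<union> T" using B assms fT by (auto simp: nsets_def)
    qed
    show "(\<lambda>J. J - T) ` {J \<in> nsets S k. T \<subseteq> J} \<subseteq> nsets (S - T) (k - card T)"
      using fT by (auto simp: nsets_def card_Diff_subset)
  qed (auto simp: nsets_def)
  from bij_betw_same_card[OF this] show ?thesis
    using assms fT by (simp add: card_nsets card_Diff_subset)
qed

text \<open>Each step multiplies by (r - j) / (m - j), which is at most r / m because r <=
  m.\<close>

lemma binomial_diff_le:
  assumes "j \<le> r" "r \<le> m"
  shows "real ((m - j) choose (r - j)) \<le> (real r / real m) ^ j * real (m choose r)"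
  using assms
proof (induction j)
  case 0 thus ?case by simp
next
  case (Suc j)
  obtain a c where a: "m - j = Suc a" and c: "r - j = Suc c" using Suc.prems by (metis Suc_diff_Suc Suc_le_lessD order.strict_trans1 less_le_trans)
  have eq: "m - Suc j = a" "r - Suc j = c" using a c by auto
  have "real (Suc a) * real (a choose c) = real (Suc c) * real (Suc a choose Suc c)"
    using Suc_times_binomial_eq[of a c] by (metis of_nat_mult mult.commute)
  hence "real (a choose c) = real (Suc c) / real (Suc a) * real (Suc a choose Suc c)"
    by (simp add: field_simps)
  also have "\<dots> \<le> real r / real m * real (Suc a choose Suc c)"
  proof (rule mult_right_mono)
    have "real (Suc c) = real r - real j" "real (Suc a) = real m - real j"
      using a c Suc.prems by linarith+
    hence "real (Suc c) * real m \<le> real r * real (Suc a)"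
      using Suc.prems by (simp only:) (simp add: algebra_simps mult_left_mono)
    thus "real (Suc c) / real (Suc a) \<le> real r / real m"
      using Suc.prems by (simp only: divide_le_eq pos_le_divide_eq) (simp add: divide_simps)
  qed simp
  also have "\<dots> \<le> real r / real m * ((real r / real m) ^ j * real (m choose r))"
    using Suc.IH Suc.prems a c by (intro mult_left_mono) auto
  finally show ?case unfolding eq by (simp add: algebra_simps)
qed

section \<open>Fractional covers and double counting\<close>

text \<open>A fractional transversal of the hypergraph whose points are pairs and whose edges are
  the pair sets of the independent members of K. The cap at 1 lets the surplus in
  \<open>cover_number_lower_bound\<close> count at most once per pair.\<close>

definition frac_cover :: "'a set set \<Rightarrow> ('a set \<Rightarrow> bool) \<Rightarrow> ('a set \<Rightarrow> real) \<Rightarrow> bool" where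
  "frac_cover K g w \<longleftrightarrow> (\<forall>e. 0 \<le> w e \<and> w e \<le> 1) \<and>
     (\<forall>I\<in>K. (\<forall>e\<in>nsets I 2. \<not> g e) \<longrightarrow> 1 \<le> (\<Sum>e\<in>nsets I 2. w e))"

text \<open>A linear-programming value instead of an integral hitting number, because a constant
  weight 1 / r on an arbitrary pair set E is tested against it in
  \<open>light_independent_set\<close>.\<close>

definition cover_number :: "'a set \<Rightarrow> 'a set set \<Rightarrow> ('a set \<Rightarrow> bool) \<Rightarrow> real" where
  "cover_number S K g = Inf {\<Sum>e\<in>nsets S 2. w e | w. frac_cover K g w}"

lemma cover_number_le:
  assumes "frac_cover K g w"
  shows "cover_number S K g \<le> (\<Sum>e\<in>nsets S 2. w e)"
  unfolding cover_number_def
proof (rule cInf_lower)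
  show "bdd_below {\<Sum>e\<in>nsets S 2. w e |w. frac_cover K g w}"
    by (rule bdd_belowI[of _ 0]) (auto simp: frac_cover_def intro!: sum_nonneg)
qed (use assms in auto)

text \<open>As k >= 2, every member of K contains a pair, so the infimum in
  \<open>cover_number\<close> is over a nonempty set.\<close>

lemma frac_cover_one:
  assumes "K \<subseteq> nsets S k" "k \<ge> 2"
  shows "frac_cover K g (\<lambda>_. 1)"
proof -
  have "1 \<le> (\<Sum>e\<in>nsets I 2. 1 :: real)" if "I \<in> K" for I
  proof -
    have I: "finite I" "card I = k" using that assms by (auto simp: nsets_def)
    have "1 \<le> k choose 2" using zero_less_binomial[OF assms(2)] by linarith
    thus ?thesis using I by (simp add: card_nsets del: One_nat_def)
  qed
  thus ?thesis by (simp add: frac_cover_def)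
qed

lemma cover_number_greatest:
  assumes "K \<subseteq> nsets S k" "k \<ge> 2"
    and "\<And>w. frac_cover K g w \<Longrightarrow> z \<le> (\<Sum>e\<in>nsets S 2. w e)"
  shows "z \<le> cover_number S K g"
  unfolding cover_number_def
  by (rule cInf_greatest) (use frac_cover_one[OF assms(1,2)] assms(3) in auto)

text \<open>Making e an edge only drops constraints, so the value cannot rise. Making e a non-edge
  restores constraints that all involve e, and raising the weight of e to 1 meets them at extra cost
  at most 1.\<close>

lemma cover_number_lipschitz:
  assumes S: "finite S" and K: "K \<subseteq> nsets S k" "k \<ge> 2"
  shows "\<bar>cover_number S K (g(e := True)) - cover_number S K (g(e := False))\<bar> \<le> of_bool (e \<in> nsets S 2)"
proof -
  have sub: "nsets I 2 \<subseteq> nsets S 2" if "I \<in> K" for I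
    using that K by (intro nsets_mono) (auto simp: nsets_def)
  have fin: "finite (nsets I 2)" if "I \<in> K" for I
    using that K by (intro finite_imp_finite_nsets) (auto simp: nsets_def)
  have "cover_number S K (g(e := False)) - of_bool (e \<in> nsets S 2) \<le> cover_number S K (g(e := True))"
  proof (rule cover_number_greatest[OF K])
    fix w assume w: "frac_cover K (g(e := True)) w"
    have w01: "0 \<le> w f" "w f \<le> 1" for f using w by (auto simp: frac_cover_def)
    have "frac_cover K (g(e := False)) (w(e := 1))"
      unfolding frac_cover_def
    proof (intro conjI allI ballI impI)
      fix I assume I: "I \<in> K" and ind: "\<forall>f\<in>nsets I 2. \<not> (g(e := False)) f"
      show "1 \<le> (\<Sum>f\<in>nsets I 2. (w(e := 1)) f)"
      proof (cases "e \<in> nsets I 2")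
        case True
        have "(\<Sum>f\<in>{e}. (w(e := 1)) f) \<le> (\<Sum>f\<in>nsets I 2. (w(e := 1)) f)"
          by (rule sum_mono2) (use True fin[OF I] w01 in auto)
        thus ?thesis by simp
      next
        case False
        hence "\<forall>f\<in>nsets I 2. \<not> (g(e := True)) f" using ind by (metis fun_upd_apply)
        hence "1 \<le> (\<Sum>f\<in>nsets I 2. w f)" using w I by (auto simp: frac_cover_def)
        also have "\<dots> = (\<Sum>f\<in>nsets I 2. (w(e := 1)) f)" by (rule sum.cong) (use False in auto)
        finally show ?thesis .
      qed
    qed (use w01 in auto)
    from cover_number_le[OF this, of S]
    have "cover_number S K (g(e := False)) \<le> (\<Sum>f\<in>nsets S 2. (w(e := 1)) f)" .
    also have "\<dots> \<le> (\<Sum>f\<in>nsets S 2. w f + of_bool (f = e))"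
      using w01 by (intro sum_mono) auto
    also have "\<dots> = (\<Sum>f\<in>nsets S 2. w f) + of_bool (e \<in> nsets S 2)"
      using finite_imp_finite_nsets[OF S] by (simp add: sum.distrib of_bool_def)
    finally show "cover_number S K (g(e := False)) - of_bool (e \<in> nsets S 2) \<le> (\<Sum>f\<in>nsets S 2. w f)"
      by simp
  qed
  moreover have "cover_number S K (g(e := True)) \<le> cover_number S K (g(e := False))"
  proof (rule cover_number_greatest[OF K])
    fix w assume w: "frac_cover K (g(e := False)) w"
    have "frac_cover K (g(e := True)) w"
      using w unfolding frac_cover_def by (metis fun_upd_apply)
    thus "cover_number S K (g(e := True)) \<le> (\<Sum>f\<in>nsets S 2. w f)" by (rule cover_number_le)
  qed
  ultimately show ?thesis by linarith
qed

text \<open>The pair \<open>e\<close> itself is not required to be a non-edge: otherwise the count would vanish with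
  probability \<open>p\<close> and would not be concentrated.\<close>

definition ext_count :: "'a set \<Rightarrow> nat \<Rightarrow> 'a set \<Rightarrow> ('a set \<Rightarrow> bool) \<Rightarrow> nat" where
  "ext_count S k e g = card {I \<in> nsets S k. e \<subseteq> I \<and> (\<forall>f\<in>nsets I 2 - {e}. \<not> g f)}"

text \<open>Weak duality by double counting: every independent member of K collects weight at least
  1, and a pair e passes its weight on to at most \<open>ext_count\<close> of them. This contributes
  at most a * w e, plus the surplus of \<open>ext_count\<close> over a, which is subtracted
  separately.\<close>

lemma cover_number_lower_bound:
  assumes S: "finite S" and K: "K \<subseteq> nsets S k" "k \<ge> 2" and a: "a > 0"
  shows "real (card {I \<in> K. \<forall>e\<in>nsets I 2. \<not> g e}) -
     (\<Sum>e\<in>nsets S 2. max 0 (real (ext_count S k e g) - a)) \<le> a * cover_number S K g"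
proof -
  define N where "N = {I \<in> K. \<forall>e\<in>nsets I 2. \<not> g e}"
  define R where "R = (\<Sum>e\<in>nsets S 2. max 0 (real (ext_count S k e g) - a))"
  have finK: "finite (nsets S k)" using finite_imp_finite_nsets[OF S] .
  hence finN: "finite N" using K unfolding N_def by (auto intro: finite_subset)
  have fin2: "finite (nsets S 2)" using finite_imp_finite_nsets[OF S] .
  have "(real (card N) - R) / a \<le> cover_number S K g"
  proof (rule cover_number_greatest[OF K])
    fix w assume w: "frac_cover K g w"
    have w01: "0 \<le> w f" "w f \<le> 1" for f using w by (auto simp: frac_cover_def)
    have "real (card N) = (\<Sum>I\<in>N. 1)" by simp
    also have "\<dots> \<le> (\<Sum>I\<in>N. \<Sum>e\<in>nsets I 2. w e)"
      using w by (intro sum_mono) (auto simp: frac_cover_def N_def)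
    also have "\<dots> = (\<Sum>I\<in>N. \<Sum>e\<in>nsets S 2. if e \<subseteq> I then w e else 0)"
    proof (rule sum.cong[OF refl])
      fix I assume "I \<in> N"
      hence "I \<subseteq> S" using K by (auto simp: N_def nsets_def)
      hence "nsets I 2 = {e \<in> nsets S 2. e \<subseteq> I}" by (auto simp: nsets_def)
      thus "(\<Sum>e\<in>nsets I 2. w e) = (\<Sum>e\<in>nsets S 2. if e \<subseteq> I then w e else 0)"
        using fin2 by (simp add: sum.inter_filter)
    qed
    also have "\<dots> = (\<Sum>e\<in>nsets S 2. \<Sum>I\<in>N. if e \<subseteq> I then w e else 0)" by (rule sum.swap)
    also have "\<dots> = (\<Sum>e\<in>nsets S 2. w e * real (card {I \<in> N. e \<subseteq> I}))"
      using finN by (simp add: sum.inter_filter[symmetric] mult.commute)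
    also have "\<dots> \<le> (\<Sum>e\<in>nsets S 2. a * w e + max 0 (real (ext_count S k e g) - a))"
    proof (rule sum_mono)
      fix e assume e: "e \<in> nsets S 2"
      have "card {I \<in> N. e \<subseteq> I} \<le> ext_count S k e g"
        unfolding ext_count_def using K finK by (intro card_mono) (auto simp: N_def)
      hence "w e * real (card {I \<in> N. e \<subseteq> I}) \<le> w e * real (ext_count S k e g)"
        using w01 by (intro mult_left_mono) auto
      also have "\<dots> = a * w e + w e * (real (ext_count S k e g) - a)" by (simp add: algebra_simps)
      also have "w e * (real (ext_count S k e g) - a) \<le> w e * max 0 (real (ext_count S k e g) - a)"
        using w01 by (intro mult_left_mono) auto
      also have "\<dots> \<le> max 0 (real (ext_count S k e g) - a)"
        using w01 by (intro mult_left_le_one_le) auto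
      finally show "w e * real (card {I \<in> N. e \<subseteq> I}) \<le> a * w e + max 0 (real (ext_count S k e g) - a)"
        by simp
    qed
    also have "\<dots> = a * (\<Sum>e\<in>nsets S 2. w e) + R" by (simp add: R_def sum.distrib sum_distrib_left)
    finally show "(real (card N) - R) / a \<le> (\<Sum>e\<in>nsets S 2. w e)"
      using a by (simp add: field_simps)
  qed
  thus ?thesis using a by (simp add: field_simps N_def R_def)
qed

section \<open>The second moment of the number of independent sets through a pair\<close>

text \<open>This will bound the relative variance of \<open>ext_count\<close> when |S| = m. Here j
  is the number of vertices shared by two k-sets besides those of e, so that
  \<open>((j + 2) choose 2) - 1\<close> pairs are shared besides e, and (k / m)^j bounds the
  fraction of the k-sets through e that contain j further prescribed vertices.\<close>

definition overlap_sum :: "nat \<Rightarrow> nat \<Rightarrow> real \<Rightarrow> real" where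
  "overlap_sum k m b = (\<Sum>j\<le>k - 2. real ((k - 2) choose j) * (real k / real m) ^ j * (b ^ (((j + 2) choose 2) - 1) - 1))"

text \<open>The term of J is enlarged to a sum over all T between e and I with T contained in J. For
  fixed T the sets J are then counted by one binomial coefficient, without prescribing the exact
  intersection, and only the size of T matters.\<close>

lemma sum_overlap_le:
  assumes S: "finite S" and e: "e \<in> nsets S 2" and I: "I \<in> nsets S k" "e \<subseteq> I" and k: "k \<ge> 2" and b: "b \<ge> 1"
  shows "(\<Sum>J \<in> {J \<in> nsets S k. e \<subseteq> J}. b ^ ((card (I \<inter> J) choose 2) - 1) - 1)
     \<le> real ((card S - 2) choose (k - 2)) * overlap_sum k (card S) b"
proof -
  define F where "F = {J \<in> nsets S k. e \<subseteq> J}"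
  define \<phi> where "\<phi> = (\<lambda>i :: nat. b ^ ((i choose 2) - 1) - 1)"
  define \<T> where "\<T> = {T. e \<subseteq> T \<and> T \<subseteq> I}"
  have \<phi>0: "0 \<le> \<phi> i" for i using b by (simp add: \<phi>_def one_le_power)
  have finF: "finite F" using finite_imp_finite_nsets[OF S] by (simp add: F_def)
  have I': "finite I" "card I = k" "I \<subseteq> S" using I by (auto simp: nsets_def)
  have fin\<T>: "finite \<T>" using I' by (auto simp: \<T>_def intro: finite_subset[of _ "Pow I"])
  have ce: "card e = 2" "finite e" using e by (auto simp: nsets_def)
  have kS: "k \<le> card S" using I' S card_mono by metis
  have cT: "2 \<le> card T" "card T \<le> k" "finite T" if "T \<in> \<T>" for T
  proof -
    have T: "e \<subseteq> T" "T \<subseteq> I" using that by (auto simp: \<T>_def)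
    show f: "finite T" using T I' finite_subset by blast
    show "2 \<le> card T" using card_mono[OF f T(1)] ce by simp
    show "card T \<le> k" using card_mono[OF I'(1) T(2)] I' by simp
  qed
  \<comment> \<open>All terms are nonnegative, and T = I \<inter> J alone already gives the left
    side.\<close>
  have "(\<Sum>J\<in>F. \<phi> (card (I \<inter> J))) \<le> (\<Sum>J\<in>F. \<Sum>T\<in>\<T>. if T \<subseteq> J then \<phi> (card T) else 0)"
  proof (rule sum_mono)
    fix J assume J: "J \<in> F"
    have "(\<Sum>T\<in>{I \<inter> J}. if T \<subseteq> J then \<phi> (card T) else 0) \<le> (\<Sum>T\<in>\<T>. if T \<subseteq> J then \<phi> (card T) else 0)"
      by (rule sum_mono2) (use fin\<T> J I \<phi>0 in \<open>auto simp: \<T>_def F_def\<close>)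
    thus "\<phi> (card (I \<inter> J)) \<le> (\<Sum>T\<in>\<T>. if T \<subseteq> J then \<phi> (card T) else 0)" by simp
  qed
  also have "\<dots> = (\<Sum>T\<in>\<T>. \<Sum>J\<in>F. if T \<subseteq> J then \<phi> (card T) else 0)" by (rule sum.swap)
  also have "\<dots> = (\<Sum>T\<in>\<T>. \<phi> (card T) * real (card {J \<in> F. T \<subseteq> J}))"
    using finF by (simp add: sum.inter_filter[symmetric] mult.commute)
  also have "\<dots> = (\<Sum>T\<in>\<T>. \<phi> (card T) * real ((card S - card T) choose (k - card T)))"
  proof (rule sum.cong[OF refl])
    fix T assume T: "T \<in> \<T>"
    have "{J \<in> F. T \<subseteq> J} = {J \<in> nsets S k. T \<subseteq> J}" using T by (auto simp: F_def \<T>_def)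
    moreover have "T \<subseteq> S" using T I' by (auto simp: \<T>_def)
    ultimately show "\<phi> (card T) * real (card {J \<in> F. T \<subseteq> J}) = \<phi> (card T) * real ((card S - card T) choose (k - card T))"
      using cT[OF T] by (simp add: card_nsets_superset[OF S])
  qed
  also have "\<dots> = (\<Sum>j\<le>k - 2. \<Sum>T\<in>{T \<in> \<T>. card T - 2 = j}. \<phi> (card T) * real ((card S - card T) choose (k - card T)))"
  proof (rule sum.group[symmetric, OF fin\<T>])
    show "(\<lambda>T. card T - 2) ` \<T> \<subseteq> {..k - 2}" using cT(2) diff_le_mono by fastforce
  qed simp
  also have "\<dots> = (\<Sum>j\<le>k - 2. \<phi> (j + 2) * real ((card S - 2 - j) choose (k - 2 - j)) * real ((k - 2) choose j))"
  proof (rule sum.cong[OF refl])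
    fix j assume j: "j \<in> {..k - 2}"
    have "{T \<in> \<T>. card T - 2 = j} = {T \<in> nsets I (j + 2). e \<subseteq> T}"
    proof (intro equalityI subsetI)
      fix T assume T: "T \<in> {T \<in> \<T>. card T - 2 = j}"
      hence "T \<in> \<T>" "card T = j + 2" using cT(1)[of T] by auto
      thus "T \<in> {T \<in> nsets I (j + 2). e \<subseteq> T}" using cT(3)[of T] by (simp add: \<T>_def nsets_def)
    next
      fix T assume T: "T \<in> {T \<in> nsets I (j + 2). e \<subseteq> T}"
      thus "T \<in> {T \<in> \<T>. card T - 2 = j}" by (simp add: \<T>_def nsets_def)
    qed
    hence c: "card {T \<in> \<T>. card T - 2 = j} = (k - 2) choose j"
      using card_nsets_superset[OF I'(1) I(2), of "j + 2"] ce I' by simp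
    have "(\<Sum>T\<in>{T \<in> \<T>. card T - 2 = j}. \<phi> (card T) * real ((card S - card T) choose (k - card T))) =
      (\<Sum>T\<in>{T \<in> \<T>. card T - 2 = j}. \<phi> (j + 2) * real ((card S - 2 - j) choose (k - 2 - j)))"
    proof (rule sum.cong[OF refl])
      fix T assume "T \<in> {T \<in> \<T>. card T - 2 = j}"
      hence "card T = j + 2" using cT[of T] by auto
      thus "\<phi> (card T) * real ((card S - card T) choose (k - card T)) = \<phi> (j + 2) * real ((card S - 2 - j) choose (k - 2 - j))"
        by (simp add: diff_diff_add add.commute)
    qed
    thus "(\<Sum>T\<in>{T \<in> \<T>. card T - 2 = j}. \<phi> (card T) * real ((card S - card T) choose (k - card T))) =
        \<phi> (j + 2) * real ((card S - 2 - j) choose (k - 2 - j)) * real ((k - 2) choose j)"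
      using c by simp
  qed
  also have "\<dots> \<le> (\<Sum>j\<le>k - 2. \<phi> (j + 2) * ((real k / real (card S)) ^ j * real ((card S - 2) choose (k - 2))) * real ((k - 2) choose j))"
  proof (intro sum_mono mult_right_mono mult_left_mono \<phi>0)
    fix j assume j: "j \<in> {..k - 2}"
    have "real ((card S - 2 - j) choose (k - 2 - j)) \<le> (real (k - 2) / real (card S - 2)) ^ j * real ((card S - 2) choose (k - 2))"
      using j kS k by (intro binomial_diff_le) auto
    also have "\<dots> \<le> (real k / real (card S)) ^ j * real ((card S - 2) choose (k - 2))"
    proof (intro mult_right_mono power_mono)
      have *: "real (k - 2) = real k - 2" "real (card S - 2) = real (card S) - 2" "real k \<le> real (card S)" "real k \<ge> 2"
        using k kS by (auto simp: of_nat_diff)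
      \<comment> \<open>For card S = 2 the quotient has denominator 0 and equals 0 by convention, so
        that case is settled apart.\<close>
      have "(real k - 2) / (real (card S) - 2) \<le> real k / real (card S)" if "real (card S) > 2"
        using that * by (simp add: divide_simps algebra_simps)
      thus "real (k - 2) / real (card S - 2) \<le> real k / real (card S)"
        using * by (cases "card S = 2") auto
    qed auto
    finally show "real ((card S - 2 - j) choose (k - 2 - j)) \<le> (real k / real (card S)) ^ j * real ((card S - 2) choose (k - 2))" .
  qed auto
  also have "\<dots> = real ((card S - 2) choose (k - 2)) * overlap_sum k (card S) b"
    unfolding overlap_sum_def sum_distrib_left by (rule sum.cong) (auto simp: \<phi>_def)
  finally show ?thesis unfolding F_def \<phi>_def .
qed

lemma real_ext_count:
  assumes "finite S"
  shows "real (ext_count S k e g) = (\<Sum>I\<in>{I \<in> nsets S k. e \<subseteq> I}. of_bool (\<forall>f\<in>nsets I 2 - {e}. \<not> g f))"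
proof -
  have "{I \<in> nsets S k. e \<subseteq> I \<and> (\<forall>f\<in>nsets I 2 - {e}. \<not> g f)} =
    {I \<in> {I \<in> nsets S k. e \<subseteq> I}. \<forall>f\<in>nsets I 2 - {e}. \<not> g f}" by auto
  thus ?thesis unfolding ext_count_def using finite_imp_finite_nsets[OF assms]
    by (simp add: of_bool_def sum.inter_filter[symmetric] del: mem_Collect_eq)
qed

lemma expectation_ext_count:
  assumes A: "finite A" "nsets S 2 \<subseteq> A" and S: "finite S" and e: "e \<in> nsets S 2" and k: "k \<ge> 2"
    and p: "0 \<le> p" "p \<le> 1"
  shows "measure_pmf.expectation (bernoulli_product A p) (\<lambda>g. real (ext_count S k e g)) =
     real ((card S - 2) choose (k - 2)) * (1 - p) ^ ((k choose 2) - 1)"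
proof -
  let ?F = "{I \<in> nsets S k. e \<subseteq> I}"
  have ce: "card e = 2" "finite e" "e \<subseteq> S" using e by (auto simp: nsets_def)
  have "measure_pmf.expectation (bernoulli_product A p) (\<lambda>g. real (ext_count S k e g)) =
    (\<Sum>I\<in>?F. measure_pmf.expectation (bernoulli_product A p) (\<lambda>g. of_bool (\<forall>f\<in>nsets I 2 - {e}. \<not> g f)))"
    unfolding real_ext_count[OF S] using A by (intro Bochner_Integration.integral_sum) simp
  also have "\<dots> = (\<Sum>I\<in>?F. (1 - p) ^ ((k choose 2) - 1))"
  proof (rule sum.cong[OF refl])
    fix I assume "I \<in> ?F"
    hence I: "finite I" "card I = k" "e \<subseteq> I" "I \<subseteq> S" by (auto simp: nsets_def)
    have sub: "nsets I 2 - {e} \<subseteq> A" using nsets_mono[OF I(4), of 2] A by auto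
    have "e \<in> nsets I 2" using I ce by (auto simp: nsets_def)
    hence c: "card (nsets I 2 - {e}) = (k choose 2) - 1"
      using I by (simp add: card_nsets)
    show "measure_pmf.expectation (bernoulli_product A p) (\<lambda>g. of_bool (\<forall>f\<in>nsets I 2 - {e}. \<not> g f)) = (1 - p) ^ ((k choose 2) - 1)"
      using expectation_all_False[OF A(1) sub p] c by simp
  qed
  also have "\<dots> = real (card ?F) * (1 - p) ^ ((k choose 2) - 1)" by simp
  also have "card ?F = (card S - 2) choose (k - 2)"
    using card_nsets_superset[OF S ce(3), of k] ce k by simp
  finally show ?thesis .
qed

text \<open>The events for I and J are correlated only through shared pairs: their joint probability
  is the product of the two, times b to the number of pairs shared besides e. Subtracting \<mu>^2
  leaves, for each I, exactly the sum treated in \<open>sum_overlap_le\<close>.\<close>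

lemma variance_ext_count:
  assumes A: "finite A" "nsets S 2 \<subseteq> A" and S: "finite S" and e: "e \<in> nsets S 2" and k: "k \<ge> 2"
    and p: "0 \<le> p" "p < 1"
  defines "\<mu> \<equiv> real ((card S - 2) choose (k - 2)) * (1 - p) ^ ((k choose 2) - 1)"
  shows "measure_pmf.expectation (bernoulli_product A p) (\<lambda>g. (real (ext_count S k e g) - \<mu>)\<^sup>2)
     \<le> \<mu>\<^sup>2 * overlap_sum k (card S) (1 / (1 - p))"
proof -
  define b where "b = 1 / (1 - p)"
  define F where "F = {I \<in> nsets S k. e \<subseteq> I}"
  let ?E = "measure_pmf.expectation (bernoulli_product A p)"
  have b1: "b \<ge> 1" using p by (simp add: b_def)
  have ce: "card e = 2" "finite e" "e \<subseteq> S" using e by (auto simp: nsets_def)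
  have cF: "card F = (card S - 2) choose (k - 2)"
    using card_nsets_superset[OF S ce(3), of k] ce k by (simp add: F_def)
  have k1: "1 \<le> k choose 2" using zero_less_binomial[OF k] by linarith
  have pair: "?E (\<lambda>g. of_bool (\<forall>f\<in>nsets I 2 - {e}. \<not> g f) * of_bool (\<forall>f\<in>nsets J 2 - {e}. \<not> g f)) =
      (1 - p) ^ (2 * ((k choose 2) - 1)) * b ^ ((card (I \<inter> J) choose 2) - 1)" if "I \<in> F" "J \<in> F" for I J
  proof -
    have I: "finite I" "card I = k" "e \<subseteq> I" "I \<subseteq> S" and J: "finite J" "card J = k" "e \<subseteq> J" "J \<subseteq> S"
      using that by (auto simp: nsets_def F_def)
    define U where "U = nsets I 2 \<union> nsets J 2 - {e}"
    define i2 where "i2 = card (I \<inter> J) choose 2"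
    have int: "nsets I 2 \<inter> nsets J 2 = nsets (I \<inter> J) 2" by (auto simp: nsets_def)
    have fin: "finite (nsets I 2)" "finite (nsets J 2)" using I J finite_imp_finite_nsets by blast+
    have eU: "e \<in> nsets I 2 \<union> nsets J 2" using I ce by (auto simp: nsets_def)
    have ci: "card (nsets (I \<inter> J) 2) = i2" using I by (simp add: card_nsets i2_def)
    have "2 \<le> card (I \<inter> J)" using card_mono[of "I \<inter> J" e] I J ce by auto
    hence i1: "1 \<le> i2" unfolding i2_def using zero_less_binomial[of 2 "card (I \<inter> J)"] by linarith
    have ik: "i2 \<le> k choose 2"
      using card_mono[OF fin(1), of "nsets (I \<inter> J) 2"] ci I int by (auto simp: card_nsets)
    have "card (nsets I 2 \<union> nsets J 2) + i2 = 2 * (k choose 2)"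
      using card_Un_Int[OF fin] int ci I J by (simp add: card_nsets)
    moreover have "card U = card (nsets I 2 \<union> nsets J 2) - 1" unfolding U_def using eU fin by simp
    \<comment> \<open>Inclusion-exclusion for the pair sets, where e is dropped once from the union
      and once from the intersection. The bounds \<open>i1\<close> and \<open>k1\<close> keep the
      natural subtractions exact.\<close>
    ultimately have cU: "card U + (i2 - 1) = 2 * ((k choose 2) - 1)" using i1 ik k1 by linarith
    have sub: "U \<subseteq> A" using nsets_mono[OF I(4), of 2] nsets_mono[OF J(4), of 2] A by (auto simp: U_def)
    have "(\<lambda>g. of_bool (\<forall>f\<in>nsets I 2 - {e}. \<not> g f) * of_bool (\<forall>f\<in>nsets J 2 - {e}. \<not> g f)) =
        (\<lambda>g. of_bool (\<forall>f\<in>U. \<not> g f) :: real)"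
      unfolding U_def of_bool_conj[symmetric] by (intro ext arg_cong[where f = of_bool]) blast
    hence "?E (\<lambda>g. of_bool (\<forall>f\<in>nsets I 2 - {e}. \<not> g f) * of_bool (\<forall>f\<in>nsets J 2 - {e}. \<not> g f)) = (1 - p) ^ card U"
      using expectation_all_False[OF A(1) sub] p by simp
    also have "\<dots> = (1 - p) ^ (card U + (i2 - 1)) * b ^ (i2 - 1)"
      using p by (simp add: b_def power_add power_one_over)
    finally show ?thesis unfolding cU unfolding i2_def .
  qed
  have sq: "(real (ext_count S k e g))\<^sup>2 =
      (\<Sum>I\<in>F. \<Sum>J\<in>F. of_bool (\<forall>f\<in>nsets I 2 - {e}. \<not> g f) * of_bool (\<forall>f\<in>nsets J 2 - {e}. \<not> g f))" for g
    unfolding real_ext_count[OF S] F_def power2_eq_square sum_product ..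
  have Esq: "?E (\<lambda>g. (real (ext_count S k e g))\<^sup>2) =
      (\<Sum>I\<in>F. \<Sum>J\<in>F. (1 - p) ^ (2 * ((k choose 2) - 1)) * b ^ ((card (I \<inter> J) choose 2) - 1))"
    unfolding sq using A(1) by (simp add: pair Bochner_Integration.integral_sum cong: sum.cong)
  have mu: "\<mu>\<^sup>2 = (\<Sum>I\<in>F. \<Sum>J\<in>F. (1 - p) ^ (2 * ((k choose 2) - 1)))"
    by (simp add: \<mu>_def cF power2_eq_square power_mult power_mult_distrib power_even_eq)
  have EY: "?E (\<lambda>g. real (ext_count S k e g)) = \<mu>"
    unfolding \<mu>_def using p by (intro expectation_ext_count A S e k) auto
  have "?E (\<lambda>g. (real (ext_count S k e g) - \<mu>)\<^sup>2) =
      ?E (\<lambda>g. (real (ext_count S k e g))\<^sup>2 - 2 * \<mu> * real (ext_count S k e g) + \<mu>\<^sup>2)"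
    by (simp add: power2_diff algebra_simps)
  also have "\<dots> = ?E (\<lambda>g. (real (ext_count S k e g))\<^sup>2) - 2 * \<mu> * ?E (\<lambda>g. real (ext_count S k e g)) + \<mu>\<^sup>2"
    using A(1) by simp
  also have "\<dots> = ?E (\<lambda>g. (real (ext_count S k e g))\<^sup>2) - \<mu>\<^sup>2"
    unfolding EY by (simp add: power2_eq_square)
  also have "\<dots> = (1 - p) ^ (2 * ((k choose 2) - 1)) * (\<Sum>I\<in>F. \<Sum>J\<in>F. b ^ ((card (I \<inter> J) choose 2) - 1) - 1)"
    unfolding Esq mu by (simp add: sum_subtractf sum_distrib_left right_diff_distrib)
  also have "\<dots> \<le> (1 - p) ^ (2 * ((k choose 2) - 1)) * (\<Sum>I\<in>F. real ((card S - 2) choose (k - 2)) * overlap_sum k (card S) b)"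
  proof (intro mult_left_mono sum_mono)
    fix I assume "I \<in> F"
    thus "(\<Sum>J\<in>F. b ^ ((card (I \<inter> J) choose 2) - 1) - 1) \<le> real ((card S - 2) choose (k - 2)) * overlap_sum k (card S) b"
      using sum_overlap_le[OF S e _ _ k b1, of I] by (simp add: F_def)
  qed (use p in auto)
  also have "\<dots> = \<mu>\<^sup>2 * overlap_sum k (card S) b"
    by (simp add: \<mu>_def cF power2_eq_square power_mult power_mult_distrib power_even_eq)
  finally show ?thesis by (simp add: b_def)
qed

text \<open>Without the maximum the two sides differ by (x - 2 * m)^2 / (2 * m). This converts the
  expected surplus over 3/2 of the mean into a variance.\<close>

lemma excess_le_square:
  fixes x m :: real
  assumes "m > 0"
  shows "max 0 (x - 3 / 2 * m) \<le> (x - m)\<^sup>2 / (2 * m)"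
proof -
  have "2 * m * (x - 3 / 2 * m) \<le> (x - m)\<^sup>2"
    using zero_le_power2[of "x - 2 * m"] by (simp add: power2_eq_square algebra_simps)
  hence "x - 3 / 2 * m \<le> (x - m)\<^sup>2 / (2 * m)" using assms by (simp add: field_simps)
  thus ?thesis using assms by simp
qed

text \<open>\<open>cover_number_lower_bound\<close> is averaged with a = 3/2 * \<mu>. K has density
  at least one half, so its expected number of independent members is at least half of that for all
  k-sets, and the variance bound makes the expected surplus a small fraction of it. Uniform weights
  on all pairs show that the order |S|^2 / k^2 is right.\<close>

lemma expectation_cover_number:
  assumes A: "finite A" "nsets S 2 \<subseteq> A" and S: "finite S" and K: "K \<subseteq> nsets S k" and k: "k \<ge> 2"
    and p: "0 \<le> p" "p \<le> 1 / 2" and kS: "k \<le> card S"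
    and dens: "2 * card K \<ge> card S choose k"
    and ov: "(real k)\<^sup>2 * overlap_sum k (card S) (1 / (1 - p)) \<le> 1 / 10"
  shows "measure_pmf.expectation (bernoulli_product A p) (cover_number S K) \<ge> (real (card S))\<^sup>2 / (7 * (real k)\<^sup>2)"
proof -
  define V where "V = overlap_sum k (card S) (1 / (1 - p))"
  define \<mu> where "\<mu> = real ((card S - 2) choose (k - 2)) * (1 - p) ^ ((k choose 2) - 1)"
  let ?E = "measure_pmf.expectation (bernoulli_product A p)"
  have \<mu>0: "\<mu> > 0" unfolding \<mu>_def using p k kS by (auto intro!: mult_pos_pos)
  have k2: "real (k choose 2) > 0" using zero_less_binomial[OF k] by simp
  have fin2: "finite (nsets S 2)" using finite_imp_finite_nsets[OF S] .
  have finK: "finite K" using K finite_imp_finite_nsets[OF S] finite_subset by blast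
  have N: "?E (\<lambda>g. real (card {I \<in> K. \<forall>e\<in>nsets I 2. \<not> g e})) = real (card K) * (1 - p) ^ (k choose 2)"
  proof -
    have "?E (\<lambda>g. real (card {I \<in> K. \<forall>e\<in>nsets I 2. \<not> g e})) = ?E (\<lambda>g. \<Sum>I\<in>K. of_bool (\<forall>e\<in>nsets I 2. \<not> g e))"
      using finK by (simp add: of_bool_def sum.inter_filter[symmetric])
    also have "\<dots> = (\<Sum>I\<in>K. ?E (\<lambda>g. of_bool (\<forall>e\<in>nsets I 2. \<not> g e)))"
      using A by (intro Bochner_Integration.integral_sum) simp
    also have "\<dots> = (\<Sum>I\<in>K. (1 - p) ^ (k choose 2))"
    proof (rule sum.cong[OF refl])
      fix I assume "I \<in> K"
      hence I: "finite I" "card I = k" "I \<subseteq> S" using K by (auto simp: nsets_def)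
      have "nsets I 2 \<subseteq> A" using nsets_mono[OF I(3), of 2] A by auto
      from expectation_all_False[OF A(1) this] show "?E (\<lambda>g. of_bool (\<forall>e\<in>nsets I 2. \<not> g e)) = (1 - p) ^ (k choose 2)"
        using p I by (simp add: card_nsets)
    qed
    finally show ?thesis by simp
  qed
  have R: "?E (\<lambda>g. max 0 (real (ext_count S k e g) - 3 / 2 * \<mu>)) \<le> \<mu> * V / 2" if e: "e \<in> nsets S 2" for e
  proof -
    have "?E (\<lambda>g. max 0 (real (ext_count S k e g) - 3 / 2 * \<mu>)) \<le>
        ?E (\<lambda>g. (real (ext_count S k e g) - \<mu>)\<^sup>2 / (2 * \<mu>))"
      by (rule integral_mono) (use A excess_le_square[OF \<mu>0] in auto)
    also have "\<dots> = ?E (\<lambda>g. (real (ext_count S k e g) - \<mu>)\<^sup>2) / (2 * \<mu>)" by simp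
    also have "\<dots> \<le> \<mu>\<^sup>2 * V / (2 * \<mu>)"
      using variance_ext_count[OF A S e k, of p] p \<mu>0 unfolding \<mu>_def V_def by (intro divide_right_mono) auto
    finally show ?thesis using \<mu>0 by (simp add: power2_eq_square)
  qed
  have "real (card K) * (1 - p) ^ (k choose 2) - real (card S choose 2) * (\<mu> * V / 2) \<le>
      ?E (\<lambda>g. real (card {I \<in> K. \<forall>e\<in>nsets I 2. \<not> g e})) -
        (\<Sum>e\<in>nsets S 2. ?E (\<lambda>g. max 0 (real (ext_count S k e g) - 3 / 2 * \<mu>)))"
  proof -
    have "(\<Sum>e\<in>nsets S 2. ?E (\<lambda>g. max 0 (real (ext_count S k e g) - 3 / 2 * \<mu>))) \<le> (\<Sum>e\<in>nsets S 2. \<mu> * V / 2)"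
      by (intro sum_mono R)
    thus ?thesis unfolding N by (simp add: card_nsets[OF S])
  qed
  also have "\<dots> = ?E (\<lambda>g. real (card {I \<in> K. \<forall>e\<in>nsets I 2. \<not> g e}) -
        (\<Sum>e\<in>nsets S 2. max 0 (real (ext_count S k e g) - 3 / 2 * \<mu>)))"
    using A(1) by (simp add: Bochner_Integration.integral_sum)
  also have "\<dots> \<le> ?E (\<lambda>g. 3 / 2 * \<mu> * cover_number S K g)"
    by (rule integral_mono) (use A cover_number_lower_bound[OF S K k, of "3 / 2 * \<mu>"] \<mu>0 in auto)
  also have "\<dots> = 3 / 2 * \<mu> * ?E (cover_number S K)" by simp
  finally have main: "real (card K) * (1 - p) ^ (k choose 2) - real (card S choose 2) * (\<mu> * V / 2)
    \<le> 3 / 2 * \<mu> * ?E (cover_number S K)" .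
  \<comment> \<open>Counting incidences of pairs and k-sets passes from k-sets to extensions of
    pairs. One factor 1/2 is the density of K, the other is 1 - p >= 1/2, the probability for e
    itself, which \<mu> omits.\<close>
  have K1: "real (k choose 2) * (real (card K) * (1 - p) ^ (k choose 2)) \<ge> real (card S choose 2) * \<mu> / 4"
  proof -
    have "(1 - p) ^ (k choose 2) = (1 - p) * (1 - p) ^ ((k choose 2) - 1)"
      using k2 by (subst power_Suc[symmetric]) auto
    moreover have "(card S choose k) * (k choose 2) = (card S choose 2) * ((card S - 2) choose (k - 2))"
      by (rule choose_mult) (use k kS in auto)
    hence "real (card S choose k) * real (k choose 2) = real (card S choose 2) * real ((card S - 2) choose (k - 2))"
      by (metis of_nat_mult)
    ultimately have "real (k choose 2) * (real (card S choose k) * (1 - p) ^ (k choose 2)) =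
        real (card S choose 2) * \<mu> * (1 - p)" by (simp add: \<mu>_def mult_ac)
    moreover have "real (k choose 2) * (real (card S choose k) / 2 * (1 - p) ^ (k choose 2)) \<le>
       real (k choose 2) * (real (card K) * (1 - p) ^ (k choose 2))"
      using dens p by (intro mult_left_mono mult_right_mono) auto
    moreover have "real (card S choose 2) * \<mu> * (1 / 2) \<le> real (card S choose 2) * \<mu> * (1 - p)"
      using p \<mu>0 by (intro mult_left_mono) auto
    ultimately show ?thesis by (simp add: algebra_simps)
  qed
  have V2: "real (k choose 2) * V \<le> 1 / 20"
  proof -
    have V0: "V \<ge> 0" unfolding V_def overlap_sum_def using p by (intro sum_nonneg mult_nonneg_nonneg) (auto simp: one_le_power)
    have "real (k choose 2) \<le> (real k)\<^sup>2 / 2"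
      using k by (simp add: choose_two_real power2_eq_square field_simps)
    hence "real (k choose 2) * V \<le> (real k)\<^sup>2 / 2 * V" using V0 by (rule mult_right_mono)
    thus ?thesis using ov by (simp add: V_def)
  qed
  \<comment> \<open>The main term 1/4 minus 1/40 for the surplus leaves 9/40; division by 3/2 gives
    3/20, just above the required 1/7.\<close>
  have "real (card S choose 2) * \<mu> / 4 - real (card S choose 2) * \<mu> / 2 * (1 / 20)
      \<le> real (card S choose 2) * \<mu> / 4 - real (card S choose 2) * \<mu> / 2 * (real (k choose 2) * V)"
    using V2 \<mu>0 by (intro diff_left_mono mult_left_mono) auto
  also have "\<dots> \<le> real (k choose 2) * (real (card K) * (1 - p) ^ (k choose 2) - real (card S choose 2) * (\<mu> * V / 2))"
    using K1 by (simp add: algebra_simps)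
  also have "\<dots> \<le> real (k choose 2) * (3 / 2 * \<mu> * ?E (cover_number S K))"
    using main k2 by (intro mult_left_mono) auto
  finally have "\<mu> * (real (card S choose 2) * (9 / 40)) \<le> \<mu> * (real (k choose 2) * (3 / 2 * ?E (cover_number S K)))"
    by (simp add: algebra_simps)
  hence "real (card S choose 2) * (9 / 40) \<le> real (k choose 2) * (3 / 2 * ?E (cover_number S K))"
    using \<mu>0 by simp
  hence X: "3 / 20 * (real (card S choose 2) / real (k choose 2)) \<le> ?E (cover_number S K)"
    using k2 by (simp add: field_simps)
  have "(real (card S))\<^sup>2 / (real k)\<^sup>2 \<le> real (card S choose 2) / real (k choose 2)"
  proof -
    have kr: "2 \<le> real k" "real k \<le> real (card S)" using k kS by auto
    have "real (card S) * (real k - 1) \<le> (real (card S) - 1) * real k"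
      using kr by (simp add: algebra_simps)
    hence "(real (card S) * real k) * (real (card S) * (real k - 1)) \<le> (real (card S) * real k) * ((real (card S) - 1) * real k)"
      by (intro mult_left_mono) auto
    thus ?thesis using kr k2 by (simp add: choose_two_real power2_eq_square divide_simps algebra_simps)
  qed
  hence "1 / 7 * ((real (card S))\<^sup>2 / (real k)\<^sup>2) \<le> 3 / 20 * (real (card S choose 2) / real (k choose 2))"
    by (intro mult_mono) auto
  thus ?thesis using X by (simp add: field_simps)
qed

section \<open>Pseudorandom properties of the random graph\<close>

lemma cover_number_lower_tail:
  assumes A: "finite A" "nsets S 2 \<subseteq> A" and S: "finite S" and K: "K \<subseteq> nsets S k" and k: "k \<ge> 2"
    and p: "0 < p" "p \<le> 1 / 2" and kS: "k \<le> card S" and kp: "(real k)\<^sup>2 * p \<ge> 1"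
    and dens: "2 * card K \<ge> card S choose k"
    and ov: "(real k)\<^sup>2 * overlap_sum k (card S) (1 / (1 - p)) \<le> 1 / 10"
  shows "measure_pmf.prob (bernoulli_product A p) {g. cover_number S K g < (real (card S))\<^sup>2 / (8 * (real k)\<^sup>2)}
     \<le> exp (- ((real (card S))\<^sup>2 / (6272 * (real k ^ 4 * p))))"
proof -
  let ?E = "measure_pmf.expectation (bernoulli_product A p) (cover_number S K)"
  \<comment> \<open>The gap to the mean is t = (1/7 - 1/8) * |S|^2 / k^2, and l minimises p * l^2 *
    |S|^2 / 2 - l * t. The hypothesis \<open>kp\<close> ensures l <= 1.\<close>
  define l where "l = 1 / (56 * ((real k)\<^sup>2 * p))"
  define t where "t = (real (card S))\<^sup>2 / (56 * (real k)\<^sup>2)"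
  have l: "0 \<le> l" "l \<le> 1" unfolding l_def using p kp by (auto simp: divide_simps)
  have E: "?E \<ge> (real (card S))\<^sup>2 / (7 * (real k)\<^sup>2)"
    by (rule expectation_cover_number) (use assms in auto)
  have sumc: "(\<Sum>e\<in>A. (of_bool (e \<in> nsets S 2) :: real)\<^sup>2) \<le> (real (card S))\<^sup>2 / 2"
  proof -
    have "(\<Sum>e\<in>A. (of_bool (e \<in> nsets S 2) :: real)\<^sup>2) = (\<Sum>e\<in>A. if e \<in> nsets S 2 then 1 else 0)"
      by (rule sum.cong) auto
    also have "\<dots> = real (card (A \<inter> nsets S 2))" using A by (simp add: sum.If_cases)
    also have "A \<inter> nsets S 2 = nsets S 2" using A by auto
    finally show ?thesis using S by (simp add: card_nsets choose_two_real power2_eq_square field_simps)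
  qed
  have "measure_pmf.prob (bernoulli_product A p) {g. cover_number S K g < (real (card S))\<^sup>2 / (8 * (real k)\<^sup>2)}
     \<le> measure_pmf.prob (bernoulli_product A p) {g. cover_number S K g \<le> ?E - t}"
  proof (intro measure_pmf.finite_measure_mono subsetI)
    fix g assume "g \<in> {g. cover_number S K g < (real (card S))\<^sup>2 / (8 * (real k)\<^sup>2)}"
    moreover have "(real (card S))\<^sup>2 / (8 * (real k)\<^sup>2) + t = (real (card S))\<^sup>2 / (7 * (real k)\<^sup>2)"
      unfolding t_def using k by (simp add: field_simps)
    ultimately show "g \<in> {g. cover_number S K g \<le> ?E - t}" using E by simp
  qed simp
  also have "\<dots> \<le> exp (p * l\<^sup>2 * (\<Sum>e\<in>A. (of_bool (e \<in> nsets S 2) :: real)\<^sup>2) - l * t)"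
    using p by (intro lipschitz_lower_tail A l cover_number_lipschitz[OF S K k]) auto
  also have "\<dots> \<le> exp (p * l\<^sup>2 * ((real (card S))\<^sup>2 / 2) - l * t)"
    using sumc p by (auto intro!: mult_left_mono)
  also have "p * l\<^sup>2 * ((real (card S))\<^sup>2 / 2) - l * t = - ((real (card S))\<^sup>2 / (6272 * (real k ^ 4 * p)))"
    unfolding l_def t_def using p k by (simp add: field_simps power2_eq_square power4_eq_xxxx)
  finally show ?thesis .
qed

text \<open>E enters only as a candidate cover: if every independent member of K contained more than
  \<rho> pairs of E, weight 1 / r on E would be a cover cheaper than \<open>X\<close> allows. Thus
  the one property \<open>X\<close> serves every E, and no union bound over E is taken.\<close>

lemma light_independent_set:
  assumes S: "finite S" and K: "K \<subseteq> nsets S k" and k: "k > 0" and S0: "card S > 0"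
    and X: "cover_number S K g \<ge> (real (card S))\<^sup>2 / (8 * (real k)\<^sup>2)"
  shows "\<exists>I\<in>K. (\<forall>e\<in>nsets I 2. \<not> g e) \<and>
    real (card (E \<inter> nsets I 2)) \<le> 8 * (real k)\<^sup>2 * real (card (E \<inter> nsets S 2)) / (real (card S))\<^sup>2"
proof (rule ccontr)
  define \<rho> where "\<rho> = 8 * (real k)\<^sup>2 * real (card (E \<inter> nsets S 2)) / (real (card S))\<^sup>2"
  \<comment> \<open>The least integer above \<rho>: a count exceeding \<rho> is at least r, whereas
    the cost of the cover forces r <= \<rho>.\<close>
  define r where "r = nat \<lfloor>\<rho>\<rfloor> + 1"
  assume "\<not> (\<exists>I\<in>K. (\<forall>e\<in>nsets I 2. \<not> g e) \<and>
    real (card (E \<inter> nsets I 2)) \<le> 8 * (real k)\<^sup>2 * real (card (E \<inter> nsets S 2)) / (real (card S))\<^sup>2)"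
  hence no: "\<rho> < real (card (E \<inter> nsets I 2))" if "I \<in> K" "\<forall>e\<in>nsets I 2. \<not> g e" for I
    using that unfolding \<rho>_def[symmetric] by (meson not_le_imp_less)
  have \<rho>0: "\<rho> \<ge> 0" by (simp add: \<rho>_def)
  have r\<rho>: "\<rho> < real r" unfolding r_def using \<rho>0 by linarith
  have r1: "r \<ge> 1" by (simp add: r_def)
  define w where "w = (\<lambda>e. if e \<in> E then 1 / real r else 0)"
  have "frac_cover K g w"
    unfolding frac_cover_def
  proof (intro conjI allI ballI impI)
    fix I assume I: "I \<in> K" "\<forall>e\<in>nsets I 2. \<not> g e"
    have fin: "finite (nsets I 2)" using I K by (intro finite_imp_finite_nsets) (auto simp: nsets_def)
    have "r \<le> card (E \<inter> nsets I 2)" unfolding r_def using no[OF I] \<rho>0 by linarith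
    hence "1 \<le> real (card (E \<inter> nsets I 2)) / real r" using r1 by simp
    also have "\<dots> = (\<Sum>e\<in>nsets I 2. w e)"
      using fin by (simp add: w_def sum.If_cases Int_commute)
    finally show "1 \<le> (\<Sum>e\<in>nsets I 2. w e)" .
  qed (use r1 in \<open>auto simp: w_def\<close>)
  from cover_number_le[OF this, of S] have "cover_number S K g \<le> real (card (E \<inter> nsets S 2)) / real r"
    using finite_imp_finite_nsets[OF S] by (simp add: w_def sum.If_cases Int_commute)
  with X have "(real (card S))\<^sup>2 / (8 * (real k)\<^sup>2) \<le> real (card (E \<inter> nsets S 2)) / real r" by linarith
  hence "real r \<le> \<rho>" using r1 k S0 by (simp add: \<rho>_def field_simps)
  with r\<rho> show False by simp
qed

text \<open>The lower tail inequality for the negated edge count, with l = 1. Twice the mean is at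
  most p * |T|^2, which the hypothesis \<open>a\<close> bounds by half of a * |T|.\<close>

lemma edge_count_upper_tail:
  assumes A: "finite A" "nsets T 2 \<subseteq> A" and T: "finite T" and p: "0 \<le> p" "p \<le> 1" and a: "p * real (card T) \<le> a / 2"
  shows "measure_pmf.prob (bernoulli_product A p) {g. a * real (card T) \<le> real (card {e \<in> nsets T 2. g e})}
    \<le> exp (- a / 2) ^ card T"
proof -
  define f where "f = (\<lambda>g. - real (card {e \<in> nsets T 2. g e}))"
  let ?E = "measure_pmf.expectation (bernoulli_product A p)"
  have fin: "finite (nsets T 2)" using finite_imp_finite_nsets[OF T] .
  have f: "f g = - (\<Sum>e\<in>nsets T 2. of_bool (g e))" for g
    unfolding f_def using fin by (simp add: of_bool_def sum.inter_filter[symmetric])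
  have Ee: "?E (\<lambda>g. of_bool (g e)) = p" if "e \<in> nsets T 2" for e
  proof -
    have "?E (\<lambda>g. of_bool (\<forall>e\<in>{e}. \<not> g e)) = (1 - p) ^ card {e}"
      by (rule expectation_all_False) (use A that p in auto)
    hence "?E (\<lambda>g. 1 - of_bool (g e)) = 1 - p" by (simp add: of_bool_not_iff)
    thus ?thesis using A by simp
  qed
  have Ef: "?E f = - (p * real (card T choose 2))"
    unfolding f using A Ee by (simp add: Bochner_Integration.integral_sum card_nsets[OF T] mult.commute)
  have lip: "\<bar>f (g(e := True)) - f (g(e := False))\<bar> \<le> of_bool (e \<in> nsets T 2)" for g e
  proof -
    have "f (g(e := False)) - f (g(e := True)) = (\<Sum>d\<in>nsets T 2. of_bool ((g(e := True)) d) - of_bool ((g(e := False)) d))"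
      unfolding f by (simp add: sum_subtractf)
    also have "\<dots> = (\<Sum>d\<in>nsets T 2. if d = e then 1 else 0)" by (rule sum.cong) auto
    also have "\<dots> = of_bool (e \<in> nsets T 2)" using fin by simp
    finally have "\<bar>f (g(e := True)) - f (g(e := False))\<bar> = \<bar>of_bool (e \<in> nsets T 2)\<bar>"
      by (metis abs_minus_commute)
    thus ?thesis by simp
  qed
  have sumc: "(\<Sum>e\<in>A. (of_bool (e \<in> nsets T 2) :: real)\<^sup>2) = real (card T choose 2)"
  proof -
    have "(\<Sum>e\<in>A. (of_bool (e \<in> nsets T 2) :: real)\<^sup>2) = (\<Sum>e\<in>A. if e \<in> nsets T 2 then 1 else 0)"
      by (rule sum.cong) auto
    also have "\<dots> = real (card (A \<inter> nsets T 2))" using A by (simp add: sum.If_cases)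
    also have "A \<inter> nsets T 2 = nsets T 2" using A by auto
    finally show ?thesis using T by (simp add: card_nsets)
  qed
  define s where "s = a * real (card T) - p * real (card T choose 2)"
  have "measure_pmf.prob (bernoulli_product A p) {g. a * real (card T) \<le> real (card {e \<in> nsets T 2. g e})}
     = measure_pmf.prob (bernoulli_product A p) {g. f g \<le> ?E f - s}"
    unfolding Ef unfolding s_def f_def by simp
  also have "\<dots> \<le> exp (p * 1\<^sup>2 * (\<Sum>e\<in>A. (of_bool (e \<in> nsets T 2) :: real)\<^sup>2) - 1 * s)"
    using p by (intro lipschitz_lower_tail A lip) auto
  also have "\<dots> = exp (2 * (p * real (card T choose 2)) - a * real (card T))"
    unfolding sumc s_def by simp
  also have "\<dots> \<le> exp (real (card T) * (- a / 2))"
  proof -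
    have "2 * (p * real (card T choose 2)) = p * real (card T) * (real (card T) - 1)"
      by (simp add: choose_two_real)
    also have "\<dots> \<le> p * real (card T) * real (card T)" using p by (intro mult_left_mono) auto
    also have "\<dots> \<le> a / 2 * real (card T)" using a by (intro mult_right_mono) auto
    finally show ?thesis by (simp add: algebra_simps)
  qed
  also have "\<dots> = exp (- a / 2) ^ card T" by (rule exp_of_nat_mult)
  finally show ?thesis .
qed

section \<open>The two pseudorandom properties and their union bounds\<close>

text \<open>The average of \<open>sum x I\<close> over all k-subsets I of S is k * x(S) / |S|, so
  the threshold is 3/5 of the average.\<close>

definition heavy_sets :: "'a set \<Rightarrow> nat \<Rightarrow> ('a \<Rightarrow> nat) \<Rightarrow> 'a set set" where
  "heavy_sets S k x = {I \<in> nsets S k. 3 / 5 * real k * real (sum x S) / real (card S) \<le> real (sum x I)}"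

text \<open>Arbitrary families of k-sets are too numerous for a union bound. Those cut out by
  weights with values in {..n} are at most (n + 1)^n for each S, and degrees in E are such
  weights.\<close>

definition richly_independent :: "nat \<Rightarrow> nat \<Rightarrow> real \<Rightarrow> (nat set \<Rightarrow> bool) \<Rightarrow> bool" where
  "richly_independent n k s g \<longleftrightarrow> (\<forall>S \<subseteq> {1..n}. \<forall>x \<in> {1..n} \<rightarrow>\<^sub>E {..n}. s \<le> real (card S) \<longrightarrow>
     card S choose k \<le> 2 * card (heavy_sets S k x) \<longrightarrow>
     (real (card S))\<^sup>2 / (8 * (real k)\<^sup>2) \<le> cover_number S (heavy_sets S k x) g)"

definition locally_sparse :: "nat \<Rightarrow> real \<Rightarrow> real \<Rightarrow> (nat set \<Rightarrow> bool) \<Rightarrow> bool" where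
  "locally_sparse n s a g \<longleftrightarrow> (\<forall>T \<subseteq> {1..n}. real (card T) \<le> s \<longrightarrow> real (card {e \<in> nsets T 2. g e}) \<le> a * real (card T))"

text \<open>A union bound over at most 2^n * (n + 1)^n pairs (S, x); the tail estimate is weakest at
  the smallest admissible size s.\<close>

lemma prob_not_richly_independent:
  assumes k: "k \<ge> 2" and p: "0 < p" "p \<le> 1 / 2" and kp: "(real k)\<^sup>2 * p \<ge> 1" and s: "real k \<le> s"
    and ov: "\<And>m. s \<le> real m \<Longrightarrow> m \<le> n \<Longrightarrow> (real k)\<^sup>2 * overlap_sum k m (1 / (1 - p)) \<le> 1 / 10"
  shows "measure_pmf.prob (bernoulli_product (nsets {1..n} 2) p) {g. \<not> richly_independent n k s g}
     \<le> 2 ^ n * real (n + 1) ^ n * exp (- (s\<^sup>2 / (6272 * (real k ^ 4 * p))))"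
proof -
  let ?P = "measure_pmf.prob (bernoulli_product (nsets {1..n} 2) p)"
  define J where "J = {(S, x). S \<subseteq> {1..n} \<and> x \<in> {1..n} \<rightarrow>\<^sub>E {..n} \<and> s \<le> real (card S) \<and>
     card S choose k \<le> 2 * card (heavy_sets S k x)}"
  define B where "B = (\<lambda>(S :: nat set, x). {g. cover_number S (heavy_sets S k x) g < (real (card S))\<^sup>2 / (8 * (real k)\<^sup>2)})"
  have Jsub: "J \<subseteq> Pow {1..n} \<times> ({1..n} \<rightarrow>\<^sub>E {..n})" by (auto simp: J_def)
  have fJ: "finite (Pow {1..n} \<times> ({1..n} \<rightarrow>\<^sub>E {..n :: nat}))"
    by (intro finite_cartesian_product finite_PiE) auto
  have finJ: "finite J" using finite_subset[OF Jsub fJ] .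
  have "card J \<le> card (Pow {1..n} \<times> ({1..n} \<rightarrow>\<^sub>E {..n :: nat}))" by (rule card_mono[OF fJ Jsub])
  also have "\<dots> = 2 ^ n * (n + 1) ^ n" by (simp add: card_cartesian_product card_Pow card_PiE)
  finally have cJ: "real (card J) \<le> 2 ^ n * real (n + 1) ^ n"
    using of_nat_mono[of "card J" "2 ^ n * (n + 1) ^ n", where 'a = real] by simp
  have s0: "s \<ge> 0" using s by linarith
  have kp0: "real k ^ 4 * p > 0" using k p by simp
  have each: "?P (B j) \<le> exp (- (s\<^sup>2 / (6272 * (real k ^ 4 * p))))" if jJ: "j \<in> J" for j
  proof -
    obtain S x where j: "j = (S, x)" and S: "S \<subseteq> {1..n}" "s \<le> real (card S)" "card S choose k \<le> 2 * card (heavy_sets S k x)"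
      using jJ by (auto simp: J_def)
    have fS: "finite S" using S finite_subset by blast
    have cS: "card S \<le> n" using card_mono[OF _ S(1)] by simp
    have "?P (B j) \<le> exp (- ((real (card S))\<^sup>2 / (6272 * (real k ^ 4 * p))))"
      unfolding B_def j prod.case
    proof (rule cover_number_lower_tail)
      show "nsets S 2 \<subseteq> nsets {1..n} 2" using S(1) by (rule nsets_mono)
      show "heavy_sets S k x \<subseteq> nsets S k" by (auto simp: heavy_sets_def)
      show "(real k)\<^sup>2 * overlap_sum k (card S) (1 / (1 - p)) \<le> 1 / 10" by (rule ov[OF S(2) cS])
      show "k \<le> card S" using s S(2) by linarith
    qed (use p kp k fS S finite_imp_finite_nsets in auto)
    also have "\<dots> \<le> exp (- (s\<^sup>2 / (6272 * (real k ^ 4 * p))))"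
      using S s0 kp0 by (auto intro!: divide_right_mono power_mono)
    finally show ?thesis .
  qed
  have "{g. \<not> richly_independent n k s g} \<subseteq> (\<Union>j\<in>J. B j)"
  proof
    fix g assume "g \<in> {g. \<not> richly_independent n k s g}"
    then obtain S x where "S \<subseteq> {1..n}" "x \<in> {1..n} \<rightarrow>\<^sub>E {..n}" "s \<le> real (card S)"
      "card S choose k \<le> 2 * card (heavy_sets S k x)"
      "\<not> (real (card S))\<^sup>2 / (8 * (real k)\<^sup>2) \<le> cover_number S (heavy_sets S k x) g"
      unfolding richly_independent_def by blast
    hence "(S, x) \<in> J" "g \<in> B (S, x)" by (simp_all add: J_def B_def)
    thus "g \<in> (\<Union>j\<in>J. B j)" by blast
  qed
  hence "?P {g. \<not> richly_independent n k s g} \<le> ?P (\<Union>j\<in>J. B j)"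
    by (intro measure_pmf.finite_measure_mono) auto
  also have "\<dots> \<le> (\<Sum>j\<in>J. ?P (B j))"
    by (rule measure_pmf.finite_measure_subadditive_finite) (use finJ in auto)
  also have "\<dots> \<le> (\<Sum>j\<in>J. exp (- (s\<^sup>2 / (6272 * (real k ^ 4 * p)))))" by (intro sum_mono each)
  also have "\<dots> = real (card J) * exp (- (s\<^sup>2 / (6272 * (real k ^ 4 * p))))" by simp
  also have "\<dots> \<le> 2 ^ n * real (n + 1) ^ n * exp (- (s\<^sup>2 / (6272 * (real k ^ 4 * p))))"
    using cJ by (intro mult_right_mono) auto
  finally show ?thesis .
qed

lemma sum_power_card_Pow:
  fixes y :: "'b :: comm_semiring_1"
  assumes "finite A"
  shows "(\<Sum>T\<in>Pow A. y ^ card T) = (1 + y) ^ card A"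
  using prod_add[OF assms, of "\<lambda>_. y" "\<lambda>_. 1"] by (simp add: add.commute)

text \<open>The empty set never violates the condition, so the union bound runs over nonempty T, and
  the powers of exp (- a / 2) add up to a binomial expansion without its constant term.\<close>

lemma prob_not_locally_sparse:
  assumes p: "0 \<le> p" "p \<le> 1" and a: "p * s \<le> a / 2"
  shows "measure_pmf.prob (bernoulli_product (nsets {1..n} 2) p) {g. \<not> locally_sparse n s a g}
     \<le> (1 + exp (- a / 2)) ^ n - 1"
proof -
  let ?P = "measure_pmf.prob (bernoulli_product (nsets {1..n} 2) p)"
  define J where "J = {T. T \<subseteq> {1..n} \<and> T \<noteq> {} \<and> real (card T) \<le> s}"
  define B where "B = (\<lambda>T :: nat set. {g. a * real (card T) \<le> real (card {e \<in> nsets T 2. g e})})"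
  have finJ: "finite J" by (rule finite_subset[of _ "Pow {1..n}"]) (auto simp: J_def)
  have "{g. \<not> locally_sparse n s a g} \<subseteq> (\<Union>j\<in>J. B j)"
  proof
    fix g assume "g \<in> {g. \<not> locally_sparse n s a g}"
    then obtain T where T: "T \<subseteq> {1..n}" "real (card T) \<le> s" "\<not> real (card {e \<in> nsets T 2. g e}) \<le> a * real (card T)"
      by (auto simp: locally_sparse_def)
    have "T \<noteq> {}" using T(3) by (auto simp: nsets_empty_iff)
    hence "T \<in> J" "g \<in> B T" using T by (simp_all add: J_def B_def)
    thus "g \<in> (\<Union>j\<in>J. B j)" by blast
  qed
  hence "?P {g. \<not> locally_sparse n s a g} \<le> ?P (\<Union>j\<in>J. B j)"
    by (intro measure_pmf.finite_measure_mono) auto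
  also have "\<dots> \<le> (\<Sum>j\<in>J. ?P (B j))"
    by (rule measure_pmf.finite_measure_subadditive_finite) (use finJ in auto)
  also have "\<dots> \<le> (\<Sum>T\<in>J. exp (- a / 2) ^ card T)"
  proof (rule sum_mono)
    fix T assume T: "T \<in> J"
    have "p * real (card T) \<le> a / 2" using T p a mult_left_mono[of "real (card T)" s p] by (auto simp: J_def)
    moreover have "T \<subseteq> {1..n}" "finite T" using T finite_subset[of T "{1..n}"] by (auto simp: J_def)
    ultimately show "?P (B T) \<le> exp (- a / 2) ^ card T"
      unfolding B_def using p
      by (intro edge_count_upper_tail[OF finite_imp_finite_nsets[OF finite_atLeastAtMost] nsets_mono]) auto
  qed
  also have "\<dots> \<le> (\<Sum>T\<in>Pow {1..n} - {{}}. exp (- a / 2) ^ card T)"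
    by (rule sum_mono2) (auto simp: J_def)
  also have "\<dots> = (1 + exp (- a / 2)) ^ n - 1"
    using sum_power_card_Pow[of "{1..n}" "exp (- a / 2)"] by (simp add: sum_diff1)
  finally show ?thesis .
qed

section \<open>Colouring graphs with few edges\<close>

definition colourable :: "'a set \<Rightarrow> 'a set set \<Rightarrow> nat \<Rightarrow> bool" where
  "colourable V H q \<longleftrightarrow> (\<exists>c. proper_colouring V H q c)"

lemma chromatic_number_le: "colourable V H q \<Longrightarrow> chromatic_number V H \<le> q"
  unfolding colourable_def chromatic_number_def by (rule Least_le)

lemma colourable_Un:
  assumes "colourable S H a" "colourable T H b"
  shows "colourable (S \<union> T) H (a + b)"
proof -
  obtain c d where c: "proper_colouring S H a c" and d: "proper_colouring T H b d"
    using assms by (auto simp: colourable_def)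
  have "proper_colouring (S \<union> T) H (a + b) (\<lambda>v. if v \<in> S then c v else a + d v)"
    using c d unfolding proper_colouring_def Pi_def by (auto simp: trans_less_add1 insert_commute)
  thus ?thesis by (auto simp: colourable_def)
qed

text \<open>A vertex of degree at most d is set aside, the rest is coloured by induction, and one of
  the d + 1 colours is free at that vertex.\<close>

lemma colourable_degenerate:
  assumes "finite S" and "\<forall>v\<in>S. {v} \<notin> H"
    and "\<And>T. T \<subseteq> S \<Longrightarrow> T \<noteq> {} \<Longrightarrow> \<exists>v\<in>T. card {u \<in> T. {u, v} \<in> H} \<le> d"
  shows "colourable S H (Suc d)"
  using assms
proof (induction S rule: finite_psubset_induct)
  case (psubset S)
  show ?case
  proof (cases "S = {}")
    case True thus ?thesis by (auto simp: colourable_def proper_colouring_def)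
  next
    case False
    then obtain v where v: "v \<in> S" "card {u \<in> S. {u, v} \<in> H} \<le> d" using psubset.prems(2)[of S] by auto
    have "colourable (S - {v}) H (Suc d)"
      using psubset.prems by (intro psubset.IH) (use v in auto)
    then obtain c where c: "proper_colouring (S - {v}) H (Suc d) c" by (auto simp: colourable_def)
    define N where "N = {u \<in> S. {u, v} \<in> H}"
    have fN: "finite N" using psubset.hyps by (simp add: N_def)
    have "card (c ` N) < card {..d}" using card_image_le[OF fN, of c] v by (simp add: N_def)
    hence "\<not> {..d} \<subseteq> c ` N" using fN card_mono[of "c ` N" "{..d}"] by force
    then obtain q where q: "q \<le> d" "q \<notin> c ` N" by auto
    have "proper_colouring S H (Suc d) (c(v := q))"
      unfolding proper_colouring_def
    proof (intro conjI ballI impI)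
      show "c(v := q) \<in> S \<rightarrow> {..<Suc d}" using c q unfolding proper_colouring_def by auto
      fix u w assume uw: "u \<in> S" "w \<in> S" "{u, w} \<in> H"
      have "u \<noteq> w" using uw psubset.prems(1) by auto
      moreover have "w \<in> N" if "u = v" using uw that by (simp add: N_def insert_commute)
      moreover have "u \<in> N" if "w = v" using uw that by (simp add: N_def)
      ultimately show "(c(v := q)) u \<noteq> (c(v := q)) w"
        using c q uw unfolding proper_colouring_def by auto
    qed
    thus ?thesis by (auto simp: colourable_def)
  qed
qed

lemma colourable_card:
  assumes "finite S" "\<forall>v\<in>S. {v} \<notin> H"
  shows "colourable S H (card S)"
proof -
  obtain f where f: "bij_betw f S {0..<card S}" using ex_bij_betw_finite_nat[OF assms(1)] by blast
  have "proper_colouring S H (card S) f"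
    using f assms unfolding proper_colouring_def bij_betw_def inj_on_def by fastforce
  thus ?thesis by (auto simp: colourable_def)
qed

lemma sum_degree_eq:
  assumes "finite M" "finite I"
  shows "(\<Sum>v\<in>I. card {e \<in> M. v \<in> e}) = (\<Sum>e\<in>M. card (e \<inter> I))"
proof -
  have "(\<Sum>v\<in>I. card {e \<in> M. v \<in> e}) = (\<Sum>v\<in>I. \<Sum>e\<in>M. if v \<in> e then 1 else 0)"
    using assms by (simp add: sum.inter_filter[symmetric])
  also have "\<dots> = (\<Sum>e\<in>M. \<Sum>v\<in>I. if v \<in> e then 1 else 0)" by (rule sum.swap)
  also have "\<dots> = (\<Sum>e\<in>M. card (e \<inter> I))"
    using assms by (simp add: sum.inter_filter[symmetric] Int_def conj_commute)
  finally show ?thesis .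
qed

lemma handshake:
  assumes "finite T" "M \<subseteq> nsets T 2"
  shows "(\<Sum>v\<in>T. card {e \<in> M. v \<in> e}) = 2 * card M"
proof -
  have fM: "finite M" using assms finite_imp_finite_nsets finite_subset by metis
  have "(\<Sum>v\<in>T. card {e \<in> M. v \<in> e}) = (\<Sum>e\<in>M. card (e \<inter> T))" by (rule sum_degree_eq[OF fM assms(1)])
  also have "\<dots> = (\<Sum>e\<in>M. 2)"
  proof (rule sum.cong[OF refl])
    fix e assume "e \<in> M"
    hence "e \<subseteq> T" "card e = 2" using assms by (auto simp: nsets_def)
    thus "card (e \<inter> T) = 2" by (simp add: Int_absorb2)
  qed
  finally show ?thesis by simp
qed

text \<open>The average degree in every induced subgraph is at most d, so each has a vertex of
  degree at most the integer part of d.\<close>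

lemma colourable_sparse:
  assumes S: "finite S" "\<forall>v\<in>S. {v} \<notin> H" and d: "d \<ge> 0"
    and sparse: "\<And>T. T \<subseteq> S \<Longrightarrow> 2 * real (card (H \<inter> nsets T 2)) \<le> d * real (card T)"
  shows "colourable S H (nat \<lfloor>d\<rfloor> + 1)"
proof -
  have "colourable S H (Suc (nat \<lfloor>d\<rfloor>))"
  proof (rule colourable_degenerate[OF S])
    fix T assume T: "T \<subseteq> S" "T \<noteq> {}"
    have fT: "finite T" using T S finite_subset by blast
    have fM: "finite (H \<inter> nsets T 2)" using finite_imp_finite_nsets[OF fT] by blast
    show "\<exists>v\<in>T. card {u \<in> T. {u, v} \<in> H} \<le> nat \<lfloor>d\<rfloor>"
    proof (rule ccontr)
      assume *: "\<not> ?thesis"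
      have deg: "d < real (card {e \<in> H \<inter> nsets T 2. v \<in> e})" if v: "v \<in> T" for v
      proof -
        have vH: "{v} \<notin> H" using v T(1) S(2) by blast
        have "card {u \<in> T. {u, v} \<in> H} \<le> card {e \<in> H \<inter> nsets T 2. v \<in> e}"
        proof (rule card_inj_on_le[where f = "\<lambda>u. {u, v}"])
          show "(\<lambda>u. {u, v}) ` {u \<in> T. {u, v} \<in> H} \<subseteq> {e \<in> H \<inter> nsets T 2. v \<in> e}"
            using v vH by auto
          show "finite {e \<in> H \<inter> nsets T 2. v \<in> e}" using fM by (rule finite_subset[rotated]) auto
        qed (auto simp: inj_on_def doubleton_eq_iff)
        moreover have "nat \<lfloor>d\<rfloor> < card {u \<in> T. {u, v} \<in> H}" using * v by auto
        ultimately show ?thesis using d by linarith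
      qed
      have "d * real (card T) = (\<Sum>v\<in>T. d)" by simp
      also have "\<dots> < (\<Sum>v\<in>T. real (card {e \<in> H \<inter> nsets T 2. v \<in> e}))"
        by (rule sum_strict_mono) (use fT T deg in auto)
      also have "\<dots> = real (2 * card (H \<inter> nsets T 2))"
        unfolding handshake[OF fT Int_lower2[of H], symmetric] by simp
      finally show False using sparse[OF T(1)] by simp
    qed
  qed
  thus ?thesis by simp
qed

text \<open>The geometric mean of the bounds |T|^2 and 2 * M for twice the edge count. Through it,
  E-edges cost only the square root of their number in colours.\<close>

lemma edges_le_sqrt:
  assumes "finite T" "real (card (F \<inter> nsets T 2)) \<le> M"
  shows "2 * real (card (F \<inter> nsets T 2)) \<le> sqrt (2 * M) * real (card T)"
proof -
  define m where "m = real (card (F \<inter> nsets T 2))"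
  have m0: "0 \<le> m" by (simp add: m_def)
  have "card (F \<inter> nsets T 2) \<le> card (nsets T 2)"
    by (rule card_mono) (use finite_imp_finite_nsets[OF assms(1)] in auto)
  hence "m \<le> real (card T choose 2)" using assms by (simp add: m_def card_nsets)
  hence "2 * m \<le> (real (card T))\<^sup>2" by (simp add: choose_two_real power2_eq_square algebra_simps)
  moreover have "2 * m \<le> 2 * M" using assms by (simp add: m_def)
  ultimately have "(2 * m) * (2 * m) \<le> (2 * M) * (real (card T))\<^sup>2"
    using m0 by (intro mult_mono) auto
  hence "sqrt ((2 * m) * (2 * m)) \<le> sqrt ((2 * M) * (real (card T))\<^sup>2)" by (rule real_sqrt_le_mono)
  thus ?thesis using m0 by (simp add: real_sqrt_mult m_def)
qed

text \<open>\<open>edges_le_sqrt\<close> bounds the degeneracy. For M = 0 this is a single colour,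
  the case of classes free of E-edges.\<close>

lemma colourable_few_edges:
  assumes "finite S" "\<forall>v\<in>S. {v} \<notin> H" "real (card (H \<inter> nsets S 2)) \<le> M"
  shows "colourable S H (nat \<lfloor>sqrt (2 * M)\<rfloor> + 1)"
proof (rule colourable_sparse[OF assms(1,2)])
  show "0 \<le> sqrt (2 * M)" using order_trans[OF of_nat_0_le_iff assms(3)] by simp
  fix T assume T: "T \<subseteq> S"
  have fT: "finite T" using T assms finite_subset by blast
  have "card (H \<inter> nsets T 2) \<le> card (H \<inter> nsets S 2)"
    by (rule card_mono) (use finite_imp_finite_nsets[OF assms(1)] nsets_mono[OF T] in auto)
  hence "real (card (H \<inter> nsets T 2)) \<le> M" using assms(3) by linarith
  thus "2 * real (card (H \<inter> nsets T 2)) \<le> sqrt (2 * M) * real (card T)"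
    by (rule edges_le_sqrt[OF fT])
qed

text \<open>The comparison is made edge by edge: an edge with 0, 1 or 2 ends in I is counted 1, 1 or
  2 times on either side.\<close>

lemma edges_after_removal:
  assumes "finite S" "I \<subseteq> S"
  shows "(\<Sum>v\<in>I. card {e \<in> E \<inter> nsets S 2. v \<in> e}) + card (E \<inter> nsets (S - I) 2)
    \<le> card (E \<inter> nsets S 2) + card (E \<inter> nsets I 2)"
proof -
  define M where "M = E \<inter> nsets S 2"
  have fM: "finite M" using finite_imp_finite_nsets[OF assms(1)] by (simp add: M_def)
  have fI: "finite I" using assms finite_subset by blast
  have "E \<inter> nsets (S - I) 2 = {e \<in> M. e \<subseteq> S - I}" by (auto simp: M_def nsets_def)
  hence 1: "card (E \<inter> nsets (S - I) 2) = (\<Sum>e\<in>M. of_bool (e \<subseteq> S - I))"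
    using fM by (simp add: of_bool_def sum.inter_filter[symmetric])
  have "E \<inter> nsets I 2 = {e \<in> M. e \<subseteq> I}" using assms by (auto simp: M_def nsets_def)
  hence 2: "card (E \<inter> nsets I 2) = (\<Sum>e\<in>M. of_bool (e \<subseteq> I))"
    using fM by (simp add: of_bool_def sum.inter_filter[symmetric])
  have "(\<Sum>v\<in>I. card {e \<in> M. v \<in> e}) + card (E \<inter> nsets (S - I) 2) = (\<Sum>e\<in>M. card (e \<inter> I) + of_bool (e \<subseteq> S - I))"
    unfolding 1 sum_degree_eq[OF fM fI] by (simp add: sum.distrib)
  also have "\<dots> \<le> (\<Sum>e\<in>M. 1 + of_bool (e \<subseteq> I))"
  proof (rule sum_mono)
    fix e assume "e \<in> M"
    then obtain u v where e: "e = {u, v}" "u \<noteq> v" "u \<in> S" "v \<in> S" by (auto simp: M_def elim: nsets2_E)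
    show "card (e \<inter> I) + of_bool (e \<subseteq> S - I) \<le> 1 + of_bool (e \<subseteq> I)"
      using e by (cases "u \<in> I"; cases "v \<in> I") auto
  qed
  also have "\<dots> = card M + card (E \<inter> nsets I 2)" unfolding 2 sum.distrib by simp
  finally show ?thesis by (simp add: M_def)
qed

text \<open>Chebyshev's inequality for a uniformly random k-subset I of S. The mean of x(I) is m,
  and as memberships of distinct vertices are negatively correlated, the variance is at most D * m.
  Hence x(I) < 3/5 * m has probability at most 25 * D / (4 * m), and \<open>big\<close> says D <=
  2/25 * m.\<close>

lemma heavy_sets_dense:
  fixes x :: "'a \<Rightarrow> nat" and D :: real
  assumes S: "finite S" and k: "2 \<le> k" "k \<le> card S" and D: "\<And>v. v \<in> S \<Longrightarrow> real (x v) \<le> D"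
    and big: "25 / 2 * D * real (card S) \<le> real k * real (sum x S)"
  shows "card S choose k \<le> 2 * card (heavy_sets S k x)"
proof -
  define l where "l = real (card S)"
  define \<sigma> where "\<sigma> = real (sum x S)"
  define C where "C = real (card S choose k)"
  define r where "r = real k / l"
  define m where "m = r * \<sigma>"
  have l0: "l > 0" using k by (simp add: l_def)
  have r0: "r > 0" using k l0 by (simp add: r_def)
  have \<sigma>0: "\<sigma> \<ge> 0" unfolding \<sigma>_def by (rule of_nat_0_le_iff)
  have fin: "finite (nsets S k)" using finite_imp_finite_nsets[OF S] .
  have cN: "real (card (nsets S k)) = C" using S by (simp add: card_nsets C_def)
  have cnt: "real (card {I \<in> nsets S k. T \<subseteq> I}) \<le> r ^ card T * C" if "T \<subseteq> S" "card T \<le> 2" for T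
    using card_nsets_superset[OF S that(1), of k] binomial_diff_le[of "card T" k "card S"] that k
    by (simp add: r_def l_def C_def)
  have cnt1: "real (card {I \<in> nsets S k. v \<in> I}) = r * C" if "v \<in> S" for v
  proof -
    have "card {I \<in> nsets S k. {v} \<subseteq> I} = (card S - 1) choose (k - 1)"
      using card_nsets_superset[OF S, of "{v}" k] that k by simp
    moreover have "k * (card S choose k) = card S * ((card S - 1) choose (k - 1))"
      using times_binomial_minus1_eq[of k "card S"] k by simp
    hence "real k * C = l * real ((card S - 1) choose (k - 1))" unfolding C_def l_def by (metis of_nat_mult)
    ultimately show ?thesis using l0 by (simp add: r_def field_simps)
  qed
  have xI: "real (sum x I) = (\<Sum>v\<in>S. if v \<in> I then real (x v) else 0)" if "I \<in> nsets S k" for I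
  proof -
    have "S \<inter> I = I" using that by (auto simp: nsets_def)
    thus ?thesis using S by (simp add: sum.If_cases)
  qed
  have first: "(\<Sum>I\<in>nsets S k. real (sum x I)) = C * m"
  proof -
    have "(\<Sum>I\<in>nsets S k. real (sum x I)) = (\<Sum>I\<in>nsets S k. \<Sum>v\<in>S. if v \<in> I then real (x v) else 0)"
      by (rule sum.cong) (simp_all add: xI del: of_nat_sum)
    also have "\<dots> = (\<Sum>v\<in>S. \<Sum>I\<in>nsets S k. if v \<in> I then real (x v) else 0)" by (rule sum.swap)
    also have "\<dots> = (\<Sum>v\<in>S. real (x v) * real (card {I \<in> nsets S k. v \<in> I}))"
      using fin by (simp add: sum.inter_filter[symmetric] mult.commute)
    also have "\<dots> = (\<Sum>v\<in>S. real (x v) * (r * C))" by (rule sum.cong) (simp_all add: cnt1)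
    also have "\<dots> = \<sigma> * (r * C)" by (simp add: sum_distrib_right \<sigma>_def)
    finally show ?thesis by (simp add: m_def)
  qed
  have second: "(\<Sum>I\<in>nsets S k. (real (sum x I))\<^sup>2) \<le> C * (r * (D * \<sigma>) + m\<^sup>2)"
  proof -
    have "(\<Sum>I\<in>nsets S k. (real (sum x I))\<^sup>2) = (\<Sum>I\<in>nsets S k. \<Sum>u\<in>S. \<Sum>v\<in>S. if {u, v} \<subseteq> I then real (x u) * real (x v) else 0)"
    proof (rule sum.cong[OF refl])
      fix I assume "I \<in> nsets S k"
      show "(real (sum x I))\<^sup>2 = (\<Sum>u\<in>S. \<Sum>v\<in>S. if {u, v} \<subseteq> I then real (x u) * real (x v) else 0)"
        unfolding power2_eq_square xI[OF \<open>I \<in> nsets S k\<close>] sum_product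
        by (intro sum.cong refl) auto
    qed
    also have "\<dots> = (\<Sum>u\<in>S. \<Sum>I\<in>nsets S k. \<Sum>v\<in>S. if {u, v} \<subseteq> I then real (x u) * real (x v) else 0)"
      by (rule sum.swap)
    also have "\<dots> = (\<Sum>u\<in>S. \<Sum>v\<in>S. \<Sum>I\<in>nsets S k. if {u, v} \<subseteq> I then real (x u) * real (x v) else 0)"
      by (rule sum.cong[OF refl], rule sum.swap)
    also have "\<dots> = (\<Sum>u\<in>S. \<Sum>v\<in>S. real (x u) * real (x v) * real (card {I \<in> nsets S k. {u, v} \<subseteq> I}))"
      using fin by (simp add: sum.inter_filter[symmetric] mult.commute)
    \<comment> \<open>On the diagonal the probability is r, off it at most r^2. The r^2 term is kept
      for u = v as well, so that the double sum factors into \<sigma>^2.\<close>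
    also have "\<dots> \<le> (\<Sum>u\<in>S. \<Sum>v\<in>S. (if u = v then r * C * real (x u) * real (x u) else 0) + r\<^sup>2 * C * (real (x u) * real (x v)))"
    proof (intro sum_mono)
      fix u v assume uv: "u \<in> S" "v \<in> S"
      have C0: "C \<ge> 0" by (simp add: C_def)
      show "real (x u) * real (x v) * real (card {I \<in> nsets S k. {u, v} \<subseteq> I}) \<le>
         (if u = v then r * C * real (x u) * real (x u) else 0) + r\<^sup>2 * C * (real (x u) * real (x v))"
      proof (cases "u = v")
        case True
        hence "real (card {I \<in> nsets S k. {u, v} \<subseteq> I}) = r * C" using cnt1[OF uv(1)] by simp
        thus ?thesis using True C0 by (simp add: mult_ac)
      next
        case False
        hence "real (card {I \<in> nsets S k. {u, v} \<subseteq> I}) \<le> r\<^sup>2 * C" using cnt[of "{u, v}"] uv by (simp add: power2_eq_square)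
        hence "real (x u) * real (x v) * real (card {I \<in> nsets S k. {u, v} \<subseteq> I}) \<le> real (x u) * real (x v) * (r\<^sup>2 * C)"
          by (rule mult_left_mono) simp
        thus ?thesis using False by (simp add: mult_ac)
      qed
    qed
    also have "\<dots> = r * C * (\<Sum>u\<in>S. real (x u) * real (x u)) + r\<^sup>2 * C * \<sigma>\<^sup>2"
      using S by (simp add: sum.distrib sum_distrib_left sum_product \<sigma>_def power2_eq_square mult_ac)
    also have "\<dots> \<le> r * C * (\<Sum>u\<in>S. D * real (x u)) + r\<^sup>2 * C * \<sigma>\<^sup>2"
      using r0 by (intro add_right_mono mult_left_mono sum_mono mult_right_mono D) (auto simp: C_def)
    also have "(\<Sum>u\<in>S. D * real (x u)) = D * \<sigma>" by (simp add: sum_distrib_left \<sigma>_def)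
    finally show ?thesis by (simp add: m_def algebra_simps power_mult_distrib)
  qed
  have var: "(\<Sum>I\<in>nsets S k. (real (sum x I) - m)\<^sup>2) \<le> C * (r * (D * \<sigma>))"
  proof -
    have "(\<Sum>I\<in>nsets S k. (real (sum x I) - m)\<^sup>2) =
        (\<Sum>I\<in>nsets S k. (real (sum x I))\<^sup>2 - 2 * m * real (sum x I) + m\<^sup>2)"
      by (rule sum.cong) (simp_all add: power2_diff algebra_simps del: of_nat_sum)
    also have "\<dots> = (\<Sum>I\<in>nsets S k. (real (sum x I))\<^sup>2) - 2 * m * (\<Sum>I\<in>nsets S k. real (sum x I)) + C * m\<^sup>2"
      by (simp add: sum.distrib sum_subtractf sum_distrib_left cN[unfolded card_nsets[OF S]] card_nsets[OF S] del: of_nat_sum)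
    also have "\<dots> = (\<Sum>I\<in>nsets S k. (real (sum x I))\<^sup>2) - C * m\<^sup>2"
      unfolding first by (simp add: power2_eq_square)
    also have "\<dots> \<le> C * (r * (D * \<sigma>))" using second by (simp add: algebra_simps)
    finally show ?thesis .
  qed
  define L where "L = nsets S k - heavy_sets S k x"
  have hsub: "heavy_sets S k x \<subseteq> nsets S k" by (auto simp: heavy_sets_def)
  have hm: "3 / 5 * real k * real (sum x S) / real (card S) = 3 / 5 * m"
    by (simp add: m_def r_def l_def \<sigma>_def)
  have "real (card L) * (4 / 25 * m\<^sup>2) \<le> C * (r * (D * \<sigma>))"
  proof -
    have "real (card L) * (4 / 25 * m\<^sup>2) = (\<Sum>I\<in>L. (2 / 5 * m)\<^sup>2)" by (simp add: power_mult_distrib power_divide)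
    also have "\<dots> \<le> (\<Sum>I\<in>L. (real (sum x I) - m)\<^sup>2)"
    proof (rule sum_mono)
      fix I assume "I \<in> L"
      hence "real (sum x I) < 3 / 5 * m" unfolding L_def heavy_sets_def hm by auto
      moreover have "m \<ge> 0" using r0 \<sigma>0 by (simp add: m_def)
      ultimately have "2 / 5 * m \<le> m - real (sum x I)" "0 \<le> 2 / 5 * m" by linarith+
      hence "(2 / 5 * m)\<^sup>2 \<le> (m - real (sum x I))\<^sup>2" by (rule power_mono)
      thus "(2 / 5 * m)\<^sup>2 \<le> (real (sum x I) - m)\<^sup>2" by (simp add: power2_commute)
    qed
    also have "\<dots> \<le> (\<Sum>I\<in>nsets S k. (real (sum x I) - m)\<^sup>2)"
      by (rule sum_mono2) (use fin in \<open>auto simp: L_def\<close>)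
    finally show ?thesis using var by linarith
  qed
  hence "(r * \<sigma>) * (real (card L) * (4 / 25 * m)) \<le> (r * \<sigma>) * (C * D)"
    by (simp add: m_def power2_eq_square algebra_simps)
  have "real (card L) \<le> C / 2"
  \<comment> \<open>With zero total weight every k-subset is heavy; otherwise the common factor r *
    \<sigma> can be cancelled.\<close>
  proof (cases "\<sigma> = 0")
    case True
    hence "m = 0" by (simp add: m_def)
    hence "L = {}" unfolding L_def heavy_sets_def hm by (auto simp del: of_nat_sum)
    thus ?thesis by (simp add: C_def)
  next
    case False
    hence \<sigma>p: "\<sigma> > 0" using \<sigma>0 by simp
    have "real (card L) * (4 / 25 * m) \<le> C * D"
      using \<open>(r * \<sigma>) * (real (card L) * (4 / 25 * m)) \<le> (r * \<sigma>) * (C * D)\<close> r0 \<sigma>p by simp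
    also have "\<dots> \<le> C * (2 / 25 * m)"
    proof (rule mult_left_mono)
      show "D \<le> 2 / 25 * m" using big l0 by (simp add: m_def r_def l_def \<sigma>_def field_simps del: of_nat_sum)
    qed (simp add: C_def)
    finally show ?thesis using r0 \<sigma>p by (simp add: m_def)
  qed
  moreover have "real (card L) = C - real (card (heavy_sets S k x))"
    unfolding L_def cN[symmetric] using card_Diff_subset[OF finite_subset[OF hsub fin] hsub] card_mono[OF fin hsub]
    by (simp add: of_nat_diff)
  ultimately show ?thesis unfolding C_def by linarith
qed

section \<open>The greedy colouring\<close>

text \<open>This turns the cost of one class, of order k / sqrt l, into a difference of square
  roots, so that the costs telescope along the greedy removal.\<close>

lemma sqrt_diff_ge:
  fixes l k :: real
  assumes "0 < l" "0 \<le> k" "k \<le> l"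
  shows "k / (2 * sqrt l) \<le> sqrt l - sqrt (l - k)"
proof -
  have "k = (sqrt l - sqrt (l - k)) * (sqrt l + sqrt (l - k))"
    using assms by (simp add: algebra_simps)
  also have "\<dots> \<le> (sqrt l - sqrt (l - k)) * (2 * sqrt l)"
    using assms by (intro mult_left_mono) auto
  finally show ?thesis using assms by (simp add: divide_le_eq)
qed

text \<open>If S spans many E-edges, degrees serve as weights: a heavy I has degree sum at least 6/5
  * k * m / l, and E-edges inside I take back at most 1/5 * k * m / l because l >= 40 * k. So at
  least the fraction k / l of the E-edges disappears. If there are few E-edges, the density bound
  survives the loss of k vertices by itself.\<close>

lemma light_class_step:
  fixes g :: "nat set \<Rightarrow> bool" and E :: "nat set set" and D B :: real
  assumes rich: "richly_independent n k s0 g" and k: "k \<ge> 2" and s0: "40 * real k \<le> s0"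
    and D: "0 \<le> D" "D \<le> real n" and B: "7 * D \<le> B * real k"
    and S: "S \<subseteq> {1..n}" "s0 \<le> real (card S)"
    and deg: "\<And>v. v \<in> S \<Longrightarrow> real (card {e \<in> E \<inter> nsets S 2. v \<in> e}) \<le> D"
  obtains I where "I \<in> nsets S k" "\<forall>e\<in>nsets I 2. \<not> g e"
    "real (card (E \<inter> nsets I 2)) \<le> 8 * (real k)\<^sup>2 * real (card (E \<inter> nsets S 2)) / (real (card S))\<^sup>2"
    "real (card (E \<inter> nsets S 2)) \<le> B * real (card S) \<Longrightarrow>
       real (card (E \<inter> nsets (S - I) 2)) \<le> B * real (card S - k)"
proof -
  define l where "l = real (card S)"
  define m where "m = real (card (E \<inter> nsets S 2))"
  have fS: "finite S" using S finite_subset by blast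
  have kr: "real k \<ge> 2" using k by simp
  have l40: "40 * real k \<le> l" using S s0 by (simp add: l_def)
  have kS: "k \<le> card S" using l40 kr by (simp add: l_def)
  have lk: "real (card S - k) = l - real k" using kS by (simp add: l_def of_nat_diff)
  have l0: "l > 0" using l40 kr by linarith
  have S0: "card S > 0" using l0 by (simp add: l_def)
  have B0: "B \<ge> 0"
  proof (rule ccontr)
    assume "\<not> B \<ge> 0"
    hence "B * real k < 0" using kr by (simp add: mult_less_0_iff)
    thus False using B D by linarith
  qed
  have mono: "card (E \<inter> nsets (S - I) 2) \<le> card (E \<inter> nsets S 2)" for I
    by (rule card_mono) (use finite_imp_finite_nsets[OF fS] nsets_mono[of "S - I" S 2] in auto)
  have light: "\<exists>I\<in>heavy_sets S k x. (\<forall>e\<in>nsets I 2. \<not> g e) \<and>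
      real (card (E \<inter> nsets I 2)) \<le> 8 * (real k)\<^sup>2 * real (card (E \<inter> nsets S 2)) / (real (card S))\<^sup>2"
    if x: "x \<in> {1..n} \<rightarrow>\<^sub>E {..n}" "card S choose k \<le> 2 * card (heavy_sets S k x)" for x
  proof (rule light_independent_set[OF fS])
    show "(real (card S))\<^sup>2 / (8 * (real k)\<^sup>2) \<le> cover_number S (heavy_sets S k x) g"
      using rich x S by (auto simp: richly_independent_def)
  qed (use k S0 in \<open>auto simp: heavy_sets_def\<close>)
  show thesis
  \<comment> \<open>The threshold is the condition \<open>big\<close> of
    \<open>heavy_sets_dense\<close> for the degree sum 2 * m.\<close>
  proof (cases "25 / 4 * D * l \<le> real k * m")
    case True
    define x where "x = (\<lambda>v\<in>{1..n}. card {e \<in> E \<inter> nsets S 2. v \<in> e})"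
    have xS: "x v = card {e \<in> E \<inter> nsets S 2. v \<in> e}" if "v \<in> S" for v using that S by (auto simp: x_def)
    have xn: "x v \<le> n" if "v \<in> {1..n}" for v
    proof (cases "v \<in> S")
      case True
      hence "real (x v) \<le> real n" using deg[OF True] D xS by simp
      thus ?thesis by simp
    next
      case False
      hence "{e \<in> E \<inter> nsets S 2. v \<in> e} = {}" by (auto simp: nsets_def)
      thus ?thesis using that unfolding x_def by (simp only: restrict_apply if_True) simp
    qed
    have sx: "sum x I = (\<Sum>v\<in>I. card {e \<in> E \<inter> nsets S 2. v \<in> e})" if "I \<subseteq> S" for I
      using that by (intro sum.cong refl xS) auto
    have sxS: "real (sum x S) = 2 * m"
      using handshake[OF fS Int_lower2[of E]] by (simp add: sx m_def del: of_nat_sum)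
    have "card S choose k \<le> 2 * card (heavy_sets S k x)"
    proof (rule heavy_sets_dense[OF fS k kS])
      show "real (x v) \<le> D" if "v \<in> S" for v using deg[OF that] xS[OF that] by simp
      show "25 / 2 * D * real (card S) \<le> real k * real (sum x S)"
        unfolding sxS using True by (simp add: l_def)
    qed
    moreover have "x \<in> {1..n} \<rightarrow>\<^sub>E {..n}"
    proof (rule PiE_I)
      fix v assume "v \<in> {1..n}" thus "x v \<in> {..n}" using xn by simp
    next
      fix v assume "v \<notin> {1..n}" thus "x v = undefined" unfolding x_def by (simp only: restrict_apply if_False)
    qed
    ultimately obtain I where I: "I \<in> heavy_sets S k x" "\<forall>e\<in>nsets I 2. \<not> g e"
      "real (card (E \<inter> nsets I 2)) \<le> 8 * (real k)\<^sup>2 * real (card (E \<inter> nsets S 2)) / (real (card S))\<^sup>2"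
      using light by blast
    have Ik: "I \<in> nsets S k" and Ih: "3 / 5 * real k * real (sum x S) / real (card S) \<le> real (sum x I)"
      using I by (auto simp: heavy_sets_def)
    have IS: "I \<subseteq> S" using Ik by (auto simp: nsets_def)
    show thesis
    proof (rule that[OF Ik I(2,3)])
      assume mB: "real (card (E \<inter> nsets S 2)) \<le> B * real (card S)"
      have "real (sum x I) + real (card (E \<inter> nsets (S - I) 2)) \<le> m + real (card (E \<inter> nsets I 2))"
        using edges_after_removal[OF fS IS, of E] unfolding sx[OF IS, symmetric] m_def by linarith
      hence "real (card (E \<inter> nsets (S - I) 2)) \<le> m + 8 * (real k)\<^sup>2 * m / l\<^sup>2 - 6 / 5 * real k * m / l"
        using I(3) Ih unfolding sxS by (simp add: m_def l_def algebra_simps)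
      also have "8 * (real k)\<^sup>2 * m / l\<^sup>2 = (8 * real k / l) * (real k * m / l)"
        by (simp add: power2_eq_square)
      also have "\<dots> \<le> 1 / 5 * (real k * m / l)"
        using l40 l0 by (intro mult_right_mono) (auto simp: m_def divide_le_eq)
      also have "m + 1 / 5 * (real k * m / l) - 6 / 5 * real k * m / l = m / l * (l - real k)"
        using l0 by (simp add: field_simps)
      also have "\<dots> \<le> B * (l - real k)"
        using mB l0 l40 kr by (intro mult_right_mono) (auto simp: m_def l_def divide_le_eq)
      finally show "real (card (E \<inter> nsets (S - I) 2)) \<le> B * real (card S - k)" unfolding lk by simp
    qed
  next
    case False
    \<comment> \<open>Zero weights make all k-subsets heavy, so only lightness is asked of
      I.\<close>
    define x where "x = (\<lambda>v\<in>{1..n}. 0 :: nat)"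
    have "sum x I = 0" if "I \<subseteq> S" for I
      by (rule sum.neutral) (use that S in \<open>auto simp: x_def\<close>)
    hence "heavy_sets S k x = nsets S k" by (auto simp: heavy_sets_def nsets_def simp del: of_nat_sum)
    hence "card S choose k \<le> 2 * card (heavy_sets S k x)" using fS by (simp add: card_nsets)
    moreover have "x \<in> {1..n} \<rightarrow>\<^sub>E {..n}" by (auto simp: x_def)
    ultimately obtain I where I: "I \<in> heavy_sets S k x" "\<forall>e\<in>nsets I 2. \<not> g e"
      "real (card (E \<inter> nsets I 2)) \<le> 8 * (real k)\<^sup>2 * real (card (E \<inter> nsets S 2)) / (real (card S))\<^sup>2"
      using light by blast
    have Ik: "I \<in> nsets S k" using I by (auto simp: heavy_sets_def)
    show thesis
    proof (rule that[OF Ik I(2,3)])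
      \<comment> \<open>The hypothesis 7 * D <= B * k gives m <= 25/28 * B * l, and 25/28 <= 39/40
        leaves room for the loss of k <= l / 40 vertices.\<close>
      have "real k * m \<le> 25 / 4 * D * l" using False by simp
      also have "\<dots> = 25 / 28 * l * (7 * D)" by simp
      also have "\<dots> \<le> 25 / 28 * l * (B * real k)" using B l0 by (intro mult_left_mono) auto
      also have "\<dots> = real k * (25 / 28 * l * B)" by simp
      finally have "m \<le> 25 / 28 * l * B" using kr by simp
      also have "\<dots> \<le> (l - real k) * B" using l40 B0 kr by (intro mult_right_mono) auto
      finally show "real (card (E \<inter> nsets (S - I) 2)) \<le> B * real (card S - k)"
        using mono[of I] unfolding lk m_def by (simp add: mult.commute)
    qed
  qed
qed

text \<open>Classes are removed until fewer than s0 vertices remain. While |S| >= m0 a class spans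
  no E-edge and takes one colour. Below m0 the invariant that S spans at most B * |S| E-edges bounds
  the extra colours of a class by the decrease of 8 * sqrt B * sqrt |S|; the minimum with m0 freezes
  this potential before that.\<close>

lemma greedy_colouring:
  fixes n :: nat and g :: "nat set \<Rightarrow> bool" and E :: "nat set set" and D B a s0 m0 e0 :: real
  defines "H \<equiv> {e \<in> nsets {1..n} 2. g e} \<union> E"
  assumes rich: "richly_independent n k s0 g" and sparse: "locally_sparse n s0 a g"
    and E: "E \<subseteq> nsets {1..n} 2" and k: "k \<ge> 2" and s0: "40 * real k \<le> s0" and a: "a \<ge> 0"
    and D: "0 \<le> D" "D \<le> real n" and B: "7 * D \<le> B * real k" "B \<ge> 0"
    and m0: "8 * (real k)\<^sup>2 * e0 < m0\<^sup>2" "m0 > 0" "e0 \<le> B * (m0 - real k)" and e0: "e0 \<ge> 0"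
    and "S \<subseteq> {1..n}"
    and "\<And>v. v \<in> S \<Longrightarrow> real (card {e \<in> E \<inter> nsets S 2. v \<in> e}) \<le> D"
    and "real (card (E \<inter> nsets S 2)) \<le> e0"
    and "m0 \<le> real (card S) \<or> real (card (E \<inter> nsets S 2)) \<le> B * real (card S)"
  shows "\<exists>q. colourable S H q \<and>
    real q \<le> 2 * a + sqrt (2 * e0) + 1 + real (card S) / real k + 8 * sqrt B * sqrt (min (real (card S)) m0)"
  using assms(16-19)
proof (induction "card S" arbitrary: S rule: less_induct)
  case less
  define l where "l = real (card S)"
  define m where "m = real (card (E \<inter> nsets S 2))"
  have fS: "finite S" using less.prems finite_subset by blast
  have Hn: "H \<subseteq> nsets {1..n} 2" using E by (auto simp: H_def)
  have nosing: "\<forall>v\<in>T. {v} \<notin> H" for T using Hn by (auto simp: nsets_def)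
  show ?case
  proof (cases "l < s0")
    case True
    \<comment> \<open>On small sets the random graph contributes average degree at most 2 * a, and E
      at most sqrt (2 * e0).\<close>
    define d where "d = 2 * a + sqrt (2 * e0)"
    have d0: "d \<ge> 0" using a e0 by (simp add: d_def)
    have "colourable S H (nat \<lfloor>d\<rfloor> + 1)"
    proof (rule colourable_sparse[OF fS nosing d0])
      fix T assume T: "T \<subseteq> S"
      have fT: "finite T" using T fS finite_subset by blast
      have Tn: "T \<subseteq> {1..n}" using T less.prems by auto
      have "real (card T) \<le> s0" using card_mono[OF fS T] True by (simp add: l_def)
      hence 1: "real (card {e \<in> nsets T 2. g e}) \<le> a * real (card T)"
        using sparse Tn by (simp add: locally_sparse_def)
      have "card (E \<inter> nsets T 2) \<le> card (E \<inter> nsets S 2)"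
        by (rule card_mono) (use finite_imp_finite_nsets[OF fS] nsets_mono[OF T] in auto)
      hence 2: "2 * real (card (E \<inter> nsets T 2)) \<le> sqrt (2 * e0) * real (card T)"
        using less.prems(3) by (intro edges_le_sqrt[OF fT]) linarith
      have "H \<inter> nsets T 2 \<subseteq> {e \<in> nsets T 2. g e} \<union> (E \<inter> nsets T 2)" by (auto simp: H_def)
      hence "card (H \<inter> nsets T 2) \<le> card ({e \<in> nsets T 2. g e} \<union> (E \<inter> nsets T 2))"
        by (intro card_mono) (use finite_imp_finite_nsets[OF fT] in auto)
      also have "\<dots> \<le> card {e \<in> nsets T 2. g e} + card (E \<inter> nsets T 2)" by (rule card_Un_le)
      finally have "real (card (H \<inter> nsets T 2)) \<le> real (card {e \<in> nsets T 2. g e}) + real (card (E \<inter> nsets T 2))" by simp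
      thus "2 * real (card (H \<inter> nsets T 2)) \<le> d * real (card T)"
        using 1 2 by (simp add: d_def algebra_simps)
    qed
    moreover have "real (nat \<lfloor>d\<rfloor> + 1) \<le> d + 1" using d0 by linarith
    moreover have "0 \<le> real (card S) / real k" "0 \<le> 8 * sqrt B * sqrt (min (real (card S)) m0)"
      using B m0 by auto
    ultimately have "colourable S H (nat \<lfloor>d\<rfloor> + 1) \<and> real (nat \<lfloor>d\<rfloor> + 1) \<le>
        2 * a + sqrt (2 * e0) + 1 + real (card S) / real k + 8 * sqrt B * sqrt (min (real (card S)) m0)"
      unfolding d_def by linarith
    thus ?thesis by blast
  next
    case False
    obtain I where I: "I \<in> nsets S k" "\<forall>e\<in>nsets I 2. \<not> g e"
      "real (card (E \<inter> nsets I 2)) \<le> 8 * (real k)\<^sup>2 * real (card (E \<inter> nsets S 2)) / (real (card S))\<^sup>2"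
      "real (card (E \<inter> nsets S 2)) \<le> B * real (card S) \<Longrightarrow>
       real (card (E \<inter> nsets (S - I) 2)) \<le> B * real (card S - k)"
      using light_class_step[OF rich k s0 D B(1) less.prems(1) _ less.prems(2)] False by (auto simp: l_def)
    have kr: "real k \<ge> 2" using k by simp
    have l40: "40 * real k \<le> l" using False s0 by linarith
    have kS: "k \<le> card S" using l40 kr by (simp add: l_def)
    have lk: "real (card S - k) = l - real k" using kS by (simp add: l_def of_nat_diff)
    have l0: "l > 0" using l40 kr by linarith
    have IS: "I \<subseteq> S" "finite I" "card I = k" using I by (auto simp: nsets_def)
    have cSI: "card (S - I) = card S - k" using IS by (simp add: card_Diff_subset)
    have mono: "card (E \<inter> nsets (S - I) 2) \<le> card (E \<inter> nsets S 2)"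
      by (rule card_mono) (use finite_imp_finite_nsets[OF fS] nsets_mono[of "S - I" S 2] in auto)
    have HI: "H \<inter> nsets I 2 = E \<inter> nsets I 2" using I(2) by (auto simp: H_def)
    have "\<exists>q. colourable (S - I) H q \<and> real q \<le> 2 * a + sqrt (2 * e0) + 1 + real (card (S - I)) / real k + 8 * sqrt B * sqrt (min (real (card (S - I))) m0)"
    proof (rule less.hyps)
      show "card (S - I) < card S" using cSI k kS by simp
      show "S - I \<subseteq> {1..n}" using less.prems by auto
      show "real (card (E \<inter> nsets (S - I) 2)) \<le> e0" using mono less.prems(3) by linarith
      \<comment> \<open>A set of at least m0 vertices keeps at least m0 - k of them, and e0 <= B *
        (m0 - k) supplies the density invariant when the size crosses m0. From then on
        \<open>light_class_step\<close> maintains it.\<close>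
      show "m0 \<le> real (card (S - I)) \<or> real (card (E \<inter> nsets (S - I) 2)) \<le> B * real (card (S - I))"
      proof (cases "m0 \<le> l")
        case True
        have "real (card (E \<inter> nsets (S - I) 2)) \<le> e0" using mono less.prems(3) by linarith
        also have "\<dots> \<le> B * (m0 - real k)" by (rule m0)
        also have "\<dots> \<le> B * (l - real k)" using True B by (intro mult_left_mono) auto
        finally show ?thesis unfolding cSI lk by simp
      next
        case False
        thus ?thesis using less.prems(4) I(4) unfolding cSI by (auto simp: l_def)
      qed
      fix v assume v: "v \<in> S - I"
      have "card {e \<in> E \<inter> nsets (S - I) 2. v \<in> e} \<le> card {e \<in> E \<inter> nsets S 2. v \<in> e}"
        by (rule card_mono) (use finite_imp_finite_nsets[OF fS] nsets_mono[of "S - I" S 2] in auto)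
      thus "real (card {e \<in> E \<inter> nsets (S - I) 2. v \<in> e}) \<le> D" using less.prems(2)[of v] v by auto
    qed
    then obtain q where q: "colourable (S - I) H q"
      "real q \<le> 2 * a + sqrt (2 * e0) + 1 + (l - real k) / real k + 8 * sqrt B * sqrt (min (l - real k) m0)"
      unfolding cSI lk by blast
    have div: "(l - real k) / real k = l / real k - 1" using kr by (simp add: diff_divide_distrib)
    have step: "\<exists>r. colourable I H r \<and> real r + 8 * sqrt B * sqrt (min (l - real k) m0) \<le> 1 + 8 * sqrt B * sqrt (min l m0)"
    proof (cases "m0 \<le> l")
      case True
      \<comment> \<open>The number of E-edges inside I is below 1, hence zero.\<close>
      have "real (card (E \<inter> nsets I 2)) \<le> 8 * (real k)\<^sup>2 * m / l\<^sup>2" using I(3) by (simp add: m_def l_def)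
      also have "\<dots> \<le> 8 * (real k)\<^sup>2 * e0 / m0\<^sup>2"
        using less.prems(3) True m0 e0 by (intro frac_le mult_left_mono power_mono) (auto simp: m_def)
      also have "\<dots> < 1" using m0 by simp
      finally have "real (card (H \<inter> nsets I 2)) \<le> 0" unfolding HI by simp
      from colourable_few_edges[OF IS(2) nosing this] have "colourable I H 1" by simp
      moreover have "sqrt B * sqrt (min (l - real k) m0) \<le> sqrt B * sqrt (min l m0)"
        using B kr by (intro mult_left_mono real_sqrt_le_mono) auto
      ultimately show ?thesis by (intro exI[of _ 1]) auto
    next
      case False
      hence mB: "m \<le> B * l" using less.prems(4) by (simp add: m_def l_def)
      define M where "M = 8 * (real k)\<^sup>2 * m / l\<^sup>2"
      have "real (card (H \<inter> nsets I 2)) \<le> M" unfolding HI using I(3) by (simp add: M_def m_def l_def)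
      from colourable_few_edges[OF IS(2) nosing this] have col: "colourable I H (nat \<lfloor>sqrt (2 * M)\<rfloor> + 1)" .
      \<comment> \<open>By the invariant I spans at most 8 * k^2 * B / l E-edges, which cost 4 *
        sqrt B * k / sqrt l extra colours; \<open>sqrt_diff_ge\<close> doubles the constant to
        8.\<close>
      have "2 * M \<le> 16 * (real k)\<^sup>2 * (B * l) / l\<^sup>2"
        unfolding M_def using mB by (simp add: divide_right_mono mult_left_mono)
      also have "\<dots> = (4 * sqrt B * real k / sqrt l)\<^sup>2"
        using l0 B by (simp add: power_divide power_mult_distrib power2_eq_square)
      finally have "sqrt (2 * M) \<le> 4 * sqrt B * real k / sqrt l"
        by (rule real_le_lsqrt[rotated]) (use B l0 in auto)
      also have "\<dots> = 8 * sqrt B * (real k / (2 * sqrt l))" by simp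
      also have "\<dots> \<le> 8 * sqrt B * (sqrt l - sqrt (l - real k))"
        using B l0 l40 by (intro mult_left_mono sqrt_diff_ge) auto
      finally have "sqrt (2 * M) \<le> 8 * sqrt B * sqrt l - 8 * sqrt B * sqrt (l - real k)" by (simp add: algebra_simps)
      moreover have "real (nat \<lfloor>sqrt (2 * M)\<rfloor> + 1) \<le> sqrt (2 * M) + 1"
        by (simp add: M_def m_def)
      ultimately show ?thesis using col False kr by (intro exI[of _ "nat \<lfloor>sqrt (2 * M)\<rfloor> + 1"]) (auto simp: min_def)
    qed
    then obtain r where r: "colourable I H r"
      "real r + 8 * sqrt B * sqrt (min (l - real k) m0) \<le> 1 + 8 * sqrt B * sqrt (min l m0)" by blast
    have "colourable ((S - I) \<union> I) H (q + r)" using q(1) r(1) by (rule colourable_Un)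
    moreover have "(S - I) \<union> I = S" using IS by auto
    moreover have "real (q + r) \<le> 2 * a + sqrt (2 * e0) + 1 + l / real k + 8 * sqrt B * sqrt (min l m0)"
      using q(2) r(2) unfolding div by simp
    ultimately show ?thesis unfolding l_def by auto
  qed
qed

text \<open>The greedy colouring requires E-degrees at most D. By the handshake count at most 2 * e0
  / D vertices exceed this, and they receive private colours.\<close>

lemma robust_chromatic_number_le:
  fixes g :: "nat set \<Rightarrow> bool" and E :: "nat set set" and D B a s0 m0 e0 :: real
  assumes rich: "richly_independent n k s0 g" and sparse: "locally_sparse n s0 a g"
    and E: "E \<subseteq> nsets {1..n} 2" and k: "k \<ge> 2" and s0: "40 * real k \<le> s0" and a: "a \<ge> 0"
    and D: "0 < D" "D \<le> real n" and B: "7 * D \<le> B * real k" "2 * e0 \<le> B * real n"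
    and m0: "8 * (real k)\<^sup>2 * e0 < m0\<^sup>2" "m0 > 0" "e0 \<le> B * (m0 - real k)" and e0: "real (card E) \<le> e0"
    and few: "2 * e0 / D \<le> real n / 2"
  shows "real (chromatic_number {1..n} ({e \<in> nsets {1..n} 2. g e} \<union> E)) \<le>
    2 * e0 / D + (2 * a + sqrt (2 * e0) + 1 + real n / real k + 8 * sqrt B * sqrt (min (real n) m0))"
proof -
  define H where "H = {e \<in> nsets {1..n} 2. g e} \<union> E"
  define W where "W = {v \<in> {1..n}. D < real (card {e \<in> E. v \<in> e})}"
  define S where "S = {1..n} - W"
  have Wn: "W \<subseteq> {1..n}" by (auto simp: W_def)
  have fE: "finite E" using E finite_imp_finite_nsets[of "{1..n}" 2] finite_subset by blast
  have fW: "finite W" using Wn finite_subset by blast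
  have e00: "e0 \<ge> 0" using e0 by linarith
  have kr: "real k \<ge> 2" using k by simp
  have B0: "B \<ge> 0"
  proof (rule ccontr)
    assume "\<not> B \<ge> 0"
    hence "B * real k < 0" using kr by (simp add: mult_less_0_iff)
    thus False using B D by linarith
  qed
  have "D * real (card W) = (\<Sum>v\<in>W. D)" by simp
  also have "\<dots> \<le> (\<Sum>v\<in>W. real (card {e \<in> E. v \<in> e}))" by (rule sum_mono) (auto simp: W_def)
  also have "\<dots> \<le> (\<Sum>v\<in>{1..n}. real (card {e \<in> E. v \<in> e}))" by (rule sum_mono2) (use Wn in auto)
  also have "\<dots> = 2 * real (card E)"
    using handshake[of "{1..n}" E] E by (simp flip: of_nat_sum)
  also have "\<dots> \<le> 2 * e0" using e0 by simp
  finally have W: "real (card W) \<le> 2 * e0 / D" using D by (simp add: field_simps)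
  have cS: "real (card S) = real n - real (card W)"
    unfolding S_def using Wn fW card_mono[OF _ Wn] by (simp add: card_Diff_subset of_nat_diff)
  hence cS2: "real n / 2 \<le> real (card S)" using W few by linarith
  have nosing: "\<forall>v\<in>T. {v} \<notin> H" for T using E by (auto simp: H_def nsets_def)
  have "\<exists>q. colourable S H q \<and>
    real q \<le> 2 * a + sqrt (2 * e0) + 1 + real (card S) / real k + 8 * sqrt B * sqrt (min (real (card S)) m0)"
    unfolding H_def
  proof (rule greedy_colouring[OF rich sparse E k s0 a _ _ _ B0 m0 e00])
    show "S \<subseteq> {1..n}" by (auto simp: S_def)
    fix v assume v: "v \<in> S"
    have "card {e \<in> E \<inter> nsets S 2. v \<in> e} \<le> card {e \<in> E. v \<in> e}" by (rule card_mono) (use fE in auto)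
    thus "real (card {e \<in> E \<inter> nsets S 2. v \<in> e}) \<le> D" using v by (auto simp: S_def W_def)
  next
    have "card (E \<inter> nsets S 2) \<le> card E" by (rule card_mono) (use fE in auto)
    thus le: "real (card (E \<inter> nsets S 2)) \<le> e0" using e0 by linarith
    \<comment> \<open>At least n / 2 vertices remain, so the density invariant holds from the start,
      whatever m0 is.\<close>
    have "e0 \<le> B * (real n / 2)" using B by simp
    also have "\<dots> \<le> B * real (card S)" using cS2 B0 by (rule mult_left_mono)
    finally show "m0 \<le> real (card S) \<or> real (card (E \<inter> nsets S 2)) \<le> B * real (card S)" using le by linarith
  qed (use D B in auto)
  then obtain q where q: "colourable S H q"
    "real q \<le> 2 * a + sqrt (2 * e0) + 1 + real (card S) / real k + 8 * sqrt B * sqrt (min (real (card S)) m0)"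
    by blast
  have "colourable (W \<union> S) H (card W + q)"
    by (rule colourable_Un[OF colourable_card[OF fW nosing] q(1)])
  moreover have "W \<union> S = {1..n}" using Wn by (auto simp: S_def)
  ultimately have "chromatic_number {1..n} H \<le> card W + q" using chromatic_number_le by metis
  hence "real (chromatic_number {1..n} H) \<le> real (card W) + real q" by linarith
  moreover have "real (card S) / real k \<le> real n / real k" using cS by (intro divide_right_mono) auto
  moreover have "sqrt B * sqrt (min (real (card S)) m0) \<le> sqrt B * sqrt (min (real n) m0)"
    using B0 cS by (intro mult_left_mono real_sqrt_le_mono) auto
  ultimately show ?thesis using W q(2) unfolding H_def by linarith
qed

section \<open>Asymptotic estimates\<close>

lemma power_minus_one_le:
  fixes b :: real
  assumes "b \<ge> 1"
  shows "b ^ N - 1 \<le> real N * (b - 1) * b ^ (N - 1)"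
proof (cases N)
  case (Suc M)
  have "b ^ N - 1 = (b - 1) * (\<Sum>i<N. b ^ i)" by (rule power_diff_1_eq)
  also have "\<dots> \<le> (b - 1) * (\<Sum>i<N. b ^ (N - 1))"
    using assms by (intro mult_left_mono sum_mono power_increasing) auto
  finally show ?thesis by (simp add: mult_ac)
qed simp

text \<open>A single term of the series of exp j gives j! >= (j / e)^j.\<close>

lemma binomial_le_exp_power:
  assumes "j > 0"
  shows "real (n choose j) \<le> (exp 1 * real n / real j) ^ j"
proof -
  have "real j ^ j / fact j \<le> exp (real j)"
  proof -
    have "(\<Sum>i\<in>{j}. real j ^ i /\<^sub>R fact i) \<le> (\<Sum>i. real j ^ i /\<^sub>R fact i)"
      by (rule sum_le_suminf[OF summable_exp_generic]) auto
    thus ?thesis by (simp add: exp_def divide_inverse mult.commute)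
  qed
  hence f: "real j ^ j \<le> exp (real j) * fact j" by (simp add: divide_le_eq)
  have "real (n choose j) * fact j \<le> real n ^ j"
    using binomial_fact_pow[of n j] by (metis of_nat_fact of_nat_le_iff of_nat_mult of_nat_power)
  hence "real (n choose j) * (fact j * real j ^ j) \<le> real n ^ j * (exp (real j) * fact j)"
    using f mult_mono[of "real (n choose j) * fact j" "real n ^ j" "real j ^ j" "exp (real j) * fact j"]
    by (simp add: mult_ac)
  hence "fact j * (real (n choose j) * real j ^ j) \<le> fact j * (real n ^ j * exp (real j))" by (simp add: mult_ac)
  hence "real (n choose j) * real j ^ j \<le> real n ^ j * exp (real j)" by simp
  also have "exp (real j) = exp 1 ^ j" by (simp add: exp_of_nat_mult[symmetric])
  finally show ?thesis using assms by (simp add: power_divide power_mult_distrib le_divide_eq mult_ac)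
qed

text \<open>Doubled, to match the exponents of sqrt b in \<open>overlap_sum_le\<close>.\<close>

lemma choose_two_shift: "2 * ((j + 2 choose 2) - 1) = j * (j + 3)"
proof -
  have "even ((j + 2) * (j + 1))" by simp
  hence "2 * (j + 2 choose 2) = (j + 2) * (j + 1)" by (simp add: choose_two)
  thus ?thesis by (simp add: algebra_simps)
qed

lemma four_pow_ge_square: "j \<ge> 1 \<Longrightarrow> j\<^sup>2 \<le> (4::nat) ^ (j - 1)"
proof (induction j rule: nat_induct_at_least)
  case (Suc j)
  have "Suc j \<le> 2 * j" using Suc by simp
  hence "(Suc j)\<^sup>2 \<le> (2 * j)\<^sup>2" by (rule power_mono) simp
  also have "\<dots> = 4 * j\<^sup>2" by (simp add: power_mult_distrib)
  also have "\<dots> \<le> 4 * 4 ^ (j - 1)" using Suc by simp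
  also have "\<dots> = 4 ^ (Suc j - 1)" using Suc by (cases j) auto
  finally show ?case .
qed simp

text \<open>The sum is split at J. Up to J the powers of b are moderate, so the bounds on the terms
  decay with ratio 1/2 and the term j = 1, of order p * k^2 / m, governs the total. Beyond J the
  sharper bound on the binomial coefficient makes every term at most R^(J + 1).\<close>

lemma overlap_sum_le:
  fixes k m J :: nat and b p h R :: real
  assumes p: "0 \<le> p" "p \<le> 1 / 2" and b: "b = 1 / (1 - p)" and k: "k \<ge> 2" and m: "m > 0"
    and h: "\<And>j. j \<le> J \<Longrightarrow> sqrt b ^ (j + 4) \<le> h" "4 * ((real k)\<^sup>2 / real m) * h \<le> 1 / 2"
    and R: "exp 1 * real k / real (J + 1) * (real k / real m) * sqrt b ^ (k + 1) \<le> R" "R \<le> 1"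
  shows "overlap_sum k m b \<le> 16 * p * ((real k)\<^sup>2 / real m) + real k * R ^ (J + 1)"
proof -
  define u where "u = (real k)\<^sup>2 / real m"
  define \<beta> where "\<beta> = sqrt b"
  have b1: "b \<ge> 1" and b2: "b \<le> 2" and b0: "b \<ge> 0"
    using p by (auto simp: b field_simps)
  have "b - 1 = b * p" using p by (simp add: b field_simps)
  hence bp: "b - 1 \<le> 2 * p" using b2 p by (simp add: mult_right_mono)
  have \<beta>1: "\<beta> \<ge> 1" and \<beta>b: "\<beta>\<^sup>2 = b" using b1 by (auto simp: \<beta>_def)
  have u0: "u \<ge> 0" by (simp add: u_def)
  have h0: "h \<ge> 0" using h(1)[of 0] b1 by (auto intro: order_trans[rotated])
  have R0: "R \<ge> 0" using R(1) b1 by (auto intro: order_trans[rotated])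
  define t where "t = (\<lambda>j. real ((k - 2) choose j) * (real k / real m) ^ j * (b ^ (((j + 2) choose 2) - 1) - 1))"
  have pw: "b ^ (((j + 2) choose 2) - 1) = (\<beta> ^ (j + 3)) ^ j" for j
  proof -
    have "b ^ (((j + 2) choose 2) - 1) = \<beta> ^ (2 * (((j + 2) choose 2) - 1))" by (simp add: \<beta>b[symmetric] power_mult)
    thus ?thesis unfolding choose_two_shift by (simp add: power_mult[symmetric] mult.commute)
  qed
  have km: "real k * (real k / real m) = u" by (simp add: u_def power2_eq_square)
  have small: "t j \<le> 8 * p * u * (1 / 2) ^ (j - 1)" if j: "1 \<le> j" "j \<le> J" for j
  proof -
    define N where "N = ((j + 2) choose 2) - 1"
    have N2: "2 * N = j * (j + 3)" unfolding N_def by (rule choose_two_shift)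
    have N1: "N \<ge> 1" using N2 j by (cases N) auto
    \<comment> \<open>One factor b is split off so that the remaining exponent is a multiple of j -
      1: the ratio then enters to the power j - 1, and the factor p from b - 1 survives in every
      term.\<close>
    have "2 * (N - 1) = 2 + (j + 4) * (j - 1)" using N2 N1 j by (cases j) (auto simp: algebra_simps)
    hence bN: "b ^ (N - 1) = b * (\<beta> ^ (j + 4)) ^ (j - 1)"
    proof -
      have "b ^ (N - 1) = \<beta> ^ (2 * (N - 1))" by (simp add: \<beta>b[symmetric] power_mult)
      also have "2 * (N - 1) = 2 + (j + 4) * (j - 1)" by fact
      finally show ?thesis by (simp only: power_add power_mult \<beta>b)
    qed
    have "j * (j + 3) \<le> j * (4 * j)" using j by (intro mult_left_mono) auto
    hence "2 * N \<le> 4 * j\<^sup>2" using N2 by (simp add: power2_eq_square)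
    hence "N \<le> 2 * 4 ^ (j - 1)" using four_pow_ge_square[OF j(1)] by linarith
    hence Nr: "real N \<le> 2 * 4 ^ (j - 1)" using of_nat_mono[of N "2 * 4 ^ (j - 1)", where 'a = real] by simp
    have "b ^ N - 1 \<le> real N * (b - 1) * b ^ (N - 1)" by (rule power_minus_one_le[OF b1])
    also have "\<dots> \<le> (2 * 4 ^ (j - 1)) * (2 * p) * (2 * h ^ (j - 1))"
    proof (intro mult_mono Nr bp)
      show "b ^ (N - 1) \<le> 2 * h ^ (j - 1)"
        unfolding bN using h(1)[OF j(2)] b2 b0 \<beta>1 by (intro mult_mono power_mono) (auto simp: \<beta>_def)
    qed (use b1 p h0 in auto)
    also have "\<dots> = 8 * p * (4 * h) ^ (j - 1)" by (simp add: power_mult_distrib)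
    finally have bb: "b ^ N - 1 \<le> 8 * p * (4 * h) ^ (j - 1)" .
    have "real ((k - 2) choose j) \<le> real k ^ j"
    proof -
      have "(k - 2) choose j \<le> ((k - 2) choose j) * fact j" by simp
      also have "\<dots> \<le> (k - 2) ^ j" by (rule binomial_fact_pow)
      also have "\<dots> \<le> k ^ j" by (rule power_mono) auto
      finally have "(k - 2) choose j \<le> k ^ j" .
      thus ?thesis using of_nat_mono[of "(k - 2) choose j" "k ^ j", where 'a = real] by simp
    qed
    hence "real ((k - 2) choose j) * (real k / real m) ^ j \<le> real k ^ j * (real k / real m) ^ j"
      by (rule mult_right_mono) simp
    also have "\<dots> = u ^ j" unfolding power_mult_distrib[symmetric] km ..
    also have "\<dots> = u * u ^ (j - 1)" using j by (cases j) auto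
    finally have ku: "real ((k - 2) choose j) * (real k / real m) ^ j \<le> u * u ^ (j - 1)" .
    have "t j \<le> (u * u ^ (j - 1)) * (8 * p * (4 * h) ^ (j - 1))"
      unfolding t_def N_def[symmetric] by (rule mult_mono[OF ku bb]) (use b1 u0 in \<open>auto simp: one_le_power\<close>)
    also have "\<dots> = 8 * p * u * (4 * u * h) ^ (j - 1)" by (simp add: power_mult_distrib)
    also have "\<dots> \<le> 8 * p * u * (1 / 2) ^ (j - 1)"
      using h(2) p u0 h0 by (intro mult_left_mono power_mono) (auto simp: u_def)
    finally show ?thesis .
  qed
  have large: "t j \<le> R ^ (J + 1)" if j: "J < j" "j \<le> k - 2" for j
  proof -
    have j0: "j > 0" using j by simp
    have "real ((k - 2) choose j) \<le> (exp 1 * real (k - 2) / real j) ^ j" by (rule binomial_le_exp_power[OF j0])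
    also have "\<dots> \<le> (exp 1 * real k / real (J + 1)) ^ j"
      using j by (intro power_mono frac_le mult_left_mono) auto
    finally have c: "real ((k - 2) choose j) \<le> (exp 1 * real k / real (J + 1)) ^ j" .
    have "b ^ (((j + 2) choose 2) - 1) - 1 \<le> (\<beta> ^ (j + 3)) ^ j" unfolding pw by simp
    also have "\<dots> \<le> (\<beta> ^ (k + 1)) ^ j" using j \<beta>1 k by (intro power_mono power_increasing) auto
    finally have "t j \<le> (exp 1 * real k / real (J + 1)) ^ j * (real k / real m) ^ j * (\<beta> ^ (k + 1)) ^ j"
      unfolding t_def using c b1 by (intro mult_mono) (auto simp: one_le_power)
    also have "\<dots> = (exp 1 * real k / real (J + 1) * (real k / real m) * \<beta> ^ (k + 1)) ^ j"
      by (simp only: power_mult_distrib)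
    also have "\<dots> \<le> R ^ j" using R(1) \<beta>1 by (intro power_mono) (auto simp: \<beta>_def)
    also have "\<dots> \<le> R ^ (J + 1)" using R0 R(2) j by (intro power_decreasing) auto
    finally show ?thesis .
  qed
  \<comment> \<open>Two sets meeting only in e share no further pair, so they contribute no
    covariance.\<close>
  have t0: "t 0 = 0" unfolding t_def pw by simp
  have "overlap_sum k m b = (\<Sum>j\<le>k - 2. t j)" by (simp add: overlap_sum_def t_def)
  also have "\<dots> \<le> (\<Sum>j\<le>k - 2. (if 1 \<le> j then 8 * p * u * (1 / 2) ^ (j - 1) else 0) + (if 1 \<le> j then R ^ (J + 1) else 0))"
  proof (rule sum_mono)
    fix j assume j: "j \<in> {..k - 2}"
    have nn: "8 * p * u * (1 / 2) ^ (j - 1) \<ge> 0" "R ^ (J + 1) \<ge> 0" using p u0 R0 by auto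
    show "t j \<le> (if 1 \<le> j then 8 * p * u * (1 / 2) ^ (j - 1) else 0) + (if 1 \<le> j then R ^ (J + 1) else 0)"
    proof (cases "1 \<le> j")
      case True
      thus ?thesis using small[of j] large[of j] j nn by (cases "j \<le> J") auto
    next
      case False
      hence "j = 0" by simp
      thus ?thesis using t0 by simp
    qed
  qed
  also have "\<dots> = 8 * p * u * (\<Sum>j\<in>{1..k - 2}. (1 / 2) ^ (j - 1)) + real (k - 2) * R ^ (J + 1)"
  proof -
    have "{j \<in> {..k - 2}. 1 \<le> j} = {1..k - 2}" by auto
    thus ?thesis by (simp add: sum.distrib sum.inter_filter[symmetric] sum_distrib_left)
  qed
  also have "\<dots> \<le> 8 * p * u * 2 + real k * R ^ (J + 1)"
  proof (intro add_mono mult_left_mono mult_right_mono)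
    have "(\<Sum>j\<in>{1..k - 2}. (1 / 2) ^ (j - 1)) = (\<Sum>j<k - 2. (1 / 2 :: real) ^ j)"
      by (rule sum.reindex_bij_witness[of _ Suc "\<lambda>j. j - 1"]) auto
    also have "\<dots> \<le> 2" by (simp add: sum_gp_strict)
    finally show "(\<Sum>j\<in>{1..k - 2}. (1 / 2 :: real) ^ (j - 1)) \<le> 2" .
  qed (use p u0 R0 in auto)
  finally show ?thesis by (simp add: u_def)
qed


lemma ln_base_bounds:
  fixes p :: real
  assumes "0 < p" "p \<le> 1 / 2"
  shows "p \<le> ln (1 / (1 - p))" "ln (1 / (1 - p)) \<le> 2 * p"
proof -
  have "ln (1 - p) \<le> (1 - p) - 1" using assms by (intro ln_le_minus_one) auto
  thus "p \<le> ln (1 / (1 - p))" using assms by (simp add: ln_div)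
  have "ln (1 / (1 - p)) \<le> 1 / (1 - p) - 1" using assms by (intro ln_le_minus_one) auto
  also have "\<dots> = 1 / (1 - p) * p" using assms by (simp add: field_simps)
  also have "\<dots> \<le> 2 * p" using assms by (intro mult_right_mono) (auto simp: field_simps)
  finally show "ln (1 / (1 - p)) \<le> 2 * p" .
qed

text \<open>The last bound is where the exponent -1/3 is decisive: n * p^3 exceeds a fixed positive
  power of n. The others use only p >= n^(-1/3) and p <= 1/2.\<close>

lemma density_bounds:
  fixes p \<delta> :: real
  assumes n: "n \<ge> 1" and \<delta>: "\<delta> > 0" and p: "real n powr (- 1 / 3 + \<delta>) \<le> p" "p \<le> 1 / 2"
  shows "0 < p" "real n powr (- 1 / 3) \<le> p" "real n powr (2 / 3) \<le> real n * p"
    "2 / 3 * ln (real n) \<le> ln (real n * p)" "ln (real n * p) \<le> ln (real n)"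
    "real n powr (3 * \<delta>) \<le> real n * p ^ 3"
proof -
  have n0: "real n > 0" "real n \<ge> 1" using n by auto
  have "0 < real n powr (- 1 / 3 + \<delta>)" using n0 by simp
  thus p0: "0 < p" using p by linarith
  have "real n powr (- 1 / 3) \<le> real n powr (- 1 / 3 + \<delta>)" using n0 \<delta> by (intro powr_mono) auto
  thus p3: "real n powr (- 1 / 3) \<le> p" using p by linarith
  have "real n powr (2 / 3) = real n powr 1 * real n powr (- 1 / 3)"
    using powr_add[of "real n" 1 "- 1 / 3"] by simp
  also have "\<dots> \<le> real n * p" using p3 n0 by simp
  finally show np: "real n powr (2 / 3) \<le> real n * p" .
  have "ln (real n powr (2 / 3)) \<le> ln (real n * p)" using np n0 p0 by (subst ln_le_cancel_iff) auto
  thus "2 / 3 * ln (real n) \<le> ln (real n * p)" using n0 by (simp add: ln_powr)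
  have "real n * p \<le> real n" using n0 p p0 by (simp add: mult_left_le)
  thus "ln (real n * p) \<le> ln (real n)" using n0 p0 by simp
  have "real n powr (3 * \<delta>) = real n powr 1 * (real n powr (- 1 / 3 + \<delta>)) powr 3"
    using powr_add[of "real n" 1 "3 * \<delta> - 1"] by (simp add: powr_powr algebra_simps)
  also have "\<dots> = real n * (real n powr (- 1 / 3 + \<delta>)) ^ 3" using n0 by (simp add: powr_numeral)
  also have "\<dots> \<le> real n * p ^ 3" using p n0 by (intro mult_left_mono power_mono) auto
  finally show "real n powr (3 * \<delta>) \<le> real n * p ^ 3" .
qed

text \<open>\<open>overlap_sum_le\<close> with J about ln n / (6 * ln b) and R = n^(-\<eta>/2).
  Small overlaps contribute at most 16 * p * k^4 / m <= 256 * (ln n)^6 / (n * p^3). For large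
  overlaps the margin \<eta> below 2 * log_b (n * p) gives sqrt b ^ k <= (n * p)^(1 - \<eta>), a
  gain of (n * p)^(-\<eta>).\<close>

lemma overlap_sum_small:
  fixes p \<delta> \<eta> b :: real and n k m :: nat
  assumes \<delta>: "\<delta> > 0" and p: "real n powr (- 1 / 3 + \<delta>) \<le> p" "p \<le> 1 / 2" and b: "b = 1 / (1 - p)"
    and \<eta>: "0 < \<eta>" "\<eta> < 1" and k: "k \<ge> 2" "real k \<le> 2 * (1 - \<eta>) * (ln (real n * p) / ln b)" "k \<le> n"
    and m: "real n / ln (real n) ^ 2 \<le> real m" and n: "n \<ge> 1" "ln (real n) \<ge> 1000"
    and large: "256 * ln (real n) ^ 6 * real n powr (- 3 * \<delta>) \<le> 1 / 20"
      "16 * ln (real n) ^ 4 * real n powr (- 1 / 4) \<le> 1 / 2"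
      "168 * ln (real n) ^ 3 * real n powr (- 2 / 3 * \<eta>) \<le> real n powr (- \<eta> / 2)"
      "real n ^ 3 * real n powr (- \<eta> / 2 * (ln (real n) / 7)) \<le> 1 / 20"
  shows "(real k)\<^sup>2 * overlap_sum k m b \<le> 1 / 10"
proof -
  define L where "L = ln (real n)"
  define c where "c = ln b"
  define P where "P = real n * p"
  note dens = density_bounds[OF n(1) \<delta> p]
  have p0: "p > 0" by (rule dens)
  have n0: "real n > 0" "real n \<ge> 1" using n by auto
  have P0: "P > 0" using n0 p0 by (simp add: P_def)
  have L: "L \<ge> 1000" using n by (simp add: L_def)
  have c: "p \<le> c" "c \<le> 2 * p" using ln_base_bounds[OF p0 p(2)] by (auto simp: c_def b)
  have c0: "c > 0" using c p0 by linarith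
  have b0: "b > 0" using p by (simp add: b)
  have "real n / L\<^sup>2 > 0" using n0 L by simp
  hence m0: "real m > 0" using m unfolding L_def by linarith
  have kP: "real k \<le> 2 * (1 - \<eta>) * (ln P / c)" using k by (simp add: P_def c_def)
  have lnP: "0 \<le> ln P" "ln P \<le> L" "2 / 3 * L \<le> ln P" using dens L unfolding P_def L_def by linarith+
  have kL': "real k \<le> 2 * (L / c)"
  proof -
    have "2 * (1 - \<eta>) * (ln P / c) \<le> 2 * (L / c)"
      using lnP c0 \<eta> by (intro mult_mono divide_right_mono) auto
    thus ?thesis using kP by linarith
  qed
  have "L / c \<le> L / p" using c p0 L by (intro divide_left_mono) auto
  hence kL: "real k \<le> 2 * L / p" using kL' by simp
  have im: "1 / real m \<le> L\<^sup>2 / real n"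
  proof -
    have "real n / L\<^sup>2 > 0" using n0 L by simp
    hence "1 / real m \<le> 1 / (real n / L\<^sup>2)"
      using m by (intro divide_left_mono mult_pos_pos[OF m0]) (auto simp: L_def)
    thus ?thesis by simp
  qed
  have sb: "sqrt b ^ i = exp (real i * (c / 2))" for i
  proof -
    have "exp (ln (sqrt b)) = sqrt b" using b0 by simp
    hence "sqrt b = exp (c / 2)" using b0 by (simp add: ln_sqrt c_def)
    thus ?thesis by (simp add: exp_of_nat_mult[symmetric])
  qed
  define \<kappa> where "\<kappa> = L / c"
  have "L / (2 * p) \<le> \<kappa>" unfolding \<kappa>_def using c c0 L by (intro divide_left_mono) auto
  moreover have "L \<le> L / (2 * p)" using p p0 L by (simp add: le_divide_eq)
  ultimately have \<kappa>L: "L \<le> \<kappa>" by linarith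
  have \<kappa>c: "\<kappa> * c = L" using c0 by (simp add: \<kappa>_def)
  \<comment> \<open>The shift by 4 gives (j + 4) * ln b / 2 <= ln n / 12 for all j <= J, which
    explains h = n^(1/12).\<close>
  define J where "J = nat \<lfloor>\<kappa> / 6\<rfloor> - 4"
  have fl: "real (nat \<lfloor>\<kappa> / 6\<rfloor>) \<le> \<kappa> / 6" "\<kappa> / 6 - 1 \<le> real (nat \<lfloor>\<kappa> / 6\<rfloor>)" using \<kappa>L L by linarith+
  have "4 \<le> nat \<lfloor>\<kappa> / 6\<rfloor>" using \<kappa>L L by (simp add: le_nat_iff le_floor_iff)
  hence J: "real J + 4 = real (nat \<lfloor>\<kappa> / 6\<rfloor>)" by (simp add: J_def of_nat_diff)
  have "\<kappa> / 7 \<le> real J + 1" using J fl \<kappa>L L by linarith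
  hence J1: "\<kappa> / 7 \<le> real (J + 1)" by simp
  have "overlap_sum k m b \<le> 16 * p * ((real k)\<^sup>2 / real m) + real k * (real n powr (- \<eta> / 2)) ^ (J + 1)"
  proof (rule overlap_sum_le[where h = "real n powr (1 / 12)"])
    show "sqrt b ^ (j + 4) \<le> real n powr (1 / 12)" if "j \<le> J" for j
    proof -
      have "real (j + 4) \<le> \<kappa> / 6" using that J fl by simp
      hence "real (j + 4) * (c / 2) \<le> \<kappa> / 6 * (c / 2)" using c0 by (intro mult_right_mono) auto
      also have "\<dots> = L / 12" using \<kappa>c by simp
      finally have "exp (real (j + 4) * (c / 2)) \<le> exp (L / 12)" by simp
      thus ?thesis using n0 by (simp add: sb powr_def L_def)
    qed
    show "4 * ((real k)\<^sup>2 / real m) * real n powr (1 / 12) \<le> 1 / 2"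
    proof -
      have "(real k)\<^sup>2 * (1 / real m) \<le> (2 * L / p)\<^sup>2 * (L\<^sup>2 / real n)"
        using kL im by (intro mult_mono power_mono) auto
      also have "\<dots> = 4 * L ^ 4 / (real n * p\<^sup>2)" by (simp add: power_divide power_mult_distrib field_simps eval_nat_numeral)
      also have "\<dots> \<le> 4 * L ^ 4 / (real n powr (1 / 3))"
      proof (rule divide_left_mono)
        have "real n powr (1 / 3) = real n * (real n powr (- 1 / 3))\<^sup>2"
        proof -
          have "(real n powr (- 1 / 3))\<^sup>2 = real n powr (- 2 / 3)"
            using n0 by (simp add: powr_power)
          moreover have "real n powr (1 / 3) = real n * real n powr (- 2 / 3)"
            using powr_add[of "real n" 1 "- 2 / 3"] by simp
          ultimately show ?thesis by (simp only:)
        qed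
        also have "\<dots> \<le> real n * p\<^sup>2" using dens(2) by (intro mult_left_mono power_mono) auto
        finally show "real n powr (1 / 3) \<le> real n * p\<^sup>2" .
      qed (use L n0 p0 in auto)
      finally have "(real k)\<^sup>2 / real m \<le> 4 * L ^ 4 / real n powr (1 / 3)" by simp
      hence "4 * ((real k)\<^sup>2 / real m) * real n powr (1 / 12) \<le> 4 * (4 * L ^ 4 / real n powr (1 / 3)) * real n powr (1 / 12)"
        by (intro mult_right_mono mult_left_mono) auto
      also have "\<dots> = 16 * L ^ 4 * (real n powr (1 / 12) / real n powr (1 / 3))" by simp
      also have "real n powr (1 / 12) / real n powr (1 / 3) = real n powr (- 1 / 4)" by (simp add: powr_diff[symmetric])
      finally show ?thesis using large(2) by (simp add: L_def)
    qed
    show "exp 1 * real k / real (J + 1) * (real k / real m) * sqrt b ^ (k + 1) \<le> real n powr (- \<eta> / 2)"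
    proof -
      \<comment> \<open>From k <= 2 * \<kappa>, J + 1 >= \<kappa> / 7 and e <= 3 the constant is 3 *
        14.\<close>
      have 1: "exp 1 * real k / real (J + 1) \<le> 42"
      proof -
        have "real k \<le> 2 * \<kappa>" using kL' by (simp add: \<kappa>_def)
        also have "\<dots> \<le> 14 * real (J + 1)" using J1 by simp
        finally have "exp 1 * real k \<le> 3 * (14 * real (J + 1))" using exp_le by (intro mult_mono) auto
        thus ?thesis by (simp add: divide_le_eq)
      qed
      have 2: "real k / real m \<le> 2 * L ^ 3 / P"
      proof -
        have "real k * (1 / real m) \<le> (2 * L / p) * (L\<^sup>2 / real n)" using kL im p0 L by (intro mult_mono) auto
        also have "\<dots> = 2 * L ^ 3 / P" by (simp add: P_def power2_eq_square power3_eq_cube mult_ac)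
        finally show ?thesis by simp
      qed
      have 3: "sqrt b ^ (k + 1) \<le> 2 * P powr (1 - \<eta>)"
      proof -
        have "real k * c \<le> 2 * (1 - \<eta>) * (ln P / c) * c" using kP c0 by (intro mult_right_mono) auto
        hence "real k * (c / 2) \<le> (1 - \<eta>) * ln P" using c0 by (simp add: algebra_simps)
        hence "sqrt b ^ k \<le> P powr (1 - \<eta>)" unfolding sb powr_def using P0 by simp
        moreover have "sqrt b \<le> 2"
        proof -
          have "b \<le> 2\<^sup>2" using p by (simp add: b field_simps)
          thus ?thesis by (intro real_le_lsqrt) auto
        qed
        ultimately show ?thesis using b0 by (simp add: mult_mono)
      qed
      have "exp 1 * real k / real (J + 1) * (real k / real m) * sqrt b ^ (k + 1) \<le> 42 * (2 * L ^ 3 / P) * (2 * P powr (1 - \<eta>))"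
        using 1 2 3 b0 P0 L by (intro mult_mono) auto
      also have "\<dots> = 168 * L ^ 3 * (P powr (1 - \<eta>) / P)" by simp
      also have "P powr (1 - \<eta>) / P = P powr (- \<eta>)" using P0 by (simp add: powr_diff powr_minus field_simps)
      also have "P powr (- \<eta>) \<le> (real n powr (2 / 3)) powr (- \<eta>)"
        using dens(3) \<eta> n0 by (intro powr_mono2') (auto simp: P_def)
      also have "(real n powr (2 / 3)) powr (- \<eta>) = real n powr (- 2 / 3 * \<eta>)" by (simp add: powr_powr)
      finally show ?thesis using large(3) L by (simp add: L_def)
    qed
    show "real n powr (- \<eta> / 2) \<le> 1" using n0 \<eta> powr_mono[of "- \<eta> / 2" 0 "real n"] by simp
  qed (use p p0 b k m0 in auto)
  hence "(real k)\<^sup>2 * overlap_sum k m b \<le> (real k)\<^sup>2 * (16 * p * ((real k)\<^sup>2 / real m) + real k * (real n powr (- \<eta> / 2)) ^ (J + 1))"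
    by (rule mult_left_mono) simp
  also have "\<dots> = 16 * p * (real k ^ 4 * (1 / real m)) + real k ^ 3 * (real n powr (- \<eta> / 2)) ^ (J + 1)"
    by (simp add: algebra_simps eval_nat_numeral)
  also have "\<dots> \<le> 1 / 20 + 1 / 20"
  proof (rule add_mono)
    have "16 * p * (real k ^ 4 * (1 / real m)) \<le> 16 * p * ((2 * L / p) ^ 4 * (L\<^sup>2 / real n))"
      using kL im p0 by (intro mult_left_mono mult_mono power_mono) auto
    also have "\<dots> = 256 * L ^ 6 / (real n * p ^ 3)"
      using p0 by (simp add: power_divide power_mult_distrib field_simps eval_nat_numeral)
    also have "\<dots> \<le> 256 * L ^ 6 / real n powr (3 * \<delta>)"
      using dens(6) L n0 p0 by (intro divide_left_mono) auto
    also have "\<dots> = 256 * L ^ 6 * real n powr (- 3 * \<delta>)" by (simp add: powr_minus divide_inverse)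
    finally show "16 * p * (real k ^ 4 * (1 / real m)) \<le> 1 / 20" using large(1) by (simp add: L_def)
    \<comment> \<open>As J + 1 is at least L / 7, this power is smaller than any fixed power of 1 /
      n and beats k^3 <= n^3.\<close>
    have "(real n powr (- \<eta> / 2)) ^ (J + 1) = (real n powr (- \<eta> / 2)) powr real (J + 1)"
      using n0 by (intro powr_realpow[symmetric]) auto
    also have "\<dots> = real n powr (- \<eta> / 2 * real (J + 1))" by (rule powr_powr)
    also have "\<dots> \<le> real n powr (- \<eta> / 2 * (L / 7))"
      using J1 \<kappa>L \<eta> n0 by (intro powr_mono mult_left_mono_neg) auto
    finally have "real k ^ 3 * (real n powr (- \<eta> / 2)) ^ (J + 1) \<le> real n ^ 3 * real n powr (- \<eta> / 2 * (L / 7))"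
      using k by (intro mult_mono power_mono) auto
    thus "real k ^ 3 * (real n powr (- \<eta> / 2)) ^ (J + 1) \<le> 1 / 20" using large(4) by (simp add: L_def)
  qed
  finally show ?thesis by simp
qed

section \<open>Choice of the parameters and the limit\<close>

lemma prob_random_graph:
  "measure_pmf.prob (random_graph n p) A =
     measure_pmf.prob (bernoulli_product (nsets {1..n} 2) p) {g. {e \<in> nsets {1..n} 2. g e} \<in> A}"
  unfolding random_graph_def by (simp add: vimage_def)

text \<open>The budget in units of s: 8 for private colours with D = s / 4, 1 for 2 * a, 3/2 for
  sqrt (2 * s^2), 1 for the additive constant, 8/10 for k falling short of 2 * L, and 18.4 for
  E-edges inside classes. The total 30.7 is below the 32 that are allowed.\<close>

lemma robust_bound_of_pseudorandom:
  fixes \<epsilon> p s0 a L :: real and n k :: nat and g :: "nat set \<Rightarrow> bool" and E :: "nat set set"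
  assumes \<epsilon>: "\<epsilon> > 0" and n: "n \<ge> 1" and L: "L > 0" "2 * \<epsilon> \<le> L"
    and k: "k \<ge> 2" "real k \<le> 2 * L" "198 / 100 * L \<le> real k" "real n / real k \<le> real n / (2 * L) * (1 + \<epsilon> / 40)"
    and s0: "40 * real k \<le> s0" and a: "0 \<le> a" "2 * a \<le> \<epsilon> * real n / (64 * L)" and s: "64 * L \<le> \<epsilon> * real n"
    and rich: "richly_independent n k s0 g" and sparse: "locally_sparse n s0 a g"
    and E: "E \<subseteq> nsets {1..n} 2" "real (card E) \<le> 1 / 2 ^ 12 * \<epsilon>\<^sup>2 * ((real n)\<^sup>2 / L\<^sup>2)"
  shows "real (chromatic_number {1..n} ({e \<in> nsets {1..n} 2. g e} \<union> E)) \<le> (1 + \<epsilon>) * (real n / (2 * L))"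
proof -
  \<comment> \<open>The bound on \<open>card E\<close> is \<open>s\<^sup>2\<close>, and \<open>32 * s\<close> is the number of colours beyond \<open>n / (2 * L)\<close> that
    are allowed.\<close>
  define s where "s = \<epsilon> * real n / (64 * L)"
  \<comment> \<open>With \<epsilon> * n = 64 * L * s and k <= 2 * L, classes are free of E-edges
    once m0^2 > 32 * L^2 * s^2, and (64 / 11)^2 > 32.\<close>
  define m0 where "m0 = \<epsilon> * real n / 11"
  \<comment> \<open>The first entry is what \<open>light_class_step\<close> needs for D = s / 4, the
    second is the initial density of E on n / 2 vertices.\<close>
  define B where "B = max (7 * (s / 4) / real k) (2 * s\<^sup>2 / real n)"
  have n0: "real n > 0" using n by simp
  have k0: "real k > 0" using k by simp
  have s1: "s \<ge> 1" using s L by (simp add: s_def le_divide_eq)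
  have en: "\<epsilon> * real n = 64 * L * s" using L by (simp add: s_def)
  have e0: "1 / 2 ^ 12 * \<epsilon>\<^sup>2 * ((real n)\<^sup>2 / L\<^sup>2) = s\<^sup>2"
    by (simp add: s_def power_divide power_mult_distrib)
  have B0: "B \<ge> 0" unfolding B_def using s1 by (intro max.coboundedI1) auto
  have "real (chromatic_number {1..n} ({e \<in> nsets {1..n} 2. g e} \<union> E)) \<le>
    2 * s\<^sup>2 / (s / 4) + (2 * a + sqrt (2 * s\<^sup>2) + 1 + real n / real k + 8 * sqrt B * sqrt (min (real n) m0))"
  proof (rule robust_chromatic_number_le[OF rich sparse E(1) k(1) s0 a(1)])
    show "0 < s / 4" using s1 by simp
    have sn: "64 * s \<le> real n / 2"
    proof -
      have "64 * s * L = \<epsilon> * real n" using en by simp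
      also have "\<dots> \<le> L / 2 * real n" using L by (intro mult_right_mono) auto
      finally have "64 * s * L \<le> real n / 2 * L" by (simp add: mult.commute)
      thus ?thesis using L by simp
    qed
    thus "s / 4 \<le> real n" using s1 by linarith
    have "7 * (s / 4) / real k \<le> B" by (simp add: B_def)
    thus "7 * (s / 4) \<le> B * real k" using k0 by (simp add: divide_le_eq)
    have "2 * s\<^sup>2 / real n \<le> B" by (simp add: B_def)
    thus "2 * s\<^sup>2 \<le> B * real n" using n0 by (simp add: divide_le_eq)
    show "m0 > 0" using \<epsilon> n0 by (simp add: m0_def)
    show "8 * (real k)\<^sup>2 * s\<^sup>2 < m0\<^sup>2"
    proof -
      have "8 * (real k)\<^sup>2 * s\<^sup>2 \<le> 8 * (2 * L)\<^sup>2 * s\<^sup>2" using k by (intro mult_right_mono mult_left_mono power_mono) auto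
      also have "\<dots> < (64 * L * s / 11)\<^sup>2" using L s1 by (simp add: power_divide power_mult_distrib)
      finally show ?thesis by (simp add: m0_def en)
    qed
    show "s\<^sup>2 \<le> B * (m0 - real k)"
    proof -
      have "m0 - real k \<ge> 64 * L * s / 11 - 2 * L" using k by (simp add: m0_def en)
      moreover have "64 * L * s / 11 - 2 * L \<ge> 4 * L * s / 3"
      proof -
        have "2 * L * 1 \<le> 2 * L * s" using s1 L by (intro mult_left_mono) auto
        moreover have "64 * L * s / 11 - 2 * (L * s) \<ge> 4 * L * s / 3" using L s1 by simp
        ultimately show ?thesis by simp
      qed
      ultimately have m: "m0 - real k \<ge> 4 * L * s / 3" by linarith
      have "7 * (s / 4) / (2 * L) \<le> 7 * (s / 4) / real k" using s1 k k0 by (intro divide_left_mono) auto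
      hence BL: "7 * s / (8 * L) \<le> B" by (simp add: B_def)
      have "s\<^sup>2 \<le> 7 * s / (8 * L) * (4 * L * s / 3)" using L s1 by (simp add: power2_eq_square)
      also have "\<dots> \<le> B * (m0 - real k)" using BL m B0 L s1 by (intro mult_mono) auto
      finally show ?thesis .
    qed
    show "real (card E) \<le> s\<^sup>2" using E e0 by simp
    have "2 * s\<^sup>2 / (s / 4) = 8 * s" using s1 by (simp add: power2_eq_square)
    thus "2 * s\<^sup>2 / (s / 4) \<le> real n / 2" using sn s1 by linarith
  qed
  also have "2 * s\<^sup>2 / (s / 4) = 8 * s" using s1 by (simp add: power2_eq_square)
  also have "sqrt (2 * s\<^sup>2) \<le> 3 / 2 * s"
    using s1 by (intro real_le_lsqrt) (auto simp: power_mult_distrib power2_eq_square)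
  also have "8 * sqrt B * sqrt (min (real n) m0) \<le> 184 / 10 * s"
  proof -
    \<comment> \<open>If the second entry of B is larger, the bound n gives 2 * s^2. Otherwise m0
      gives the constant 448 / 87.12, about 5.14 and below 2.3^2; 8 * 2.3 = 18.4.\<close>
    have "B * min (real n) m0 \<le> (23 / 10 * s)\<^sup>2"
    proof (cases "7 * (s / 4) / real k \<le> 2 * s\<^sup>2 / real n")
      case True
      hence "B = 2 * s\<^sup>2 / real n" by (simp add: B_def)
      hence "B * min (real n) m0 \<le> 2 * s\<^sup>2 / real n * real n" using s1 n0 \<epsilon> by (intro mult_mono) (auto simp: m0_def)
      also have "\<dots> \<le> (23 / 10 * s)\<^sup>2" using n0 by (simp add: power_mult_distrib power_divide)
      finally show ?thesis .
    next
      case False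
      hence "B = 7 * (s / 4) / real k" by (simp add: B_def)
      also have "\<dots> \<le> 7 * (s / 4) / (198 / 100 * L)" using s1 k L k0 by (intro divide_left_mono) auto
      finally have "B \<le> 7 * (s / 4) / (198 / 100 * L)" .
      hence "B * min (real n) m0 \<le> 7 * (s / 4) / (198 / 100 * L) * (64 * L * s / 11)"
        using s1 L n0 \<epsilon> by (intro mult_mono) (auto simp: m0_def en)
      also have "\<dots> = 7 * 64 / (4 * (198 / 100) * 11) * s\<^sup>2" using L by (simp add: power2_eq_square field_simps)
      also have "\<dots> \<le> (23 / 10)\<^sup>2 * s\<^sup>2" by (intro mult_right_mono) (auto simp: power2_eq_square)
      finally show ?thesis by (simp only: power_mult_distrib)
    qed
    hence "sqrt (B * min (real n) m0) \<le> 23 / 10 * s" using s1 by (intro real_le_lsqrt) auto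
    thus ?thesis by (simp add: real_sqrt_mult)
  qed
  also have "real n / real k \<le> real n / (2 * L) + 8 / 10 * s"
  proof -
    have "real n / (2 * L) * (1 + \<epsilon> / 40) = real n / (2 * L) + \<epsilon> * real n / (80 * L)" using L by (simp add: field_simps)
    also have "\<epsilon> * real n / (80 * L) = 8 / 10 * s" by (simp add: s_def)
    finally show ?thesis using k(4) by simp
  qed
  finally have "real (chromatic_number {1..n} ({e \<in> nsets {1..n} 2. g e} \<union> E)) \<le>
    8 * s + (2 * a + 3 / 2 * s + 1 + (real n / (2 * L) + 8 / 10 * s) + 184 / 10 * s)" by simp
  also have "\<dots> \<le> real n / (2 * L) + 32 * s" using a(2) s1 unfolding s_def[symmetric] by simp
  also have "\<dots> = (1 + \<epsilon>) * (real n / (2 * L))"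
    unfolding s_def using L by (simp add: field_simps)
  finally show ?thesis .
qed

text \<open>The two union bounds with s0 = n / (ln n)^2, freed of p: k <= 2 * ln n / p and n^2 * p^3
  >= n^(1 + 3 * \<delta>) give the first summand, where 100352 = 16 * 6272, and n * p >= n^(2/3)
  gives the second.\<close>

definition failure_bound :: "real \<Rightarrow> nat \<Rightarrow> real" where
  "failure_bound \<delta> n = 2 ^ n * real (n + 1) ^ n * exp (- (real n powr (1 + 3 * \<delta>) / (100352 * ln (real n) ^ 8)))
     + (exp (real n * exp (- (real n powr (2 / 3) / (ln (real n))\<^sup>2))) - 1)"

text \<open>The power n^(1 + 3 * \<delta>), even divided by (ln n)^8, outgrows the exponent of order
  n * ln n in the number of pairs (S, x).\<close>

lemma failure_bound_tendsto_0:
  assumes "\<delta> > 0"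
  shows "failure_bound \<delta> \<longlonglongrightarrow> 0"
proof -
  have "(\<lambda>n. exp (real n * ln 2 + real n * ln (real n + 1) - real n powr (1 + 3 * \<delta>) / (100352 * ln (real n) ^ 8))) \<longlonglongrightarrow> 0"
    using assms by real_asymp
  moreover have "2 ^ n * real (n + 1) ^ n * exp (- (real n powr (1 + 3 * \<delta>) / (100352 * ln (real n) ^ 8))) =
      exp (real n * ln 2 + real n * ln (real n + 1) - real n powr (1 + 3 * \<delta>) / (100352 * ln (real n) ^ 8))" for n
  proof -
    have "(2 :: real) ^ n = exp (real n * ln 2)" "real (n + 1) ^ n = exp (real n * ln (real n + 1))"
      by (simp_all add: exp_of_nat_mult add.commute)
    thus ?thesis by (simp only: exp_add exp_diff exp_minus divide_inverse)
  qed
  ultimately have 1: "(\<lambda>n. 2 ^ n * real (n + 1) ^ n * exp (- (real n powr (1 + 3 * \<delta>) / (100352 * ln (real n) ^ 8)))) \<longlonglongrightarrow> 0"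
    by simp
  have 2: "(\<lambda>n. exp (real n * exp (- (real n powr (2 / 3) / (ln (real n))\<^sup>2))) - 1) \<longlonglongrightarrow> 0"
    by real_asymp
  show ?thesis unfolding failure_bound_def using tendsto_add[OF 1 2] by simp
qed

text \<open>A statement for a single n. The largeness conditions do not involve p, so they hold
  eventually for any sequence of densities.\<close>

lemma robust_chromatic_probability:
  fixes \<epsilon> \<delta> \<eta> p b :: real and n :: nat
  assumes \<epsilon>: "\<epsilon> > 0" and \<delta>: "\<delta> > 0" and \<eta>: "\<eta> = min \<epsilon> 1 / 200"
    and p: "real n powr (- 1 / 3 + \<delta>) \<le> p" "p \<le> 1 / 2" and b: "b = 1 / (1 - p)"
    and n: "n \<ge> 1" "ln (real n) \<ge> 1000" "ln (real n) \<ge> 256 / \<epsilon>" "ln (real n) \<ge> 3 * \<epsilon>" "ln (real n) \<ge> 3 / \<eta>"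
    and large: "256 * ln (real n) ^ 6 * real n powr (- 3 * \<delta>) \<le> 1 / 20"
      "16 * ln (real n) ^ 4 * real n powr (- 1 / 4) \<le> 1 / 2"
      "168 * ln (real n) ^ 3 * real n powr (- 2 / 3 * \<eta>) \<le> real n powr (- \<eta> / 2)"
      "real n ^ 3 * real n powr (- \<eta> / 2 * (ln (real n) / 7)) \<le> 1 / 20"
      "80 * ln (real n) ^ 3 \<le> real n powr (2 / 3)"
      "64 * ln (real n) \<le> \<epsilon> * real n powr (2 / 3)"
  shows "measure_pmf.prob (random_graph n p)
            {G. \<forall>E \<subseteq> nsets {1..n} 2.
                  real (card E) \<le> 1 / 2 ^ 12 * \<epsilon>\<^sup>2 * ((real n)\<^sup>2 / (log b (real n * p))\<^sup>2) \<longrightarrow>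
                  real (chromatic_number {1..n} (G \<union> E)) \<le> (1 + \<epsilon>) * (real n / (2 * log b (real n * p)))}
         \<ge> 1 - failure_bound \<delta> n"
proof -
  define L where "L = ln (real n)"
  define \<Lambda> where "\<Lambda> = log b (real n * p)"
  \<comment> \<open>The factor 1 - \<eta> makes large overlaps negligible, while \<eta> is small
    enough for n / k to exceed n / (2 * \<Lambda>) by at most the factor 1 + \<epsilon> /
    40.\<close>
  define k where "k = nat \<lfloor>2 * (1 - \<eta>) * \<Lambda>\<rfloor>"
  define s0 where "s0 = real n / L\<^sup>2"
  define a where "a = 2 * (real n * p / L\<^sup>2)"
  note dens = density_bounds[OF n(1) \<delta> p]
  have p0: "p > 0" by (rule dens)
  have n0: "real n > 0" "real n \<ge> 1" using n by auto
  have L: "L \<ge> 1000" "L \<ge> 256 / \<epsilon>" "L \<ge> 3 * \<epsilon>" "L \<ge> 3 / \<eta>" using n by (auto simp: L_def)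
  have \<eta>0: "0 < \<eta>" "\<eta> \<le> 1 / 200" using \<epsilon> by (auto simp: \<eta>)
  have lnb: "p \<le> ln b" "ln b \<le> 2 * p" using ln_base_bounds[OF p0 p(2)] by (auto simp: b)
  have lnb0: "ln b > 0" using lnb p0 by linarith
  have \<Lambda>_eq: "\<Lambda> = ln (real n * p) / ln b" by (simp add: \<Lambda>_def log_def)
  have \<Lambda>_le: "\<Lambda> \<le> L / p"
    unfolding \<Lambda>_eq using dens(5) lnb p0 L by (intro frac_le) (auto simp: L_def)
  have "2 / 3 * L / (2 * p) \<le> \<Lambda>"
    unfolding \<Lambda>_eq using dens(4) lnb lnb0 L by (intro frac_le) (auto simp: L_def)
  hence \<Lambda>_ge: "L / (3 * p) \<le> \<Lambda>" by simp
  have "2 / 3 * L \<le> L / (3 * p)" using p p0 L by (simp add: le_divide_eq)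
  hence \<Lambda>L: "2 / 3 * L \<le> \<Lambda>" using \<Lambda>_ge by linarith
  hence \<Lambda>0: "\<Lambda> > 0" using L by linarith
  \<comment> \<open>Rounding k down loses at most 1, which a second \<eta> absorbs.\<close>
  have \<eta>\<Lambda>: "1 \<le> 2 * \<eta> * \<Lambda>"
  proof -
    have "2 / 3 * (3 / \<eta>) \<le> \<Lambda>" using \<Lambda>L L by linarith
    hence "\<eta> * (2 / 3 * (3 / \<eta>)) \<le> \<eta> * \<Lambda>" using \<eta>0 by (intro mult_left_mono) auto
    thus ?thesis using \<eta>0 by simp
  qed
  have "0 \<le> 2 * (1 - \<eta>) * \<Lambda>" using \<eta>0 \<Lambda>0 by simp
  hence k_le: "real k \<le> 2 * (1 - \<eta>) * \<Lambda>" and k_ge: "2 * (1 - \<eta>) * \<Lambda> - 1 \<le> real k"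
    unfolding k_def by linarith+
  have k_ge': "2 * (1 - 2 * \<eta>) * \<Lambda> \<le> real k" using k_ge \<eta>\<Lambda> by (simp add: algebra_simps)
  have k2L: "real k \<le> 2 * \<Lambda>"
  proof -
    have "2 * (1 - \<eta>) * \<Lambda> \<le> 2 * \<Lambda>" using \<eta>0 \<Lambda>0 by simp
    thus ?thesis using k_le by linarith
  qed
  have k198: "198 / 100 * \<Lambda> \<le> real k"
  proof -
    have "198 / 100 * \<Lambda> \<le> 2 * (1 - 2 * \<eta>) * \<Lambda>" using \<eta>0 \<Lambda>0 by (intro mult_right_mono) auto
    thus ?thesis using k_ge' by linarith
  qed
  have "2 \<le> real k" using k198 \<Lambda>L L by linarith
  hence k2: "k \<ge> 2" by simp
  have k0: "real k > 0" using k2 by simp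
  have kLp: "real k \<le> 2 * L / p" using k2L \<Lambda>_le by simp
  have nk: "real n / real k \<le> real n / (2 * \<Lambda>) * (1 + \<epsilon> / 40)"
  proof -
    have "1 \<le> (1 + \<epsilon> / 40) * (1 - 2 * \<eta>)"
    proof -
      define \<mu> where "\<mu> = min \<epsilon> 1"
      have \<mu>: "0 < \<mu>" "\<mu> \<le> 1" "\<mu> \<le> \<epsilon>" using \<epsilon> by (auto simp: \<mu>_def)
      have "\<mu> * \<mu> \<le> \<mu>" using \<mu> by (simp add: mult_left_le)
      hence "1 \<le> (1 + \<mu> / 40) * (1 - \<mu> / 100)" using \<mu> by (simp add: algebra_simps)
      also have "\<dots> \<le> (1 + \<epsilon> / 40) * (1 - \<mu> / 100)" using \<mu> by (intro mult_right_mono) auto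
      finally show ?thesis by (simp add: \<eta> \<mu>_def)
    qed
    hence "2 * \<Lambda> * 1 \<le> 2 * \<Lambda> * ((1 + \<epsilon> / 40) * (1 - 2 * \<eta>))" using \<Lambda>0 by (intro mult_left_mono) auto
    also have "\<dots> = (1 + \<epsilon> / 40) * (2 * (1 - 2 * \<eta>) * \<Lambda>)" by simp
    also have "\<dots> \<le> (1 + \<epsilon> / 40) * real k" using k_ge' \<epsilon> by (intro mult_left_mono) auto
    finally have "real n * (2 * \<Lambda>) \<le> real n * ((1 + \<epsilon> / 40) * real k)" by (intro mult_left_mono) auto
    thus ?thesis using k0 \<Lambda>0 by (simp add: field_simps)
  qed
  have L3: "80 * L ^ 3 \<le> real n * p" using dens(3) large(5) by (simp add: L_def)
  have s040: "40 * real k \<le> s0"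
  proof -
    have "80 * L / p \<le> s0"
      unfolding s0_def using L3 L p0 n0 by (simp add: divide_simps power2_eq_square power3_eq_cube mult_ac)
    thus ?thesis using kLp by simp
  qed
  have kn: "k \<le> n"
  proof -
    have "1 \<le> L\<^sup>2" using L by (intro one_le_power) auto
    hence "s0 \<le> real n" unfolding s0_def using n0 by (simp add: divide_le_eq mult_le_cancel_left1)
    hence "real k \<le> real n" using s040 k0 by linarith
    thus ?thesis by simp
  qed
  have \<epsilon>\<Lambda>: "\<epsilon> * real n * p / (64 * L) \<le> \<epsilon> * real n / (64 * \<Lambda>)"
  proof -
    have "\<Lambda> * p \<le> L" using \<Lambda>_le p0 by (simp add: le_divide_eq)
    hence "\<epsilon> * real n * (\<Lambda> * p) \<le> \<epsilon> * real n * L" using \<epsilon> by (intro mult_left_mono) auto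
    thus ?thesis using \<Lambda>0 L by (simp add: divide_simps mult_ac)
  qed
  have a2: "2 * a \<le> \<epsilon> * real n / (64 * \<Lambda>)"
  proof -
    have "256 \<le> \<epsilon> * L" using L \<epsilon> by (simp add: divide_le_eq mult.commute)
    hence "256 * (real n * p) \<le> \<epsilon> * L * (real n * p)" using n0 p0 by (intro mult_right_mono) auto
    hence "2 * a \<le> \<epsilon> * real n * p / (64 * L)"
      unfolding a_def using L by (simp add: divide_simps power2_eq_square mult_ac)
    thus ?thesis using \<epsilon>\<Lambda> by linarith
  qed
  have s1: "64 * \<Lambda> \<le> \<epsilon> * real n"
  proof -
    have "64 * L \<le> \<epsilon> * (real n * p)"
      using large(6) mult_left_mono[OF dens(3), of \<epsilon>] \<epsilon> unfolding L_def by linarith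
    hence "64 * (L / p) \<le> \<epsilon> * real n" using p0 by (simp add: divide_simps mult_ac)
    thus ?thesis using \<Lambda>_le by linarith
  qed
  have kp: "(real k)\<^sup>2 * p \<ge> 1"
  proof -
    have "L / (3 * p) \<le> real k" using k198 \<Lambda>_ge \<Lambda>0 by linarith
    hence "(L / (3 * p))\<^sup>2 * p \<le> (real k)\<^sup>2 * p" using p0 L by (intro mult_right_mono power_mono) auto
    moreover have "(L / (3 * p))\<^sup>2 * p = L * (L / (9 * p))" using p0 by (simp add: power2_eq_square field_simps)
    moreover have "1 * 1 \<le> L * (L / (9 * p))" using L p p0 by (intro mult_mono) (auto simp: le_divide_eq)
    ultimately show ?thesis by linarith
  qed
  let ?P = "measure_pmf.prob (bernoulli_product (nsets {1..n} 2) p)"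
  have "?P {g. \<not> richly_independent n k s0 g} \<le> 2 ^ n * real (n + 1) ^ n * exp (- (s0\<^sup>2 / (6272 * (real k ^ 4 * p))))"
  proof (rule prob_not_richly_independent[OF k2 p0 p(2) kp])
    show "real k \<le> s0" using s040 k0 by linarith
    fix m assume m: "s0 \<le> real m" "m \<le> n"
    show "(real k)\<^sup>2 * overlap_sum k m (1 / (1 - p)) \<le> 1 / 10"
      using m k_le \<eta>0
      by (intro overlap_sum_small[OF \<delta> p refl _ _ k2 _ kn _ n(1,2) large(1-4)]) (auto simp: s0_def L_def \<Lambda>_eq b)
  qed
  also have "\<dots> \<le> 2 ^ n * real (n + 1) ^ n * exp (- (real n powr (1 + 3 * \<delta>) / (100352 * L ^ 8)))"
  proof -
    have "real n powr (1 + 3 * \<delta>) \<le> (real n)\<^sup>2 * p ^ 3"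
    proof -
      have "real n powr (1 + 3 * \<delta>) = real n * real n powr (3 * \<delta>)" using n0 by (simp add: powr_add)
      also have "\<dots> \<le> real n * (real n * p ^ 3)" using dens(6) by (intro mult_left_mono) auto
      finally show ?thesis by (simp add: power2_eq_square)
    qed
    hence "real n powr (1 + 3 * \<delta>) / (100352 * L ^ 8) \<le> (real n)\<^sup>2 * p ^ 3 / (100352 * L ^ 8)"
      using L by (intro divide_right_mono) auto
    also have "\<dots> = s0\<^sup>2 / (6272 * ((2 * L / p) ^ 4 * p))"
      unfolding s0_def using p0 L by (simp add: divide_simps) (simp add: eval_nat_numeral)
    also have "\<dots> \<le> s0\<^sup>2 / (6272 * (real k ^ 4 * p))"
      using kLp p0 k0 L by (intro divide_left_mono mult_left_mono mult_right_mono power_mono) auto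
    finally show ?thesis by simp
  qed
  finally have 1: "?P {g. \<not> richly_independent n k s0 g} \<le> \<dots>" .
  have "?P {g. \<not> locally_sparse n s0 a g} \<le> (1 + exp (- a / 2)) ^ n - 1"
    by (rule prob_not_locally_sparse) (use p p0 in \<open>auto simp: a_def s0_def mult.commute\<close>)
  also have "\<dots> \<le> exp (exp (- a / 2)) ^ n - 1"
    by (intro diff_right_mono power_mono) (auto intro: exp_ge_add_one_self add_nonneg_nonneg)
  also have "\<dots> = exp (real n * exp (- a / 2)) - 1" by (simp add: exp_of_nat_mult)
  also have "\<dots> \<le> exp (real n * exp (- (real n powr (2 / 3) / L\<^sup>2))) - 1"
    using dens(3) L by (auto simp: a_def intro!: mult_left_mono divide_right_mono)
  finally have 2: "?P {g. \<not> locally_sparse n s0 a g} \<le> \<dots>" .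
  have "1 - failure_bound \<delta> n \<le> 1 - (?P {g. \<not> richly_independent n k s0 g} + ?P {g. \<not> locally_sparse n s0 a g})"
    using 1 2 by (simp add: failure_bound_def L_def)
  also have "\<dots> \<le> 1 - ?P ({g. \<not> richly_independent n k s0 g} \<union> {g. \<not> locally_sparse n s0 a g})"
    by (intro diff_left_mono measure_Un_le) auto
  also have "\<dots> = ?P (- ({g. \<not> richly_independent n k s0 g} \<union> {g. \<not> locally_sparse n s0 a g}))"
    by (subst measure_pmf.prob_compl[symmetric]) (auto simp: Compl_eq_Diff_UNIV)
  also have "\<dots> \<le> ?P {g. {e \<in> nsets {1..n} 2. g e} \<in>
            {G. \<forall>E \<subseteq> nsets {1..n} 2.
                  real (card E) \<le> 1 / 2 ^ 12 * \<epsilon>\<^sup>2 * ((real n)\<^sup>2 / \<Lambda>\<^sup>2) \<longrightarrow>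
                  real (chromatic_number {1..n} (G \<union> E)) \<le> (1 + \<epsilon>) * (real n / (2 * \<Lambda>))}}"
  proof (intro measure_pmf.finite_measure_mono subsetI CollectI allI impI)
    fix g E
    assume g: "g \<in> - ({g. \<not> richly_independent n k s0 g} \<union> {g. \<not> locally_sparse n s0 a g})"
      and E: "E \<subseteq> nsets {1..n} 2" "real (card E) \<le> 1 / 2 ^ 12 * \<epsilon>\<^sup>2 * ((real n)\<^sup>2 / \<Lambda>\<^sup>2)"
    show "real (chromatic_number {1..n} ({e \<in> nsets {1..n} 2. g e} \<union> E)) \<le> (1 + \<epsilon>) * (real n / (2 * \<Lambda>))"
    proof (rule robust_bound_of_pseudorandom[OF \<epsilon> n(1) \<Lambda>0 _ k2 k2L k198 nk s040 _ a2 s1 _ _ E])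
      show "2 * \<epsilon> \<le> \<Lambda>" using \<Lambda>L L by linarith
      show "0 \<le> a" using p0 by (simp add: a_def)
    qed (use g in auto)
  qed simp
  finally show ?thesis unfolding prob_random_graph \<Lambda>_def .
qed

theorem theorem1p1:
  fixes \<epsilon> \<delta> :: real and p b :: "nat \<Rightarrow> real"
  assumes "\<epsilon> > 0" and "\<delta> > 0"
    and "\<forall>\<^sub>F n in sequentially. real n powr (- 1 / 3 + \<delta>) \<le> p n \<and> p n \<le> 1 / 2"
    and "\<And>n. b n = 1 / (1 - p n)"
  shows "(\<lambda>n. measure_pmf.prob (random_graph n (p n))
            {G. \<forall>E \<subseteq> nsets {1..n} 2.
                  real (card E) \<le> 1 / 2 ^ 12 * \<epsilon>\<^sup>2 * ((real n)\<^sup>2 / (log (b n) (real n * p n))\<^sup>2) \<longrightarrow>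
                  real (chromatic_number {1..n} (G \<union> E))
                    \<le> (1 + \<epsilon>) * (real n / (2 * log (b n) (real n * p n)))})
         \<longlonglongrightarrow> 1"
    (is "?prob \<longlonglongrightarrow> 1")
proof (rule tendsto_sandwich)
  define \<eta> where "\<eta> = min \<epsilon> 1 / 200"
  have \<eta>: "\<eta> > 0" using assms by (simp add: \<eta>_def)
  have ev1: "\<forall>\<^sub>F n in sequentially. n \<ge> 1" by (rule eventually_ge_at_top)
  have ev2: "\<forall>\<^sub>F n in sequentially. ln (real n) \<ge> c" for c by real_asymp
  have ev3: "\<forall>\<^sub>F n in sequentially. 256 * ln (real n) ^ 6 * real n powr (- 3 * \<delta>) \<le> 1 / 20"
    using assms(2) by real_asymp
  have ev4: "\<forall>\<^sub>F n in sequentially. 16 * ln (real n) ^ 4 * real n powr (- 1 / 4) \<le> 1 / 2" by real_asymp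
  have ev5: "\<forall>\<^sub>F n in sequentially. 168 * ln (real n) ^ 3 * real n powr (- 2 / 3 * \<eta>) \<le> real n powr (- \<eta> / 2)"
    using \<eta> by real_asymp
  have ev6: "\<forall>\<^sub>F n in sequentially. real n ^ 3 * real n powr (- \<eta> / 2 * (ln (real n) / 7)) \<le> 1 / 20"
    using \<eta> by real_asymp
  have ev7: "\<forall>\<^sub>F n in sequentially. 80 * ln (real n) ^ 3 \<le> real n powr (2 / 3)" by real_asymp
  have ev8: "\<forall>\<^sub>F n in sequentially. 64 * ln (real n) \<le> \<epsilon> * real n powr (2 / 3)"
    using assms(1) by real_asymp
  show "\<forall>\<^sub>F n in sequentially. 1 - failure_bound \<delta> n \<le> ?prob n"
    using assms(3) ev1 ev2[of 1000] ev2[of "256 / \<epsilon>"] ev2[of "3 * \<epsilon>"] ev2[of "3 / \<eta>"] ev3 ev4 ev5 ev6 ev7 ev8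
  \<comment> \<open>The bounds on p hold only eventually and are intersected with the growth
    conditions, which concern n alone.\<close>
  proof eventually_elim
    case (elim n)
    show ?case
      by (rule robust_chromatic_probability[OF assms(1,2) \<eta>_def]) (use elim assms(4) in auto)
  qed
  show "(\<lambda>n. 1 - failure_bound \<delta> n) \<longlonglongrightarrow> 1"
    using tendsto_diff[OF tendsto_const failure_bound_tendsto_0[OF assms(2)], of 1] by simp
qed auto

end
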